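(* Let $\mathfrak L$ be an untwisted affine Lie superalgebra with root system $R$, and let $M$ be a simple finite weight $\mathfrak L$-module. Write $R^{in}=R^{in}_M$ and $R^{ln}=R^{ln}_M$. Then for each $\beta\in R_{re}$ one of the following happens: (i) $\beta$ is full-locally nilpotent, equivalently $\beta+\mathbb Z\delta\subseteq R^{ln}$. (ii) $\beta$ is full-injective, equivalently $\beta+\mathbb Z\delta\subseteq R^{in}$. (iii) $\beta$ is down-nilpotent hybrid, equivalently there exist $m\in\mathbb Z$ and $t\in\{-1,0,1\}$ such that, for $\gamma:=\beta+m\delta$, $$\gamma+\mathbb Z^{\ge 1}\delta\subseteq R^{in},\quad \gamma+\mathbb Z^{\le 0}\delta\subseteq R^{ln},\quad -\gamma+\mathbb Z^{\ge t}\delta\subseteq R^{in},\quad -\gamma+\mathbb Z^{\le t-1}\delta\subseteq R^{ln}.$$ (iv) $\beta$ is up-nilpotent hybrid, equivalently there exist $m\in\mathbb Z$ and $t\in\{-1,0,1\}$ such that, for $\eta:=\beta+m\delta$, $$\eta+\mathbb Z^{\le -1}\delta\subseteq R^{in},\quad \eta+\mathbb Z^{\ge 0}\delta\subseteq R^{ln},\quad -\eta+\mathbb Z^{\le -t}\delta\subseteq R^{in},\quad -\eta+\mathbb Z^{\ge 1-t}\delta\subseteq R^{ln}.$$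
   Context: **Untwisted affine Lie superalgebras.** The ground field is $\mathbb C$. Let $\mathfrak g=\mathfrak g_0\oplus\mathfrak g_1$ be a finite dimensional basic classical simple Lie superalgebra with $\mathfrak g_1\neq0$, i.e. of type $A(m,n)$ ($\mathfrak{sl}(m+1,n+1)$, $m>n\ge0$), $A(n,n)$ ($\mathfrak{psl}(n+1,n+1)$, $n\ge1$), $B(m,n)$ ($\mathfrak{osp}(2m+1,2n)$, $m\ge0,n>0$), $C(n)$ ($\mathfrak{osp}(2,2n-2)$, $n\ge2$), $D(m,n)$ ($\mathfrak{osp}(2m,2n)$, $m\ge2,n\ge1$), $D(2,1;\lambda)$ ($\lambda\ne0,-1$), $G(3)$ or $F(4)$. Let $\mathfrak h_0\subseteq\mathfrak g_0$ be the standard Cartan subalgebra, $\dot R\subseteq\mathfrak h_0^*$ the root system of $\mathfrak g$ (with $0\in\dot R$), and $\kappa$ a nondegenerate even supersymmetric invariant bilinear form on $\mathfrak g$. If $\mathfrak g$ is not of type $A(n,n)$: $\mathfrak L=\mathfrak g\otimes\mathbb C[t^{\pm1}]\oplus\mathbb Cc\oplus\mathbb Cd$, $c$ central, $[d,x\otimes t^p]=p\,x\otimes t^p$, $[x\otimes t^p,y\otimes t^q]=[x,y]\otimes t^{p+q}+p\,\kappa(x,y)\delta_{p+q,0}c$; $\mathfrak H=(\mathfrak h_0\otimes1)\oplus\mathbb Cc\oplus\mathbb Cd$. Elements of $\dot R$ are extended to $\mathfrak H$ by $0$ on $c,d$; $\delta\in\mathfrak H^*$ is $0$ on $\mathfrak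 h_0\otimes 1$ and $c$, and $\delta(d)=1$. The root system is $R=\dot R+\mathbb Z\delta$. If $\mathfrak g=\mathfrak{psl}(n+1,n+1)$: let $\delta^*:\mathfrak g\to\mathfrak g$ be $+1$ on the strictly upper block part of $\mathfrak g_1$, $-1$ on the strictly lower block part of $\mathfrak g_1$, $0$ on $\mathfrak g_0$. Then $\mathfrak L=\mathfrak g\otimes\mathbb C[t^{\pm1}]\oplus\mathbb Cc_1\oplus\mathbb Cc_2\oplus\mathbb Cd_1\oplus\mathbb Cd_2$ with $c_1,c_2$ central, $[d_1,d_2]=0$, $[d_1,X\otimes t^m]=2\delta^*(X)\otimes t^m$, $[d_2,X\otimes t^m]=mX\otimes t^m$, $[X\otimes t^m,Y\otimes t^u]=[X,Y]\otimes t^{m+u}+\delta_{m+u,0}\big(\tfrac1{n+1}\kappa(\delta^*(X),Y)c_1+m\,\kappa(X,Y)c_2\big)$; $\mathfrak H=(\mathfrak h_0\otimes1)\oplus\mathbb Cc_1\oplus\mathbb Cc_2\oplus\mathbb Cd_1\oplus\mathbb Cd_2$. With $\dot\epsilon_i$, $\dot\delta_j$ ($1\le i,j\le n+1$) the usual diagonal functionals restricted to $\mathfrak h_0$ (extended by $0$ to $c_i,d_i$), and $\sigma,\delta\in\mathfrak H^*$ vanishing on $\mathfrak h_0\otimes 1,c_1,c_2$ with $\sigma(d_1)=2,\sigma(d_2)=0,\delta(d_1)=0,\delta(d_2)=1$, the root system is $R=\{\dot\epsilon_i-\dot\epsilon_j,\dot\delta_i-\dot\delta_j,\pm(\dot\epsilon_i-\dot\delta_j+\sigma)\}+\mathbb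 Z\delta$. In all cases $0\in R$, $\mathfrak L=\bigoplus_{\alpha\in R}\mathfrak L^\alpha$ is the root space decomposition with respect to $\mathfrak H=\mathfrak L^0$. The form $\kappa$ on $\mathfrak h_0$, together with $(c,d)=1$ (resp. $(c_i,d_j)=\delta_{i,j}$) and all other pairings among these and with $\mathfrak h_0$ zero, gives a nondegenerate symmetric form on $\mathfrak H$ and hence a form $(-,-)$ on $\mathfrak H^*$. Real roots: $R_{re}=\{\alpha\in R:(\alpha,\alpha)\ne0\}$; imaginary roots: $R_{im}=\{\alpha\in R:(\alpha,R)=\{0\}\}=\mathbb Z\delta$. **Modules.** An $\mathfrak L$-module $M$ is a weight module if $M=\bigoplus_{\lambda\in\mathfrak H^*}M^\lambda$, $M^\lambda=\{v: hv=\lambda(h)v\ \forall h\in\mathfrak H\}$; it is a finite weight module if moreover $\dim M^\lambda<\infty$ for all $\lambda$. $R^{in}_M$ (resp. $R^{ln}_M$) is the set of all $\alpha\in R_{re}$ whose nonzero root vectors (nonzero elements of $\mathfrak L^\alpha$) act injectively (resp. locally nilpotently) on $M$. A real root $\alpha$ is full-locally nilpotent if $\alpha+\mathbb Z\delta\subseteq R^{ln}$; full-injective if $\alpha+\mathbb Z\delta\subseteq R^{in}$; up-nilpotent hybrid if there is a positive integer $m$ with $\pm\alpha+\mathbb Z^{\ge m}\delta\subseteq R^{ln}$ and $\pm\alpha+\mathbb Z^{\le -m}\delta\subseteq R^{in}$ (for both signs); down-nilpotent hybrid if there is a positive integer $m$ with $\pm\alpha+\mathbb Z^{\ge m}\delta\subseteq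 R^{in}$ and $\pm\alpha+\mathbb Z^{\le -m}\delta\subseteq R^{ln}$ (for both signs). *)

theory Defs
  imports Complex_Main "HOL-Library.Poly_Mapping" "Jordan_Normal_Form.Matrix"
begin

text \<open>Parities are booleans: \<open>False\<close> is even, \<open>True\<close> is odd, and the sum of \<open>p\<close> and \<open>q\<close> is \<open>p \<noteq> q\<close>.
  All spaces are over the complex numbers. They are whole types; the scalar multiplication and the
  homogeneous parts are record fields.\<close>

definition ksign :: "bool \<Rightarrow> bool \<Rightarrow> complex" where
  "ksign p q = (if p \<and> q then - 1 else 1)"

record 'a super_space =
  smul :: "complex \<Rightarrow> 'a \<Rightarrow> 'a"
  part :: "bool \<Rightarrow> 'a set"

definition super_space :: "('a::ab_group_add, 'z) super_space_scheme \<Rightarrow> bool" where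
  "super_space V \<longleftrightarrow> vector_space (smul V)
     \<and> (\<forall>p. module.subspace (smul V) (part V p))
     \<and> (\<forall>v. \<exists>!(x, y). x \<in> part V False \<and> y \<in> part V True \<and> v = x + y)"

definition graded_subspace :: "('a::ab_group_add, 'z) super_space_scheme \<Rightarrow> 'a set \<Rightarrow> bool" where
  "graded_subspace V W \<longleftrightarrow> module.subspace (smul V) W
     \<and> (\<forall>w\<in>W. \<exists>x \<in> W \<inter> part V False. \<exists>y \<in> W \<inter> part V True. w = x + y)"


section \<open>Basic classical simple Lie superalgebras\<close>

record 'a lie_super = "'a super_space" +
  brkt :: "'a \<Rightarrow> 'a \<Rightarrow> 'a"

definition lie_superalgebra :: "('a::ab_group_add, 'z) lie_super_scheme \<Rightarrow> bool" where
  "lie_superalgebra L \<longleftrightarrow> super_space L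
     \<and> (\<forall>x. Vector_Spaces.linear (smul L) (smul L) (brkt L x))
     \<and> (\<forall>y. Vector_Spaces.linear (smul L) (smul L) (\<lambda>x. brkt L x y))
     \<and> (\<forall>p q. \<forall>x \<in> part L p. \<forall>y \<in> part L q. brkt L x y \<in> part L (p \<noteq> q))
     \<and> (\<forall>p q. \<forall>x \<in> part L p. \<forall>y \<in> part L q.
          brkt L x y = - smul L (ksign p q) (brkt L y x))
     \<and> (\<forall>p q. \<forall>x \<in> part L p. \<forall>y \<in> part L q. \<forall>z.
          brkt L x (brkt L y z) =
            brkt L (brkt L x y) z + smul L (ksign p q) (brkt L y (brkt L x z)))"

definition finite_dimensional :: "('a::ab_group_add, 'z) super_space_scheme \<Rightarrow> 'a set \<Rightarrow> bool" where
  "finite_dimensional V W \<longleftrightarrow> (\<exists>B. finite B \<and> W \<subseteq> module.span (smul V) B)"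

definition simple_lie :: "('a::ab_group_add, 'z) lie_super_scheme \<Rightarrow> bool" where
  "simple_lie L \<longleftrightarrow> (\<exists>x y. brkt L x y \<noteq> 0)
     \<and> (\<forall>I. graded_subspace L I \<and> (\<forall>x. \<forall>y\<in>I. brkt L x y \<in> I) \<longrightarrow> I = {0} \<or> I = UNIV)"

text \<open>A simple Lie superalgebra is classical if its odd part is a completely reducible module over
  its even part.\<close>

definition even_submodule :: "('a::ab_group_add, 'z) lie_super_scheme \<Rightarrow> 'a set \<Rightarrow> bool" where
  "even_submodule L W \<longleftrightarrow> module.subspace (smul L) W \<and> W \<subseteq> part L True
     \<and> (\<forall>x \<in> part L False. \<forall>w\<in>W. brkt L x w \<in> W)"

definition classical :: "('a::ab_group_add, 'z) lie_super_scheme \<Rightarrow> bool" where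
  "classical L \<longleftrightarrow> (\<forall>W. even_submodule L W \<longrightarrow>
     (\<exists>W'. even_submodule L W' \<and> W \<inter> W' = {0} \<and>
        part L True = {w + w' | w w'. w \<in> W \<and> w' \<in> W'}))"

definition basic_form ::
    "('a::ab_group_add, 'z) lie_super_scheme \<Rightarrow> ('a \<Rightarrow> 'a \<Rightarrow> complex) \<Rightarrow> bool" where
  "basic_form L \<kappa> \<longleftrightarrow>
     (\<forall>x. Vector_Spaces.linear (smul L) (*) (\<kappa> x))
     \<and> (\<forall>y. Vector_Spaces.linear (smul L) (*) (\<lambda>x. \<kappa> x y))
     \<and> (\<forall>p q. p \<noteq> q \<longrightarrow> (\<forall>x \<in> part L p. \<forall>y \<in> part L q. \<kappa> x y = 0))
     \<and> (\<forall>p q. \<forall>x \<in> part L p. \<forall>y \<in> part L q. \<kappa> x y = ksign p q * \<kappa> y x)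
     \<and> (\<forall>x y z. \<kappa> (brkt L x y) z = \<kappa> x (brkt L y z))
     \<and> (\<forall>x. (\<forall>y. \<kappa> x y = 0) \<longrightarrow> x = 0)"

text \<open>By Kac's classification, the algebras with this property and with nonzero odd part are exactly
  those of type A(m,n), A(n,n), B(m,n), C(n), D(m,n), D(2,1;lambda), G(3) and F(4).\<close>

definition basic_classical_simple :: "('a::ab_group_add, 'z) lie_super_scheme \<Rightarrow> bool" where
  "basic_classical_simple L \<longleftrightarrow> lie_superalgebra L \<and> finite_dimensional L UNIV
     \<and> simple_lie L \<and> classical L \<and> (\<exists>\<kappa>. basic_form L \<kappa>)"


section \<open>Weights\<close>

text \<open>Functionals on a subspace \<open>H\<close> are represented by functions that vanish outside \<open>H\<close>, so that
  distinct functionals are distinct functions.\<close>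

definition dual_space :: "('a::ab_group_add, 'z) super_space_scheme \<Rightarrow> 'a set \<Rightarrow> ('a \<Rightarrow> complex) set" where
  "dual_space V H = {\<alpha>. (\<forall>x\<in>H. \<forall>y\<in>H. \<alpha> (x + y) = \<alpha> x + \<alpha> y)
     \<and> (\<forall>a. \<forall>x\<in>H. \<alpha> (smul V a x) = a * \<alpha> x) \<and> (\<forall>x. x \<notin> H \<longrightarrow> \<alpha> x = 0)}"

definition root_space ::
    "('a::ab_group_add, 'z) lie_super_scheme \<Rightarrow> 'a set \<Rightarrow> ('a \<Rightarrow> complex) \<Rightarrow> 'a set" where
  "root_space L H \<alpha> = {x. \<forall>h\<in>H. brkt L h x = smul L (\<alpha> h) x}"

text \<open>A Cartan subalgebra of the even part, with its root space decomposition; the root space of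
  the root 0 is the Cartan subalgebra itself.\<close>

definition cartan_subalgebra :: "('a::ab_group_add, 'z) lie_super_scheme \<Rightarrow> 'a set \<Rightarrow> bool" where
  "cartan_subalgebra L H \<longleftrightarrow> module.subspace (smul L) H \<and> H \<subseteq> part L False
     \<and> module.span (smul L) (\<Union>\<alpha> \<in> dual_space L H. root_space L H \<alpha>) = UNIV
     \<and> root_space L H (\<lambda>_. 0) = H"


section \<open>Type A(n,n)\<close>

text \<open>Matrices of size \<open>2 * Suc n\<close> in two by two block form, with square blocks of size \<open>Suc n\<close>.\<close>

definition sl_super :: "nat \<Rightarrow> complex mat set" where
  "sl_super n = {X \<in> carrier_mat (2 * Suc n) (2 * Suc n).
     (\<Sum>i<Suc n. X $$ (i, i)) = (\<Sum>i\<in>{Suc n..<2 * Suc n}. X $$ (i, i))}"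

definition sl_super_part :: "nat \<Rightarrow> bool \<Rightarrow> complex mat set" where
  "sl_super_part n p = {X \<in> sl_super n. \<forall>i < 2 * Suc n. \<forall>j < 2 * Suc n.
     X $$ (i, j) \<noteq> 0 \<longrightarrow> ((i < Suc n) \<noteq> (j < Suc n)) = p}"

text \<open>\<open>\<pi>\<close> identifies \<open>L\<close> with psl(n+1,n+1): it is a surjective homomorphism
  from sl(n+1,n+1) whose kernel is the set of scalar matrices.\<close>

definition psl_presentation ::
    "('a::ab_group_add, 'z) lie_super_scheme \<Rightarrow> nat \<Rightarrow> (complex mat \<Rightarrow> 'a) \<Rightarrow> bool" where
  "psl_presentation L n \<pi> \<longleftrightarrow>
     (\<forall>X \<in> sl_super n. \<forall>Y \<in> sl_super n. \<pi> (X + Y) = \<pi> X + \<pi> Y)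
     \<and> (\<forall>a. \<forall>X \<in> sl_super n. \<pi> (a \<cdot>\<^sub>m X) = smul L a (\<pi> X))
     \<and> (\<forall>p. \<pi> ` sl_super_part n p \<subseteq> part L p)
     \<and> (\<forall>p q. \<forall>X \<in> sl_super_part n p. \<forall>Y \<in> sl_super_part n q.
          brkt L (\<pi> X) (\<pi> Y) = \<pi> (X * Y - ksign p q \<cdot>\<^sub>m (Y * X)))
     \<and> \<pi> ` sl_super n = UNIV
     \<and> {X \<in> sl_super n. \<pi> X = 0} = {a \<cdot>\<^sub>m 1\<^sub>m (2 * Suc n) | a. True}"

definition type_Ann :: "('a::ab_group_add, 'z) lie_super_scheme \<Rightarrow> bool" where
  "type_Ann L \<longleftrightarrow> (\<exists>n\<ge>1. \<exists>\<pi>. psl_presentation L n \<pi>)"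

definition block_sign :: "nat \<Rightarrow> complex mat \<Rightarrow> complex mat" where
  "block_sign n X = mat (2 * Suc n) (2 * Suc n) (\<lambda>(i, j).
     if i < Suc n \<and> Suc n \<le> j then X $$ (i, j)
     else if Suc n \<le> i \<and> j < Suc n then - X $$ (i, j) else 0)"


section \<open>Untwisted affine Lie superalgebras\<close>

text \<open>\<open>cartan_form\<close> and \<open>delta\<close> are only meaningful on \<open>cartan\<close>.\<close>

record 'a affine_super = "'a lie_super" +
  cartan :: "'a set"
  cartan_form :: "'a \<Rightarrow> 'a \<Rightarrow> complex"
  delta :: "'a \<Rightarrow> complex"

text \<open>In both definitions below \<open>\<tau> p x\<close> is \<open>x \<otimes> t\<^sup>p\<close>, and \<open>f :: int \<Rightarrow>\<^sub>0 'g\<close> is the element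
  \<open>\<Sum>p. f p \<otimes> t\<^sup>p\<close> of the loop algebra. Given that the ambient algebra is a Lie superalgebra, the
  listed brackets of homogeneous elements determine the bracket.\<close>

definition loop_sum ::
    "(int \<Rightarrow> 'g \<Rightarrow> 'l::ab_group_add) \<Rightarrow> (int \<Rightarrow>\<^sub>0 'g::ab_group_add) \<Rightarrow> 'l" where
  "loop_sum \<tau> f = (\<Sum>p \<in> Poly_Mapping.keys f. \<tau> p (Poly_Mapping.lookup f p))"

definition affinization ::
    "('g::ab_group_add, 'z) lie_super_scheme \<Rightarrow> 'g set \<Rightarrow> ('g \<Rightarrow> 'g \<Rightarrow> complex)
      \<Rightarrow> (int \<Rightarrow> 'g \<Rightarrow> 'l::ab_group_add) \<Rightarrow> 'l \<Rightarrow> 'l \<Rightarrow> ('l, 'y) affine_super_scheme \<Rightarrow> bool" where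
  "affinization G H0 \<kappa> \<tau> c d L \<longleftrightarrow> lie_superalgebra L
     \<and> (\<forall>p. Vector_Spaces.linear (smul G) (smul L) (\<tau> p))
     \<and> bij (\<lambda>(f, a, b). loop_sum \<tau> f + smul L a c + smul L b d)
     \<and> (\<forall>p r. \<tau> p ` part G r \<subseteq> part L r) \<and> c \<in> part L False \<and> d \<in> part L False
     \<and> (\<forall>v. brkt L c v = 0)
     \<and> (\<forall>p x. brkt L d (\<tau> p x) = smul L (of_int p) (\<tau> p x))
     \<and> (\<forall>p q x y. brkt L (\<tau> p x) (\<tau> q y) = \<tau> (p + q) (brkt G x y)
          + (if p + q = 0 then smul L (of_int p * \<kappa> x y) c else 0))
     \<and> cartan L = {\<tau> 0 h + smul L a c + smul L b d | h a b. h \<in> H0}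
     \<and> (\<forall>h\<in>H0. \<forall>h'\<in>H0. \<forall>a b a' b'.
          cartan_form L (\<tau> 0 h + smul L a c + smul L b d) (\<tau> 0 h' + smul L a' c + smul L b' d)
            = \<kappa> h h' + a * b' + b * a')
     \<and> delta L \<in> dual_space L (cartan L)
     \<and> (\<forall>h\<in>H0. \<forall>a b. delta L (\<tau> 0 h + smul L a c + smul L b d) = b)"

definition affinization_Ann ::
    "nat \<Rightarrow> ('g::ab_group_add, 'z) lie_super_scheme \<Rightarrow> 'g set \<Rightarrow> ('g \<Rightarrow> 'g \<Rightarrow> complex)
      \<Rightarrow> ('g \<Rightarrow> 'g) \<Rightarrow> (int \<Rightarrow> 'g \<Rightarrow> 'l::ab_group_add) \<Rightarrow> 'l \<Rightarrow> 'l \<Rightarrow> 'l \<Rightarrow> 'l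
      \<Rightarrow> ('l, 'y) affine_super_scheme \<Rightarrow> bool" where
  "affinization_Ann n G H0 \<kappa> ds \<tau> c1 c2 d1 d2 L \<longleftrightarrow> lie_superalgebra L
     \<and> (\<forall>p. Vector_Spaces.linear (smul G) (smul L) (\<tau> p))
     \<and> bij (\<lambda>(f, a1, a2, b1, b2).
          loop_sum \<tau> f + smul L a1 c1 + smul L a2 c2 + smul L b1 d1 + smul L b2 d2)
     \<and> (\<forall>p r. \<tau> p ` part G r \<subseteq> part L r) \<and> {c1, c2, d1, d2} \<subseteq> part L False
     \<and> (\<forall>v. brkt L c1 v = 0) \<and> (\<forall>v. brkt L c2 v = 0) \<and> brkt L d1 d2 = 0
     \<and> (\<forall>p x. brkt L d1 (\<tau> p x) = smul L 2 (\<tau> p (ds x)))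
     \<and> (\<forall>p x. brkt L d2 (\<tau> p x) = smul L (of_int p) (\<tau> p x))
     \<and> (\<forall>p q x y. brkt L (\<tau> p x) (\<tau> q y) = \<tau> (p + q) (brkt G x y)
          + (if p + q = 0
             then smul L (\<kappa> (ds x) y / of_nat (n + 1)) c1 + smul L (of_int p * \<kappa> x y) c2
             else 0))
     \<and> cartan L = {\<tau> 0 h + smul L a1 c1 + smul L a2 c2 + smul L b1 d1 + smul L b2 d2
          | h a1 a2 b1 b2. h \<in> H0}
     \<and> (\<forall>h\<in>H0. \<forall>h'\<in>H0. \<forall>a1 a2 b1 b2 a1' a2' b1' b2'.
          cartan_form L
            (\<tau> 0 h + smul L a1 c1 + smul L a2 c2 + smul L b1 d1 + smul L b2 d2)
            (\<tau> 0 h' + smul L a1' c1 + smul L a2' c2 + smul L b1' d1 + smul L b2' d2)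
            = \<kappa> h h' + a1 * b1' + b1 * a1' + a2 * b2' + b2 * a2')
     \<and> delta L \<in> dual_space L (cartan L)
     \<and> (\<forall>h\<in>H0. \<forall>a1 a2 b1 b2.
          delta L (\<tau> 0 h + smul L a1 c1 + smul L a2 c2 + smul L b1 d1 + smul L b2 d2) = b2)"

text \<open>\<open>L\<close> is the untwisted affine Lie superalgebra obtained from \<open>G\<close>, the Cartan subalgebra \<open>H0\<close>
  and the form \<open>\<kappa>\<close>. In type A(n,n), \<open>H0\<close> consists of the (classes of) diagonal matrices and
  \<open>ds\<close> is induced by \<open>block_sign\<close>.\<close>

definition untwisted_affine ::
    "('g::ab_group_add, 'z) lie_super_scheme \<Rightarrow> 'g set \<Rightarrow> ('g \<Rightarrow> 'g \<Rightarrow> complex)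
      \<Rightarrow> ('l::ab_group_add, 'y) affine_super_scheme \<Rightarrow> bool" where
  "untwisted_affine G H0 \<kappa> L \<longleftrightarrow>
     basic_classical_simple G \<and> part G True \<noteq> {0} \<and> cartan_subalgebra G H0 \<and> basic_form G \<kappa>
     \<and> (if \<not> type_Ann G then \<exists>\<tau> c d. affinization G H0 \<kappa> \<tau> c d L
        else \<exists>n\<ge>1. \<exists>\<pi> ds \<tau> c1 c2 d1 d2. psl_presentation G n \<pi>
          \<and> H0 = \<pi> ` {X \<in> sl_super n. diagonal_mat X}
          \<and> (\<forall>X \<in> sl_super n. ds (\<pi> X) = \<pi> (block_sign n X))
          \<and> affinization_Ann n G H0 \<kappa> ds \<tau> c1 c2 d1 d2 L)"


section \<open>Roots\<close>

text \<open>The zero functional is a root. If \<open>L\<close> is untwisted affine and not of type A(n,n), these are the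
  sums of a root of \<open>G\<close> and an integer multiple of \<open>delta\<close>; in type A(n,n) the odd roots carry
  in addition plus or minus sigma, because of the action of \<open>d1\<close>.\<close>

definition roots :: "('l::ab_group_add, 'y) affine_super_scheme \<Rightarrow> ('l \<Rightarrow> complex) set" where
  "roots L = {\<alpha> \<in> dual_space L (cartan L). root_space L (cartan L) \<alpha> \<noteq> {0}}"

definition dual_vector :: "('l::ab_group_add, 'y) affine_super_scheme \<Rightarrow> ('l \<Rightarrow> complex) \<Rightarrow> 'l" where
  "dual_vector L \<alpha> = (THE t. t \<in> cartan L \<and> (\<forall>h \<in> cartan L. cartan_form L t h = \<alpha> h))"

definition dual_form ::
    "('l::ab_group_add, 'y) affine_super_scheme \<Rightarrow> ('l \<Rightarrow> complex) \<Rightarrow> ('l \<Rightarrow> complex) \<Rightarrow> complex" where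
  "dual_form L \<alpha> \<beta> = cartan_form L (dual_vector L \<alpha>) (dual_vector L \<beta>)"

definition real_roots :: "('l::ab_group_add, 'y) affine_super_scheme \<Rightarrow> ('l \<Rightarrow> complex) set" where
  "real_roots L = {\<alpha> \<in> roots L. dual_form L \<alpha> \<alpha> \<noteq> 0}"

definition shift ::
    "('l::ab_group_add, 'y) affine_super_scheme \<Rightarrow> ('l \<Rightarrow> complex) \<Rightarrow> int \<Rightarrow> ('l \<Rightarrow> complex)" where
  "shift L \<alpha> k = (\<lambda>h. \<alpha> h + of_int k * delta L h)"


section \<open>Modules\<close>

record ('l, 'm) super_module = "'m super_space" +
  act :: "'l \<Rightarrow> 'm \<Rightarrow> 'm"

definition lie_module ::
    "('l::ab_group_add, 'y) lie_super_scheme \<Rightarrow> ('l, 'm::ab_group_add, 'x) super_module_scheme \<Rightarrow> bool" where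
  "lie_module L M \<longleftrightarrow> super_space M
     \<and> (\<forall>x. Vector_Spaces.linear (smul M) (smul M) (act M x))
     \<and> (\<forall>v. Vector_Spaces.linear (smul L) (smul M) (\<lambda>x. act M x v))
     \<and> (\<forall>p q. \<forall>x \<in> part L p. \<forall>v \<in> part M q. act M x v \<in> part M (p \<noteq> q))
     \<and> (\<forall>p q. \<forall>x \<in> part L p. \<forall>y \<in> part L q. \<forall>v.
          act M (brkt L x y) v = act M x (act M y v) - smul M (ksign p q) (act M y (act M x v)))"

definition simple_module ::
    "('l::ab_group_add, 'y) lie_super_scheme \<Rightarrow> ('l, 'm::ab_group_add, 'x) super_module_scheme \<Rightarrow> bool" where
  "simple_module L M \<longleftrightarrow> lie_module L M \<and> (\<exists>v::'m. v \<noteq> 0)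
     \<and> (\<forall>W. graded_subspace M W \<and> (\<forall>x. \<forall>v\<in>W. act M x v \<in> W) \<longrightarrow> W = {0} \<or> W = UNIV)"

definition weight_space ::
    "('l::ab_group_add, 'y) affine_super_scheme \<Rightarrow> ('l, 'm::ab_group_add, 'x) super_module_scheme
      \<Rightarrow> ('l \<Rightarrow> complex) \<Rightarrow> 'm set" where
  "weight_space L M \<mu> = {v. \<forall>h \<in> cartan L. act M h v = smul M (\<mu> h) v}"

text \<open>The sum of the weight spaces is automatically direct.\<close>

definition finite_weight_module ::
    "('l::ab_group_add, 'y) affine_super_scheme \<Rightarrow> ('l, 'm::ab_group_add, 'x) super_module_scheme \<Rightarrow> bool" where
  "finite_weight_module L M \<longleftrightarrow> lie_module L M
     \<and> module.span (smul M) (\<Union>\<mu> \<in> dual_space L (cartan L). weight_space L M \<mu>) = UNIV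
     \<and> (\<forall>\<mu> \<in> dual_space L (cartan L). finite_dimensional M (weight_space L M \<mu>))"

definition R_in ::
    "('l::ab_group_add, 'y) affine_super_scheme \<Rightarrow> ('l, 'm::ab_group_add, 'x) super_module_scheme
      \<Rightarrow> ('l \<Rightarrow> complex) set" where
  "R_in L M = {\<alpha> \<in> real_roots L. \<forall>x \<in> root_space L (cartan L) \<alpha>. x \<noteq> 0 \<longrightarrow> inj (act M x)}"

definition R_ln ::
    "('l::ab_group_add, 'y) affine_super_scheme \<Rightarrow> ('l, 'm::ab_group_add, 'x) super_module_scheme
      \<Rightarrow> ('l \<Rightarrow> complex) set" where
  "R_ln L M = {\<alpha> \<in> real_roots L. \<forall>x \<in> root_space L (cartan L) \<alpha>. x \<noteq> 0 \<longrightarrow>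
     (\<forall>v. \<exists>n. (act M x ^^ n) v = 0)}"

definition full_locally_nilpotent ::
    "('l::ab_group_add, 'y) affine_super_scheme \<Rightarrow> ('l, 'm::ab_group_add, 'x) super_module_scheme
      \<Rightarrow> ('l \<Rightarrow> complex) \<Rightarrow> bool" where
  "full_locally_nilpotent L M \<alpha> \<longleftrightarrow> shift L \<alpha> ` UNIV \<subseteq> R_ln L M"

definition full_injective ::
    "('l::ab_group_add, 'y) affine_super_scheme \<Rightarrow> ('l, 'm::ab_group_add, 'x) super_module_scheme
      \<Rightarrow> ('l \<Rightarrow> complex) \<Rightarrow> bool" where
  "full_injective L M \<alpha> \<longleftrightarrow> shift L \<alpha> ` UNIV \<subseteq> R_in L M"

definition up_nilpotent_hybrid ::
    "('l::ab_group_add, 'y) affine_super_scheme \<Rightarrow> ('l, 'm::ab_group_add, 'x) super_module_scheme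
      \<Rightarrow> ('l \<Rightarrow> complex) \<Rightarrow> bool" where
  "up_nilpotent_hybrid L M \<alpha> \<longleftrightarrow> (\<exists>m>0. \<forall>\<gamma> \<in> {\<alpha>, - \<alpha>}.
     shift L \<gamma> ` {m..} \<subseteq> R_ln L M \<and> shift L \<gamma> ` {..- m} \<subseteq> R_in L M)"

definition down_nilpotent_hybrid ::
    "('l::ab_group_add, 'y) affine_super_scheme \<Rightarrow> ('l, 'm::ab_group_add, 'x) super_module_scheme
      \<Rightarrow> ('l \<Rightarrow> complex) \<Rightarrow> bool" where
  "down_nilpotent_hybrid L M \<alpha> \<longleftrightarrow> (\<exists>m>0. \<forall>\<gamma> \<in> {\<alpha>, - \<alpha>}.
     shift L \<gamma> ` {m..} \<subseteq> R_in L M \<and> shift L \<gamma> ` {..- m} \<subseteq> R_ln L M)"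

end

theory Submission
  imports Defs
begin

text \<open>For a real root \<open>\<beta>\<close> with even root vectors the vectors of weight \<open>\<beta> + \<int>\<delta>\<close> and \<open>- \<beta> + \<int>\<delta>\<close> form an
  affine sl2. On a simple module each of them acts either injectively or locally nilpotently, since
  the vectors killed by some power of a root vector form a submodule. Sl2-theory turns this into a
  statement about the support \<open>S\<close> of the module: if \<open>\<alpha>\<close> acts injectively then \<open>S + \<alpha> \<subseteq> S\<close>; if it acts
  locally nilpotently then every ray \<open>\<mu> + \<nat>\<alpha>\<close> meets \<open>S\<close> in a finite set, because highest weight
  vectors arbitrarily far out would make a weight space infinite dimensional; if both \<open>\<alpha>\<close> and \<open>- \<alpha>\<close>
  act locally nilpotently then \<open>S\<close> is invariant under the reflection in \<open>\<alpha>\<close>. What remains is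
  combinatorics of two sets of integers. If \<open>\<beta>\<close> is an odd real root and \<open>x\<close> one of its root vectors,
  then \<open>[x, x] \<noteq> 0\<close> has weight \<open>2\<beta>\<close> and acts as \<open>2 x\<^sup>2\<close>, so \<open>\<beta>\<close> inherits its behaviour from the even
  root \<open>2\<beta>\<close>. No classification is needed: that real root spaces are one-dimensional or odd with
  nonzero squares follows from the invariant form.\<close>


section \<open>Combinatorics of root strings\<close>

text \<open>Injectivity of two root vectors says nothing about their bracket, which may vanish, so
  it cannot be passed from root to root inside the algebra. The support keeps track of it instead.
  Translations that preserve the support can be composed, and a root acts injectively as soon as
  some positive multiple of it is such a translation, because a ray in its direction then meets the
  support infinitely often. Two injective roots \<beta> + k\<delta> and - \<beta> + l\<delta>
  compose to the imaginary translation (k + l)\<delta>. A positive and a negative value of k + l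
  together would make all of \<beta> + \<int>\<delta> injective; otherwise the sign of k + l fixes a
  common direction for both half-lines. The constant 2 comes from one reflection. If
  \<open>A = {a..}\<close> and \<open>B = {b..}\<close> left a gap with a + b > 2, both \<beta> + (a
  - 1)\<delta> and its negative would act nilpotently, and the reflection in this root would carry
  the end point of \<open>A\<close> outside \<open>B\<close>. The three values of t in the theorem
  are the three values of a + b - 1.\<close>

text \<open>Below, \<open>A\<close> and \<open>B\<close> are the sets of all \<open>j\<close> such that \<open>\<beta> + j\<delta>\<close> and \<open>- \<beta> + j\<delta>\<close>,
  respectively, act injectively.\<close>

definition string_type :: "int set \<Rightarrow> int set \<Rightarrow> bool" where
  "string_type A B \<longleftrightarrow> A = {} \<or> A = UNIV
     \<or> (\<exists>a b. A = {a..} \<and> B = {b..} \<and> 0 \<le> a + b \<and> a + b \<le> 2)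
     \<or> (\<exists>a b. A = {..a} \<and> B = {..b} \<and> - 2 \<le> a + b \<and> a + b \<le> 0)"

lemma int_up_closed_eq_atLeast:
  fixes X :: "int set"
  assumes ne: "X \<noteq> {}" and lb: "\<And>x. x \<in> X \<Longrightarrow> c \<le> x"
    and up: "\<And>x y. x \<in> X \<Longrightarrow> x \<le> y \<Longrightarrow> y \<in> X"
  shows "\<exists>a. X = {a..}"
proof -
  obtain x0 where x0: "x0 \<in> X" using ne by blast
  \<comment> \<open>Offsets from the bound \<open>c\<close> are natural numbers, among which a least
    one exists.\<close>
  define n where "n = (LEAST n. c + int n \<in> X)"
  have "c + int (nat (x0 - c)) \<in> X" using lb[OF x0] x0 by simp
  then have n: "c + int n \<in> X" unfolding n_def by (rule LeastI)
  have "c + int n \<le> x" if "x \<in> X" for x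
  proof -
    have "c + int (nat (x - c)) \<in> X" using lb[OF that] that by simp
    then have "n \<le> nat (x - c)" unfolding n_def by (rule Least_le)
    then show ?thesis using lb[OF that] by linarith
  qed
  then have "X = {c + int n..}" using n up by auto
  then show ?thesis ..
qed

text \<open>\<open>K\<close> plays the role of the set of translations that preserve the support of the module, and
  the reflection hypothesis that of the Weyl group.\<close>

locale string_pair =
  fixes A B :: "int set" and K :: "(int \<times> int) set"
  assumes zero: "(0, 0) \<in> K"
    and add: "(i, k) \<in> K \<Longrightarrow> (j, l) \<in> K \<Longrightarrow> (i + j, k + l) \<in> K"
    and A_K: "k \<in> A \<Longrightarrow> (1, k) \<in> K" and B_K: "k \<in> B \<Longrightarrow> (- 1, k) \<in> K"
    and K_A: "0 < n \<Longrightarrow> (int n, int n * k) \<in> K \<Longrightarrow> k \<in> A"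
    and K_B: "0 < n \<Longrightarrow> (- int n, int n * k) \<in> K \<Longrightarrow> k \<in> B"
    and reflect: "l \<notin> A \<Longrightarrow> - l \<notin> B \<Longrightarrow> j \<in> A \<longleftrightarrow> j - 2 * l \<in> B"
begin

lemma mult: "(i, k) \<in> K \<Longrightarrow> (int n * i, int n * k) \<in> K"
proof (induction n)
  case 0 then show ?case by (simp add: zero)
next
  case (Suc n)
  from add[OF Suc.prems Suc.IH[OF Suc.prems]] show ?case by (simp add: algebra_simps)
qed

text \<open>Exchanges \<beta> and - \<beta>, which reverses the first coordinate of a translation;
  facts about \<open>A\<close> thereby become facts about \<open>B\<close>.\<close>

lemma swap: "string_pair B A {(i, k). (- i, k) \<in> K}"
proof
  fix l j assume l: "l \<notin> B" "- l \<notin> A"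
  from reflect[of "- l" "j - 2 * l"] l show "j \<in> B \<longleftrightarrow> j - 2 * l \<in> A" by simp
next
  fix i k j l assume "(i, k) \<in> {(i, k). (- i, k) \<in> K}" "(j, l) \<in> {(i, k). (- i, k) \<in> K}"
  then show "(i + j, k + l) \<in> {(i, k). (- i, k) \<in> K}" using add[of "- i" k "- j" l] by simp
qed (use zero A_K B_K K_A K_B in auto)

text \<open>Replaces \<delta> by - \<delta>, so that only half-lines unbounded above have to be
  treated directly.\<close>

lemma mirror: "string_pair (uminus ` A) (uminus ` B) {(i, k). (i, - k) \<in> K}"
proof
  have im: "x \<in> uminus ` X \<longleftrightarrow> - x \<in> X" for x and X :: "int set" by force
  fix l j assume l: "l \<notin> uminus ` A" "- l \<notin> uminus ` B"
  from reflect[of "- l" "- j"] l show "j \<in> uminus ` A \<longleftrightarrow> j - 2 * l \<in> uminus ` B"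
    by (simp add: im)
next
  fix i k j l assume "(i, k) \<in> {(i, k). (i, - k) \<in> K}" "(j, l) \<in> {(i, k). (i, - k) \<in> K}"
  then show "(i + j, k + l) \<in> {(i, k). (i, - k) \<in> K}" using add[of i "- k" j "- l"] by simp
next
  fix n :: nat and k assume "0 < n" "(int n, int n * k) \<in> {(i, k). (i, - k) \<in> K}"
  then show "k \<in> uminus ` A" using K_A[of n "- k"] by (simp add: image_iff) (metis add.inverse_inverse)
next
  fix n :: nat and k assume "0 < n" "(- int n, int n * k) \<in> {(i, k). (i, - k) \<in> K}"
  then show "k \<in> uminus ` B" using K_B[of n "- k"] by (simp add: image_iff) (metis add.inverse_inverse)
qed (use zero A_K B_K in auto)

text \<open>(k' - l)(\<beta> + k\<delta>) + (l - k)(\<beta> + k'\<delta>) = (k' - k)(\<beta> +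
  l\<delta>) is a positive multiple of the root in between. This is why \<open>K_A\<close> is stated
  for multiples of a root.\<close>

lemma A_convex:
  assumes k: "k \<in> A" "k' \<in> A" "k \<le> l" "l \<le> k'"
  shows "l \<in> A"
proof (cases "k = k'")
  case True then show ?thesis using k by auto
next
  case False
  then have lt: "k < k'" using k by auto
  have "(int (nat (k' - l)) * 1 + int (nat (l - k)) * 1,
      int (nat (k' - l)) * k + int (nat (l - k)) * k') \<in> K"
    by (intro add mult A_K k)
  also have "(int (nat (k' - l)) * 1 + int (nat (l - k)) * 1,
      int (nat (k' - l)) * k + int (nat (l - k)) * k')
      = (int (nat (k' - k)), int (nat (k' - k)) * l)"
    using k by (simp add: algebra_simps)
  finally show ?thesis using K_A[of "nat (k' - k)"] lt by simp
qed

text \<open>Repeating the imaginary translation by \<open>s\<close> reaches positions arbitrarily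
  far above \<open>k\<close>; convexity fills the gaps.\<close>

lemma A_up:
  assumes "k \<in> A" "(0, s) \<in> K" "0 < s" "k \<le> l"
  shows "l \<in> A"
proof -
  have "(1 + int n * 0, k + int n * s) \<in> K" for n
    using assms by (intro add mult A_K)
  then have *: "k + int n * s \<in> A" for n using K_A[of 1 "k + int n * s"] by simp
  have "l \<le> k + int (nat (l - k)) * s"
  proof -
    have "(l - k) * 1 \<le> (l - k) * s" using assms by (intro mult_left_mono) auto
    then show ?thesis using assms by simp
  qed
  with A_convex[OF assms(1) *] assms(4) show ?thesis by blast
qed

text \<open>The positive sum \<open>k0 + l0\<close> is an imaginary translation, which makes both
  sets upward closed; nonnegativity of all sums lets each element of one set bound the other set
  from below.\<close>

lemma half_lines:
  assumes k0: "k0 \<in> A" "l0 \<in> B" "0 < k0 + l0"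
    and nonneg: "\<And>k l. k \<in> A \<Longrightarrow> l \<in> B \<Longrightarrow> 0 \<le> k + l"
  shows "\<exists>a b. A = {a..} \<and> B = {b..} \<and> 0 \<le> a + b \<and> a + b \<le> 2"
proof -
  interpret sw: string_pair B A "{(i, k). (- i, k) \<in> K}" by (rule swap)
  have s: "(0, k0 + l0) \<in> K" using add[OF A_K B_K] k0 by fastforce
  have "\<exists>a. A = {a..}"
    using k0 nonneg[of _ l0] A_up[OF _ s] by (intro int_up_closed_eq_atLeast[of _ "- l0"]) force+
  moreover have "\<exists>b. B = {b..}"
    using k0 nonneg[of k0] sw.A_up[of _ "k0 + l0"] s
    by (intro int_up_closed_eq_atLeast[of _ "- k0"]) force+
  ultimately obtain a b where ab: "A = {a..}" "B = {b..}" by blast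
  have "0 \<le> a + b" using nonneg[of a b] ab by simp
  moreover have "a + b \<le> 2"
  proof (rule ccontr)
    assume "\<not> a + b \<le> 2"
    \<comment> \<open>\<open>a - 1\<close> lies just below \<open>A\<close>, and
      \<open>1 - a\<close> lies below \<open>b\<close>, so the reflection in this root is available.
      It sends the position \<open>a\<close> of \<open>A\<close> to \<open>2 - a\<close>, which is
      still below \<open>b\<close>.\<close>
    then show False using reflect[of "a - 1" a] ab by auto
  qed
  ultimately show ?thesis using ab by blast
qed

text \<open>The cases are the possible signs of the imaginary translations k + l with
  \<open>k \<in> A\<close> and \<open>l \<in> B\<close>.\<close>

lemma string_type: "string_type A B"
proof (cases "A = {} \<or> A = UNIV")
  case True then show ?thesis by (auto simp: string_type_def)
next
  case False
  then obtain k0 k1 where k: "k0 \<in> A" "k1 \<notin> A" by auto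
  \<comment> \<open>If \<open>B\<close> were empty, the reflection at \<open>k1\<close> would be
    available and would carry \<open>k0\<close> into \<open>B\<close>.\<close>
  have "B \<noteq> {}" using reflect[of k1 k0] k by auto
  then obtain l0 where l0: "l0 \<in> B" by auto
  consider (pos) k l where "k \<in> A" "l \<in> B" "0 < k + l"
    | (neg) k l where "k \<in> A" "l \<in> B" "k + l < 0"
    | (zero) "\<And>k l. k \<in> A \<Longrightarrow> l \<in> B \<Longrightarrow> k + l = 0"
    by (meson linorder_neqE_linordered_idom)
  note cases = this
  interpret mi: string_pair "uminus ` A" "uminus ` B" "{(i, k). (i, - k) \<in> K}" by (rule mirror)
  have im: "x \<in> uminus ` X \<longleftrightarrow> - x \<in> X" for x and X :: "int set" by force
  \<comment> \<open>Imaginary translations of both signs would spread \<open>A\<close> upwards and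
    downwards until it contains \<open>k1\<close>.\<close>
  have no_both: False
    if "k \<in> A" "l \<in> B" "0 < k + l" "k' \<in> A" "l' \<in> B" "k' + l' < 0" for k l k' l'
  proof -
    have s: "(0, k + l) \<in> K" using add[OF A_K B_K] that by fastforce
    have s': "(0, k' + l') \<in> K" using add[OF A_K B_K] that by fastforce
    have "k1 \<in> A" if "k \<le> k1" using A_up[OF \<open>k \<in> A\<close> s] \<open>0 < k + l\<close> that by blast
    moreover have "- k1 \<in> uminus ` A" if "k1 \<le> k"
    proof (rule mi.A_up)
      show "(0, - (k' + l')) \<in> {(i, k). (i, - k) \<in> K}" using s' by (simp add: add.commute)
      show "- k \<in> uminus ` A" using \<open>k \<in> A\<close> by simp
    qed (use that \<open>k' + l' < 0\<close> in auto)
    ultimately show False using k by (cases "k \<le> k1") auto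
  qed
  show ?thesis
  proof (cases rule: cases)
    case (pos k l)
    then have "0 \<le> k' + l'" if "k' \<in> A" "l' \<in> B" for k' l' using no_both[OF pos that] by force
    from half_lines[OF pos this] show ?thesis by (auto simp: string_type_def)
  next
    case (neg k l)
    then have "0 \<le> k' + l'" if "k' \<in> uminus ` A" "l' \<in> uminus ` B" for k' l'
      using no_both[of "- k'" "- l'" k l] that by (force simp: im)
    from mi.half_lines[of "- k" "- l", OF _ _ _ this] neg
    obtain a b where ab: "uminus ` A = {a..}" "uminus ` B = {b..}" "0 \<le> a + b" "a + b \<le> 2"
      by auto
    have "A = {..- a}"
    proof (intro Set.set_eqI)
      fix x have "x \<in> A \<longleftrightarrow> - x \<in> uminus ` A" by (simp add: im)
      then show "x \<in> A \<longleftrightarrow> x \<in> {..- a}" unfolding ab by auto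
    qed
    moreover have "B = {..- b}"
    proof (intro Set.set_eqI)
      fix x have "x \<in> B \<longleftrightarrow> - x \<in> uminus ` B" by (simp add: im)
      then show "x \<in> B \<longleftrightarrow> x \<in> {..- b}" unfolding ab by auto
    qed
    ultimately show ?thesis using ab unfolding string_type_def
      by (intro disjI2 exI[of _ "- a"] exI[of _ "- b"]) auto
  next
    case zero
    have "A = {k0}" "B = {- k0}" using zero k(1) l0
      by (auto, smt (verit) zero, smt (verit) zero, smt (verit) zero)
    \<comment> \<open>With single points the neighbour \<open>k0 + 1\<close> admits a reflection,
      which moves \<open>k0\<close> to \<open>- k0 - 2\<close> instead of
      \<open>- k0\<close>.\<close>
    then show ?thesis using reflect[of "k0 + 1" k0] by auto
  qed
qed

end

text \<open>Serves odd roots, whose positions are the even positions in the string of the doubled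
  root. Rounding end points replaces \<open>a + b\<close> by its half plus at most 1 for upward
  half-lines and minus at most 1 for downward ones, so the bounds survive.\<close>

lemma string_type_vimage_double:
  assumes "string_type A B"
  shows "string_type {j. 2 * j \<in> A} {j. 2 * j \<in> B}"
  using assms unfolding string_type_def
proof (elim disjE exE conjE)
  fix a b :: int assume "A = {a..}" "B = {b..}" "0 \<le> a + b" "a + b \<le> 2"
  moreover have "{j. 2 * j \<in> {c..}} = {(c + 1) div 2..}" for c :: int by auto
  ultimately show "{j. 2 * j \<in> A} = {} \<or> {j. 2 * j \<in> A} = UNIV
     \<or> (\<exists>a b. {j. 2 * j \<in> A} = {a..} \<and> {j. 2 * j \<in> B} = {b..} \<and> 0 \<le> a + b \<and> a + b \<le> 2)
     \<or> (\<exists>a b. {j. 2 * j \<in> A} = {..a} \<and> {j. 2 * j \<in> B} = {..b} \<and> - 2 \<le> a + b \<and> a + b \<le> 0)"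
    by (intro disjI2 disjI1 exI[of _ "(a + 1) div 2"] exI[of _ "(b + 1) div 2"]) auto
next
  fix a b :: int assume "A = {..a}" "B = {..b}" "- 2 \<le> a + b" "a + b \<le> 0"
  moreover have "{j. 2 * j \<in> {..c}} = {..c div 2}" for c :: int by auto
  ultimately show "{j. 2 * j \<in> A} = {} \<or> {j. 2 * j \<in> A} = UNIV
     \<or> (\<exists>a b. {j. 2 * j \<in> A} = {a..} \<and> {j. 2 * j \<in> B} = {b..} \<and> 0 \<le> a + b \<and> a + b \<le> 2)
     \<or> (\<exists>a b. {j. 2 * j \<in> A} = {..a} \<and> {j. 2 * j \<in> B} = {..b} \<and> - 2 \<le> a + b \<and> a + b \<le> 0)"
    by (intro disjI2 exI[of _ "a div 2"] exI[of _ "b div 2"]) auto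
qed auto


section \<open>Eigenvectors and strings\<close>

lemma linear_add: "Vector_Spaces.linear s1 s2 f \<Longrightarrow> f (x + y) = f x + f y"
  by (simp add: Vector_Spaces.linear_iff)

lemma linear_scale: "Vector_Spaces.linear s1 s2 f \<Longrightarrow> f (s1 a x) = s2 a (f x)"
  by (simp add: Vector_Spaces.linear_iff)

context vector_space
begin

text \<open>Applying \<open>T\<close> to a linear relation and subtracting \<open>c m\<close> times
  the relation removes the term of index \<open>m\<close>, which drives the induction.\<close>

lemma independent_eigenvectors:
  assumes T: "Vector_Spaces.linear scale scale T"
    and eig: "\<And>n. T (v n) = scale (c n) (v n)" and nz: "\<And>n. v n \<noteq> 0" and inj: "inj c"
  shows "independent (range (v :: nat \<Rightarrow> 'b)) \<and> inj v"
proof -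
  have sum_zero: "\<forall>i\<in>S. r i = 0" if "finite S" "(\<Sum>i\<in>S. scale (r i) (v i)) = 0" for S r
    using that
  proof (induction S arbitrary: r rule: finite_induct)
    case empty then show ?case by simp
  next
    case (insert m S)
    have T0: "T 0 = 0" using linear_scale[OF T, of 0] by simp
    have "T (\<Sum>i\<in>S'. f i) = (\<Sum>i\<in>S'. T (f i))" if "finite S'" for S' and f :: "nat \<Rightarrow> 'b"
      using that by (induction rule: finite_induct) (use T0 in \<open>simp_all add: linear_add[OF T]\<close>)
    note linear_sum = this[OF insert.hyps(1)]
    have Tsum: "T (\<Sum>i\<in>S. scale (r i) (v i)) = (\<Sum>i\<in>S. scale (r i * c i) (v i))"
      using T by (simp add: linear_sum linear_scale eig)
    have 0: "scale (r m) (v m) + (\<Sum>i\<in>S. scale (r i) (v i)) = 0" using insert by simp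
    have "T (scale (r m) (v m) + (\<Sum>i\<in>S. scale (r i) (v i))) = T 0" using 0 by simp
    with T0 have "scale (r m * c m) (v m) + (\<Sum>i\<in>S. scale (r i * c i) (v i)) = 0"
      using T by (simp add: linear_add linear_scale eig Tsum)
    moreover have "scale (r m * c m) (v m) + (\<Sum>i\<in>S. scale (r i * c m) (v i)) = 0"
      using arg_cong[OF 0, of "scale (c m)"]
      by (simp add: scale_right_distrib scale_sum_right mult.commute)
    ultimately have "(\<Sum>i\<in>S. scale (r i * c i) (v i)) - (\<Sum>i\<in>S. scale (r i * c m) (v i)) = 0"
      by (metis add_left_cancel cancel_comm_monoid_add_class.diff_cancel)
    then have "(\<Sum>i\<in>S. scale (r i * (c i - c m)) (v i)) = 0"
      by (simp add: sum_subtractf scale_left_diff_distrib right_diff_distrib)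
    from insert.IH[OF this] have "\<forall>i\<in>S. r i * (c i - c m) = 0" .
    moreover have "c i \<noteq> c m" if "i \<in> S" for i using inj insert.hyps(2) that by (metis injD)
    ultimately have "\<forall>i\<in>S. r i = 0" by simp
    with 0 nz[of m] show ?case by simp
  qed
  have inv: "inj v"
  proof (rule injI)
    fix i j assume ij: "v i = v j"
    have "scale (c i) (v i) = scale (c j) (v i)" using eig[of i] eig[of j] ij by metis
    then have "c i = c j" using nz[of i] by (metis scale_cancel_right)
    then show "i = j" using inj by (simp add: inj_eq)
  qed
  moreover have "independent (range v)"
    unfolding independent_explicit_finite_subsets
  proof (intro allI impI ballI)
    fix S r w assume S: "S \<subseteq> range v" "finite S" "(\<Sum>u\<in>S. scale (r u) u) = 0" and w: "w \<in> S"
    obtain I where I: "S = v ` I" "finite I"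
      using S finite_subset_image by metis
    have "(\<Sum>i\<in>I. scale (r (v i)) (v i)) = 0"
      using S(3) sum.reindex[OF inj_on_subset[OF inv subset_UNIV], of "\<lambda>u. scale (r u) u" I] I by simp
    from sum_zero[OF I(2) this] show "r w = 0" using w I by auto
  qed
  ultimately show ?thesis by blast
qed

lemma no_infinite_spectrum:
  assumes "finite B" "UNIV \<subseteq> span B" "Vector_Spaces.linear scale scale T"
    and "\<And>n. T (v n) = scale (c n) (v n)" "\<And>n. v n \<noteq> 0" "inj (c :: nat \<Rightarrow> 'a)"
  shows False
proof -
  have "independent (range v) \<and> inj v" using assms(3-6) by (rule independent_eigenvectors)
  then show False
    using independent_span_bound[OF assms(1), of "range v"] assms(2) finite_imageD[of v UNIV] by auto
qed

section \<open>Vectors killed by a power of a linear map\<close>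

lemma linear_funpow:
  assumes "Vector_Spaces.linear scale scale f"
  shows "Vector_Spaces.linear scale scale (f ^^ n)"
proof (induction n)
  case 0 show ?case by (simp add: Vector_Spaces.linear_iff vector_space_axioms)
next
  case (Suc n) then show ?case using assms by (simp add: Vector_Spaces.linear_iff)
qed

lemma funpow_add_zero:
  assumes f: "Vector_Spaces.linear scale scale f" and "(f ^^ n) x = 0"
  shows "(f ^^ (m + n)) x = 0"
  using assms(2) linear_scale[OF linear_funpow[OF f], of m 0] by (simp add: funpow_add)

lemma subspace_locally_nilpotent:
  assumes f: "Vector_Spaces.linear scale scale f"
  shows "subspace {x. \<exists>n. (f ^^ n) x = 0}"
proof (rule subspaceI)
  fix x y assume "x \<in> {x. \<exists>n. (f ^^ n) x = 0}" "y \<in> {x. \<exists>n. (f ^^ n) x = 0}"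
  then obtain m n where "(f ^^ m) x = 0" "(f ^^ n) y = 0" by auto
  then have "(f ^^ (m + n)) (x + y) = 0"
    using funpow_add_zero[OF f, of m x n] funpow_add_zero[OF f, of n y m] linear_add[OF linear_funpow[OF f]]
    by (simp add: add.commute)
  then show "x + y \<in> {x. \<exists>n. (f ^^ n) x = 0}" by blast
next
  fix c x assume "x \<in> {x. \<exists>n. (f ^^ n) x = 0}"
  then obtain m where "(f ^^ m) x = 0" by auto
  then have "(f ^^ m) (scale c x) = 0" using linear_scale[OF linear_funpow[OF f]] by simp
  then show "scale c x \<in> {x. \<exists>n. (f ^^ n) x = 0}" by blast
qed (auto intro: exI[of _ 0])

end

text \<open>Applied with \<open>(e, f)\<close> to highest weight vectors, and with \<open>(f, e)\<close> to lowest weight vectors.\<close>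

locale sl2_string =
  fixes s :: "complex \<Rightarrow> 'b::ab_group_add \<Rightarrow> 'b" and e f :: "'b \<Rightarrow> 'b" and v :: 'b and m :: complex
  assumes vs: "vector_space s" and lin_e: "Vector_Spaces.linear s s e"
    and lin_f: "Vector_Spaces.linear s s f"
    and comm: "e (f ((f ^^ j) v)) = f (e ((f ^^ j) v)) + s (m - 2 * of_nat j) ((f ^^ j) v)"
    and ev: "e v = 0"
begin

interpretation vector_space s by (rule vs)

lemma zero: "e 0 = 0" "f 0 = 0"
  using linear_scale[OF lin_e, of 0 0] linear_scale[OF lin_f, of 0 0] by auto

text \<open>Commuting \<open>e\<close> past \<open>Suc j\<close> copies of \<open>f\<close> collects
  the weights m, m - 2, ..., m - 2j, whose sum is the coefficient.\<close>

lemma string: "e ((f ^^ Suc j) v) = s (of_nat (Suc j) * (m - of_nat j)) ((f ^^ j) v)"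
proof (induction j)
  case 0 then show ?case using comm[of 0] ev by (simp add: zero)
next
  case (Suc j)
  have "e ((f ^^ Suc (Suc j)) v)
      = f (s (of_nat (Suc j) * (m - of_nat j)) ((f ^^ j) v)) + s (m - 2 * of_nat (Suc j)) ((f ^^ Suc j) v)"
    using comm[of "Suc j"] Suc by simp
  also have "\<dots> = s (of_nat (Suc j) * (m - of_nat j) + (m - 2 * of_nat (Suc j))) ((f ^^ Suc j) v)"
    by (simp add: linear_scale[OF lin_f] scale_left_distrib)
  also have "of_nat (Suc j) * (m - of_nat j) + (m - 2 * of_nat (Suc j))
      = of_nat (Suc (Suc j)) * (m - of_nat (Suc j))"
    by (simp add: algebra_simps)
  finally show ?case .
qed

text \<open>By \<open>string\<close>, the result is \<open>v\<close> multiplied by j! and by all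
  factors m - i with i < j.\<close>

lemma raise_lower_nonzero:
  assumes "v \<noteq> 0" "\<And>i. i < j \<Longrightarrow> m \<noteq> of_nat i"
  shows "(e ^^ j) ((f ^^ j) v) \<noteq> 0"
  using assms(2)
proof (induction j)
  case 0 then show ?case using assms by simp
next
  case (Suc j)
  have "(e ^^ Suc j) ((f ^^ Suc j) v) = (e ^^ j) (e ((f ^^ Suc j) v))" by (simp add: funpow_swap1)
  also have "\<dots> = s (of_nat (Suc j) * (m - of_nat j)) ((e ^^ j) ((f ^^ j) v))"
    by (simp only: string linear_scale[OF linear_funpow[OF lin_e]])
  finally show ?case using Suc of_nat_neq_0[of j, where 'a = complex] by simp
qed

lemma lower_nonzero:
  assumes "v \<noteq> 0" "\<And>i. i < j \<Longrightarrow> m \<noteq> of_nat i"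
  shows "(f ^^ j) v \<noteq> 0"
  using raise_lower_nonzero[OF assms] linear_scale[OF linear_funpow[OF lin_e], of j 0 0] by fastforce

text \<open>At the first vanishing power \<open>Suc i\<close> of \<open>f\<close> the coefficient (i
  + 1)(m - i) from \<open>string\<close> must vanish, which forces m = i.\<close>

lemma nilpotent_weight:
  assumes v: "v \<noteq> 0" and n: "(f ^^ n) v = 0"
  shows "\<exists>i. m = of_nat i \<and> (\<forall>j\<le>i. (f ^^ j) v \<noteq> 0)"
proof -
  define k where "k = (LEAST n. (f ^^ n) v = 0)"
  have k: "(f ^^ k) v = 0" unfolding k_def using n by (rule LeastI)
  have nz: "(f ^^ j) v \<noteq> 0" if "j < k" for j using that not_less_Least unfolding k_def by blast
  obtain i where i: "k = Suc i" using k v by (cases k) auto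
  have "m = of_nat i"
    using string[of i] k nz[of i] zero of_nat_neq_0[of i, where 'a = complex] unfolding i by auto
  then show ?thesis using nz i by auto
qed

end


section \<open>Root spaces of basic Lie superalgebras\<close>

lemma super_space_zero:
  assumes "super_space V" "x \<in> part V False" "y \<in> part V True" "x + y = 0"
  shows "x = 0" "y = 0"
proof -
  interpret vector_space "smul V" using assms(1) by (simp add: super_space_def)
  have 0: "0 \<in> part V p" for p using assms(1) by (simp add: super_space_def subspace_0)
  have "\<exists>!p. case p of (x, y) \<Rightarrow> x \<in> part V False \<and> y \<in> part V True \<and> 0 = x + y"
    using assms(1) unfolding super_space_def by blast
  moreover have "case (x, y) of (x, y) \<Rightarrow> x \<in> part V False \<and> y \<in> part V True \<and> 0 = x + y"
    using assms by simp
  moreover have "case (0, 0) of (x, y) \<Rightarrow> x \<in> part V False \<and> y \<in> part V True \<and> 0 = x + y"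
    using 0 by simp
  ultimately have "(x, y) = (0, 0)" by blast
  then show "x = 0" "y = 0" by auto
qed

lemma super_space_decomp:
  assumes "super_space V"
  obtains x y where "x \<in> part V False" "y \<in> part V True" "v = x + y"
proof -
  have "\<exists>!(x, y). x \<in> part V False \<and> y \<in> part V True \<and> v = x + y"
    using assms unfolding super_space_def by blast
  then show ?thesis using that by (auto simp: Ex1_def)
qed

section \<open>Identities in Lie superalgebras\<close>

locale lie_superalg =
  fixes L :: "('a::ab_group_add, 'z) lie_super_scheme"
  assumes lie: "lie_superalgebra L"
begin

lemma super_space: "super_space L"
  using lie by (simp add: lie_superalgebra_def)

sublocale vs: vector_space "smul L"
  using super_space by (simp add: super_space_def)

lemma linear_brkt: "Vector_Spaces.linear (smul L) (smul L) (brkt L x)"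
  and linear_brkt_left: "Vector_Spaces.linear (smul L) (smul L) (\<lambda>x. brkt L x y)"
  using lie by (simp_all add: lie_superalgebra_def)

lemma brkt_add: "brkt L x (y + z) = brkt L x y + brkt L x z"
  and brkt_add_left: "brkt L (x + y) z = brkt L x z + brkt L y z"
  and brkt_smul: "brkt L x (smul L a y) = smul L a (brkt L x y)"
  and brkt_smul_left: "brkt L (smul L a x) y = smul L a (brkt L x y)"
  using linear_add[OF linear_brkt] linear_add[OF linear_brkt_left] linear_scale[OF linear_brkt]
    linear_scale[OF linear_brkt_left] by auto

lemma brkt_zero [simp]: "brkt L x 0 = 0" "brkt L 0 x = 0"
  using brkt_smul[of x 0 0] brkt_smul_left[of 0 0 x] by simp_all

lemma brkt_minus: "brkt L x (- y) = - brkt L x y" "brkt L (- x) y = - brkt L x y"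
  using brkt_smul[of x "- 1" y] brkt_smul_left[of "- 1" x y] by simp_all

lemma brkt_sum: "brkt L x (\<Sum>p\<in>P. g p) = (\<Sum>p\<in>P. brkt L x (g p))"
  by (induction P rule: infinite_finite_induct) (simp_all add: brkt_add)

lemma subspace_part: "vs.subspace (part L p)"
  using super_space by (simp add: super_space_def)

lemma even_odd_zero: "x \<in> part L False \<Longrightarrow> x \<in> part L True \<Longrightarrow> x = 0"
  using super_space_zero[OF super_space, of x "- x"] vs.subspace_neg[OF subspace_part] by auto

lemma brkt_part: "x \<in> part L p \<Longrightarrow> y \<in> part L q \<Longrightarrow> brkt L x y \<in> part L (p \<noteq> q)"
  using lie unfolding lie_superalgebra_def by blast

lemma antisym: "x \<in> part L p \<Longrightarrow> y \<in> part L q \<Longrightarrow> brkt L x y = - smul L (ksign p q) (brkt L y x)"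
  using lie unfolding lie_superalgebra_def by blast

lemma jacobi: "x \<in> part L p \<Longrightarrow> y \<in> part L q \<Longrightarrow>
    brkt L x (brkt L y z) = brkt L (brkt L x y) z + smul L (ksign p q) (brkt L y (brkt L x z))"
  using lie unfolding lie_superalgebra_def by blast

text \<open>No sign depends on the parity of \<open>y\<close>, so the identity extends to
  inhomogeneous \<open>y\<close>; the same holds for \<open>jacobi_even\<close>. Later computations
  with even elements then need no parity split.\<close>

lemma antisym_even:
  assumes "x \<in> part L False"
  shows "brkt L x y = - brkt L y x"
proof -
  obtain y0 y1 where y: "y0 \<in> part L False" "y1 \<in> part L True" "y = y0 + y1"
    using super_space_decomp[OF super_space] .
  then show ?thesis
    using antisym[OF assms y(1)] antisym[OF assms y(2)] by (simp add: brkt_add brkt_add_left ksign_def)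
qed

lemma jacobi_even:
  assumes "x \<in> part L False"
  shows "brkt L x (brkt L y z) = brkt L (brkt L x y) z + brkt L y (brkt L x z)"
proof -
  obtain y0 y1 where y: "y0 \<in> part L False" "y1 \<in> part L True" "y = y0 + y1"
    using super_space_decomp[OF super_space] .
  then show ?thesis
    using jacobi[OF assms y(1), of z] jacobi[OF assms y(2), of z]
    by (simp add: brkt_add brkt_add_left ksign_def)
qed

lemma brkt_even_self: "x \<in> part L False \<Longrightarrow> brkt L x x = 0"
proof -
  assume "x \<in> part L False"
  then have "brkt L x x + brkt L x x = 0" using antisym_even[of x x] by (metis add.right_inverse)
  then have "smul L 2 (brkt L x x) = 0"
    by (metis one_add_one vs.scale_left_distrib vs.scale_one)
  then show ?thesis by simp
qed

text \<open>For w = [[x, x], x] the Jacobi identity for x, x, x reads - w = 2w, hence 3w =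
  0.\<close>

lemma brkt_odd_sq:
  assumes "x \<in> part L True" shows "brkt L (brkt L x x) x = 0"
proof -
  have even: "brkt L x x \<in> part L False" using brkt_part[OF assms assms] by simp
  define w where "w = brkt L (brkt L x x) x"
  have "brkt L x (brkt L x x) = - w" using antisym_even[OF even, of x] by (simp add: w_def)
  then have "- w = w + w" using jacobi[OF assms assms, of x] by (simp add: ksign_def w_def)
  then have "(w + w) + w = 0" by (metis ab_left_minus)
  then have "smul L 3 w = 0"
    using vs.scale_left_distrib[of 2 1 w] vs.scale_left_distrib[of 1 1 w] by simp
  then show ?thesis by (simp add: w_def)
qed

end

section \<open>Root spaces relative to an even subspace\<close>

locale torus = lie_superalg L for L :: "('a::ab_group_add, 'z) lie_super_scheme" +
  fixes H :: "'a set"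
  assumes H_even: "H \<subseteq> part L False"
begin

lemma root_spaceD: "x \<in> root_space L H \<alpha> \<Longrightarrow> h \<in> H \<Longrightarrow> brkt L h x = smul L (\<alpha> h) x"
  by (simp add: root_space_def)

lemma root_space_cong: "(\<And>h. h \<in> H \<Longrightarrow> \<alpha> h = \<beta> h) \<Longrightarrow> root_space L H \<alpha> = root_space L H \<beta>"
  by (auto simp: root_space_def)

lemma subspace_root_space: "vs.subspace (root_space L H \<alpha>)"
  by (rule vs.subspaceI) (auto simp: root_space_def brkt_add brkt_smul vs.scale_right_distrib mult.commute)

lemma root_space_brkt:
  assumes "x \<in> root_space L H \<alpha>" "y \<in> root_space L H \<beta>"
  shows "brkt L x y \<in> root_space L H (\<lambda>h. \<alpha> h + \<beta> h)"
  unfolding root_space_def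
proof (intro CollectI ballI)
  fix h assume h: "h \<in> H"
  have "brkt L h (brkt L x y) = brkt L (brkt L h x) y + brkt L x (brkt L h y)"
    using jacobi_even[of h x y] h H_even by auto
  then show "brkt L h (brkt L x y) = smul L (\<alpha> h + \<beta> h) (brkt L x y)"
    using root_spaceD[OF assms(1) h] root_spaceD[OF assms(2) h]
    by (simp add: brkt_smul brkt_smul_left vs.scale_left_distrib)
qed

lemma root_space_brkt_funpow:
  assumes "x \<in> root_space L H \<alpha>" "y \<in> root_space L H \<beta>"
  shows "(brkt L x ^^ n) y \<in> root_space L H (\<lambda>h. \<beta> h + of_nat n * \<alpha> h)"
proof (induction n)
  case 0 then show ?case using assms(2) by simp
next
  case (Suc n)
  have "(brkt L x ^^ Suc n) y \<in> root_space L H (\<lambda>h. \<alpha> h + (\<beta> h + of_nat n * \<alpha> h))"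
    using root_space_brkt[OF assms(1) Suc] by simp
  then show ?case by (simp add: algebra_simps)
qed

text \<open>Bracketing with even elements preserves parity, so the eigenvector equation splits into
  its homogeneous parts.\<close>

lemma root_space_parts:
  assumes "x + y \<in> root_space L H \<alpha>" "x \<in> part L False" "y \<in> part L True"
  shows "x \<in> root_space L H \<alpha>" "y \<in> root_space L H \<alpha>"
proof -
  have "brkt L h x - smul L (\<alpha> h) x = 0 \<and> brkt L h y - smul L (\<alpha> h) y = 0" if h: "h \<in> H" for h
  proof -
    have "brkt L h x - smul L (\<alpha> h) x \<in> part L False" "brkt L h y - smul L (\<alpha> h) y \<in> part L True"
      using brkt_part[of h False x False] brkt_part[of h False y True] h H_even assms(2,3)
        vs.subspace_diff[OF subspace_part] vs.subspace_scale[OF subspace_part] by auto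
    moreover have "(brkt L h x - smul L (\<alpha> h) x) + (brkt L h y - smul L (\<alpha> h) y) = 0"
      using root_spaceD[OF assms(1) h] by (simp add: brkt_add vs.scale_right_distrib algebra_simps)
    ultimately show ?thesis using super_space_zero[OF super_space] by blast
  qed
  then show "x \<in> root_space L H \<alpha>" "y \<in> root_space L H \<alpha>" by (auto simp: root_space_def)
qed

end

section \<open>Root spaces and the invariant form\<close>

locale basic_lie = lie_superalg G for G :: "('g::ab_group_add, 'z) lie_super_scheme" +
  fixes H0 :: "'g set" and \<kappa> :: "'g \<Rightarrow> 'g \<Rightarrow> complex"
  assumes fin_dim: "finite_dimensional G UNIV" and form: "basic_form G \<kappa>"
    and cartan0: "cartan_subalgebra G H0"
begin

sublocale torus G H0
  using cartan0 by unfold_locales (simp add: cartan_subalgebra_def)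

abbreviation rs :: "('g \<Rightarrow> complex) \<Rightarrow> 'g set" where "rs \<equiv> root_space G H0"

lemma span_rs: "vs.span (\<Union>\<alpha> \<in> dual_space G H0. rs \<alpha>) = UNIV" and rs_zero: "rs (\<lambda>_. 0) = H0"
  and subspace_H0: "vs.subspace H0"
  using cartan0 by (auto simp: cartan_subalgebra_def)

lemma kappa_linear: "Vector_Spaces.linear (smul G) (*) (\<kappa> x)"
    "Vector_Spaces.linear (smul G) (*) (\<lambda>x. \<kappa> x y)"
  and kappa_parity: "p \<noteq> q \<Longrightarrow> x \<in> part G p \<Longrightarrow> y \<in> part G q \<Longrightarrow> \<kappa> x y = 0"
  and kappa_inv: "\<kappa> (brkt G x y) z = \<kappa> x (brkt G y z)"
  and kappa_nondeg: "(\<And>y. \<kappa> x y = 0) \<Longrightarrow> x = 0"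
  using form unfolding basic_form_def by blast+

lemma kappa_add: "\<kappa> x (y + z) = \<kappa> x y + \<kappa> x z" "\<kappa> (x + y) z = \<kappa> x z + \<kappa> y z"
  and kappa_smul: "\<kappa> x (smul G a y) = a * \<kappa> x y" "\<kappa> (smul G a x) y = a * \<kappa> x y"
  using linear_add[OF kappa_linear(1)] linear_add[OF kappa_linear(2)]
    linear_scale[OF kappa_linear(1)] linear_scale[OF kappa_linear(2)] by auto

lemma kappa_zero [simp]: "\<kappa> x 0 = 0" "\<kappa> 0 x = 0"
  using kappa_smul(1)[of x 0 0] kappa_smul(2)[of 0 0 x] by auto

lemma kappa_minus: "\<kappa> x (- y) = - \<kappa> x y" "\<kappa> (- x) y = - \<kappa> x y"
  using kappa_smul(1)[of x "- 1" y] kappa_smul(2)[of "- 1" x y] by auto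

lemma kappa_diff: "\<kappa> (x - y) z = \<kappa> x z - \<kappa> y z"
  using kappa_add(2)[of x "- y" z] by (simp add: kappa_minus)

text \<open>The single operator \<open>brkt G h\<close> would have infinitely many eigenvalues on a
  finite dimensional space.\<close>

lemma no_infinite_weights:
  assumes "\<And>n. v n \<in> rs (\<lambda>h. \<beta> h + of_nat n * \<alpha> h)" "\<And>n. v n \<noteq> 0" "h \<in> H0" "\<alpha> h \<noteq> 0"
  shows False
proof -
  obtain B where "finite B" "UNIV \<subseteq> vs.span B" using fin_dim by (auto simp: finite_dimensional_def)
  moreover have "brkt G h (v n) = smul G (\<beta> h + of_nat n * \<alpha> h) (v n)" for n
    using root_spaceD[OF assms(1,3)] by simp
  moreover have "inj (\<lambda>n. \<beta> h + of_nat n * \<alpha> h)"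
    using assms(4) by (auto intro!: injI)
  ultimately show False
    using vs.no_infinite_spectrum[of B "brkt G h" v "\<lambda>n. \<beta> h + of_nat n * \<alpha> h"]
      linear_brkt assms(2) by blast
qed

lemma ad_locally_nilpotent:
  assumes "e \<in> rs \<alpha>" "h \<in> H0" "\<alpha> h \<noteq> 0"
  shows "\<exists>n. (brkt G e ^^ n) z = 0"
proof -
  have "z \<in> vs.span (\<Union>\<alpha> \<in> dual_space G H0. rs \<alpha>)" using span_rs by simp
  then show ?thesis
  proof (rule vs.span_induct)
    show "vs.subspace {z. \<exists>n. (brkt G e ^^ n) z = 0}"
      by (rule vs.subspace_locally_nilpotent[OF linear_brkt])
    fix x assume "x \<in> (\<Union>\<alpha> \<in> dual_space G H0. rs \<alpha>)"
    then obtain \<beta> where "x \<in> rs \<beta>" by auto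
    from no_infinite_weights[OF root_space_brkt_funpow[OF assms(1) this] _ assms(2,3)]
    show "\<exists>n. (brkt G e ^^ n) x = 0" by blast
  qed
qed

lemma kappa_orthogonal:
  assumes "x \<in> rs \<alpha>" "y \<in> rs \<beta>" "h \<in> H0" "\<alpha> h + \<beta> h \<noteq> 0"
  shows "\<kappa> x y = 0"
proof -
  have "\<kappa> (brkt G x h) y = \<kappa> x (brkt G h y)" by (rule kappa_inv)
  moreover have "brkt G x h = - brkt G h x" using antisym_even[of h x] assms(3) H_even by auto
  ultimately have "- (\<alpha> h * \<kappa> x y) = \<beta> h * \<kappa> x y"
    using root_spaceD[OF assms(1,3)] root_spaceD[OF assms(2,3)] by (simp add: kappa_minus kappa_smul)
  then have "(\<alpha> h + \<beta> h) * \<kappa> x y = 0" by (metis add.right_inverse distrib_right)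
  then show ?thesis using assms(4) by simp
qed

text \<open>Root spaces whose weights do not add up to 0 are orthogonal, so nondegeneracy must be
  realized in the opposite root space; since the form is even, the partner can be taken of the same
  parity.\<close>

lemma kappa_pairing:
  assumes x: "x \<in> rs \<alpha>" "x \<noteq> 0" "x \<in> part G p"
  obtains y where "y \<in> rs (\<lambda>h. - \<alpha> h)" "y \<in> part G p" "\<kappa> x y = 1"
proof -
  have "\<exists>y\<in>rs (\<lambda>h. - \<alpha> h). \<kappa> x y \<noteq> 0"
  proof (rule ccontr)
    assume no: "\<not> (\<exists>y\<in>rs (\<lambda>h. - \<alpha> h). \<kappa> x y \<noteq> 0)"
    have "\<kappa> x z = 0" for z
    proof (rule vs.span_induct[of z "\<Union>\<alpha> \<in> dual_space G H0. rs \<alpha>"])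
      show "z \<in> vs.span (\<Union>\<alpha> \<in> dual_space G H0. rs \<alpha>)" using span_rs by simp
      show "vs.subspace {z. \<kappa> x z = 0}" by (rule vs.subspaceI) (auto simp: kappa_add kappa_smul)
      fix w assume "w \<in> (\<Union>\<alpha> \<in> dual_space G H0. rs \<alpha>)"
      then obtain \<gamma> where w: "w \<in> rs \<gamma>" by auto
      show "\<kappa> x w = 0"
      proof (cases "\<exists>h\<in>H0. \<alpha> h + \<gamma> h \<noteq> 0")
        case True then show ?thesis using kappa_orthogonal[OF x(1) w] by auto
      next
        case False
        then have "rs \<gamma> = rs (\<lambda>h. - \<alpha> h)"
          by (intro root_space_cong) (metis add_eq_0_iff)
        then show ?thesis using no w by auto
      qed
    qed
    then show False using kappa_nondeg[of x] x(2) by auto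
  qed
  then obtain y where y: "y \<in> rs (\<lambda>h. - \<alpha> h)" "\<kappa> x y \<noteq> 0" by auto
  obtain y0 y1 where yd: "y0 \<in> part G False" "y1 \<in> part G True" "y = y0 + y1"
    using super_space_decomp[OF super_space] .
  define z where "z = (if p then y1 else y0)"
  have z: "z \<in> rs (\<lambda>h. - \<alpha> h)" "z \<in> part G p"
    using root_space_parts[of y0 y1] y yd by (auto simp: z_def)
  have "\<kappa> x (if p then y0 else y1) = 0"
    using kappa_parity[of p "\<not> p" x] x(3) yd by (cases p) auto
  then have kz: "\<kappa> x z \<noteq> 0" using y(2) yd(3) by (auto simp: z_def kappa_add split: if_splits)
  show ?thesis
  proof
    show "smul G (1 / \<kappa> x z) z \<in> rs (\<lambda>h. - \<alpha> h)" "smul G (1 / \<kappa> x z) z \<in> part G p"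
      using z vs.subspace_scale[OF subspace_root_space] vs.subspace_scale[OF subspace_part] by auto
    show "\<kappa> x (smul G (1 / \<kappa> x z) z) = 1" using kz by (simp add: kappa_smul)
  qed
qed

text \<open>\<open>H0\<close> is the root space of 0, which is its own opposite.\<close>

lemma kappa_nondeg_H0:
  assumes "t \<in> H0" "\<And>h. h \<in> H0 \<Longrightarrow> \<kappa> t h = 0"
  shows "t = 0"
proof (rule ccontr)
  assume "t \<noteq> 0"
  have t: "t \<in> rs (\<lambda>_. 0)" "t \<in> part G False" using assms(1) rs_zero H_even by auto
  obtain y where "y \<in> rs (\<lambda>h. - 0)" "y \<in> part G False" "\<kappa> t y = 1"
    using kappa_pairing[OF t(1) \<open>t \<noteq> 0\<close> t(2)] .
  then show False using assms(2)[of y] rs_zero by simp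
qed

lemma brkt_opposite:
  assumes "x \<in> rs \<alpha>" "y \<in> rs (\<lambda>h. - \<alpha> h)"
  shows "brkt G x y \<in> H0" and "h \<in> H0 \<Longrightarrow> \<kappa> (brkt G x y) h = \<kappa> x y * \<alpha> h"
proof -
  show "brkt G x y \<in> H0" using root_space_brkt[OF assms] rs_zero by simp
  assume h: "h \<in> H0"
  have "brkt G y h = - brkt G h y" using antisym_even[of h y] h H_even by auto
  then have "brkt G y h = smul G (\<alpha> h) y" using root_spaceD[OF assms(2) h] by simp
  then show "\<kappa> (brkt G x y) h = \<kappa> x y * \<alpha> h" by (simp add: kappa_inv kappa_smul)
qed

end

text \<open>\<open>t\<close> represents \<alpha> under the form, so \<open>\<alpha> t\<close> is the
  squared length (\<alpha>, \<alpha>).\<close>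

locale nonisotropic = basic_lie +
  fixes \<alpha> :: "'a \<Rightarrow> complex" and t :: 'a
  assumes t_H0: "t \<in> H0" and t_dual: "h \<in> H0 \<Longrightarrow> \<kappa> t h = \<alpha> h" and t_nz: "\<alpha> t \<noteq> 0"
begin

lemma brkt_opposite_eq:
  assumes "x \<in> rs \<alpha>" "y \<in> rs (\<lambda>h. - \<alpha> h)"
  shows "brkt G x y = smul G (\<kappa> x y) t"
proof -
  have "brkt G x y - smul G (\<kappa> x y) t = 0"
  proof (rule kappa_nondeg_H0)
    show "brkt G x y - smul G (\<kappa> x y) t \<in> H0"
      using brkt_opposite(1)[OF assms] t_H0
      by (simp add: vs.subspace_diff[OF subspace_H0] vs.subspace_scale[OF subspace_H0])
  qed (use brkt_opposite(2)[OF assms] t_dual in \<open>simp add: kappa_diff kappa_smul\<close>)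
  then show ?thesis by simp
qed

lemma sl2_triple:
  assumes "e \<in> rs \<alpha>" "e \<in> part G False" "e \<noteq> 0"
  obtains f where "f \<in> rs (\<lambda>h. - \<alpha> h)" "f \<in> part G False" "brkt G e f \<in> H0" "\<alpha> (brkt G e f) = 2"
    "\<forall>w\<in>rs \<alpha>. \<kappa> w f = 0 \<longrightarrow> brkt G w f = 0" "\<kappa> e f \<noteq> 0"
proof -
  obtain y where y: "y \<in> rs (\<lambda>h. - \<alpha> h)" "y \<in> part G False" "\<kappa> e y = 1"
    using kappa_pairing[OF assms(1,3,2)] .
  \<comment> \<open>The bracket of \<open>e\<close> and \<open>y\<close> is \<open>t\<close>; the
    factor 2/(\<alpha>, \<alpha>) turns it into the coroot, on which \<alpha> takes the value
    2.\<close>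
  define f where "f = smul G (2 / \<alpha> t) y"
  have f: "f \<in> rs (\<lambda>h. - \<alpha> h)" "f \<in> part G False" "\<kappa> e f = 2 / \<alpha> t"
    using y vs.subspace_scale[OF subspace_root_space] vs.subspace_scale[OF subspace_part]
    by (auto simp: f_def kappa_smul)
  have ef: "brkt G e f = smul G (2 / \<alpha> t) t" using brkt_opposite_eq[OF assms(1) f(1)] f(3) by simp
  show ?thesis
  proof
    show "brkt G e f \<in> H0" by (rule brkt_opposite(1)[OF assms(1) f(1)])
    have "\<alpha> (smul G (2 / \<alpha> t) t) = \<kappa> t (smul G (2 / \<alpha> t) t)"
      using t_dual[of "smul G (2 / \<alpha> t) t"] t_H0 by (simp add: vs.subspace_scale[OF subspace_H0])
    then show "\<alpha> (brkt G e f) = 2" using t_dual[OF t_H0] t_nz by (simp add: ef kappa_smul)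
    show "\<forall>w\<in>rs \<alpha>. \<kappa> w f = 0 \<longrightarrow> brkt G w f = 0"
      using brkt_opposite_eq[OF _ f(1)] by simp
  qed (use f t_nz in auto)
qed

text \<open>A root vector orthogonal to \<open>f\<close> is a lowest weight vector of weight 2, so it generates an
  infinite string.\<close>

lemma root_space_one_dim:
  assumes "e \<in> rs \<alpha>" "e \<in> part G False" "e \<noteq> 0" "x \<in> rs \<alpha>"
  shows "\<exists>a. x = smul G a e"
proof -
  obtain f where f: "f \<in> rs (\<lambda>h. - \<alpha> h)" "f \<in> part G False" "brkt G e f \<in> H0"
    "\<alpha> (brkt G e f) = 2" "\<forall>w\<in>rs \<alpha>. \<kappa> w f = 0 \<longrightarrow> brkt G w f = 0" "\<kappa> e f \<noteq> 0"
    using sl2_triple[OF assms(1-3)] .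
  define w where "w = x - smul G (\<kappa> x f / \<kappa> e f) e"
  have w: "w \<in> rs \<alpha>" using assms unfolding w_def
    by (intro vs.subspace_diff[OF subspace_root_space] vs.subspace_scale[OF subspace_root_space])
  have "\<kappa> w f = 0" using f(6) by (simp add: w_def kappa_diff kappa_smul)
  then have wf: "brkt G f w = 0" using f(5) w antisym_even[OF f(2), of w] by simp
  have it: "(brkt G e ^^ n) w \<in> rs (\<lambda>h. \<alpha> h + of_nat n * \<alpha> h)" for n
    by (rule root_space_brkt_funpow[OF assms(1) w])
  have "w = 0"
  proof (rule ccontr)
    assume nz: "w \<noteq> 0"
    \<comment> \<open>Here \<open>f\<close> plays the raising operator, so the weight 2 of
      \<open>w\<close> enters as -2. As this is not a natural number, no power of \<open>e\<close>
      kills \<open>w\<close>.\<close>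
    interpret sl2_string "smul G" "brkt G f" "brkt G e" w "- 2"
    proof (rule sl2_string.intro)
      fix j
      have "brkt G (brkt G f e) ((brkt G e ^^ j) w) = - brkt G (brkt G e f) ((brkt G e ^^ j) w)"
        using antisym_even[OF f(2), of e] by (simp add: brkt_minus)
      also have "\<dots> = smul G (- 2 - 2 * of_nat j) ((brkt G e ^^ j) w)"
        using root_spaceD[OF it[of j] f(3)] f(4) vs.scale_minus_left[symmetric] by (simp add: algebra_simps)
      finally show "brkt G f (brkt G e ((brkt G e ^^ j) w))
          = brkt G e (brkt G f ((brkt G e ^^ j) w)) + smul G (- 2 - 2 * of_nat j) ((brkt G e ^^ j) w)"
        using jacobi_even[OF f(2), of e "(brkt G e ^^ j) w"] by simp
    qed (fact vs.vector_space_axioms linear_brkt wf)+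
    have "(brkt G e ^^ n) w \<noteq> 0" for n
    proof (rule lower_nonzero[OF nz])
      fix i :: nat
      have "Re (- 2) < 0" "0 \<le> Re (complex_of_nat i)" by simp_all
      then show "- 2 \<noteq> complex_of_nat i" by (metis not_le)
    qed
    then show False using no_infinite_weights[of "\<lambda>n. (brkt G e ^^ n) w" \<alpha> \<alpha>, OF it _ f(3)] f(4) by simp
  qed
  then show ?thesis unfolding w_def by auto
qed

text \<open>Let y be the partner of x. Bracketing y with [x, x] gives 2[t, x] = 2\<alpha>(t)x, which
  is nonzero because \<alpha> is not isotropic.\<close>

lemma odd_square_nonzero:
  assumes "x \<in> rs \<alpha>" "x \<in> part G True" "x \<noteq> 0"
  shows "brkt G x x \<noteq> 0"
proof
  assume 0: "brkt G x x = 0"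
  obtain y where y: "y \<in> rs (\<lambda>h. - \<alpha> h)" "y \<in> part G True" "\<kappa> x y = 1"
    using kappa_pairing[OF assms(1,3,2)] .
  have xy: "brkt G x y = t" using brkt_opposite_eq[OF assms(1) y(1)] y(3) by simp
  have yx: "brkt G y x = t" using antisym[OF assms(2) y(2)] xy by (simp add: ksign_def)
  have "brkt G x t = - brkt G t x" using antisym_even[of t x] t_H0 H_even by auto
  then have "brkt G t x + brkt G t x = 0"
    using jacobi[OF y(2) assms(2), of x] yx 0 by (simp add: ksign_def)
  then have "smul G (2 * \<alpha> t) x = 0"
    using root_spaceD[OF assms(1) t_H0] by (simp add: vs.scale_left_distrib[symmetric])
  then show False using assms(3) t_nz by simp
qed

end


section \<open>Supports of weight modules\<close>

lemma dual_space_combine: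
  "\<mu> \<in> dual_space V H \<Longrightarrow> \<nu> \<in> dual_space V H \<Longrightarrow> (\<lambda>h. \<mu> h + c * \<nu> h) \<in> dual_space V H"
  by (auto simp: dual_space_def algebra_simps)

lemma dual_space_scale: "\<mu> \<in> dual_space V H \<Longrightarrow> (\<lambda>h. c * \<mu> h) \<in> dual_space V H"
  by (auto simp: dual_space_def algebra_simps)

lemma dual_space_uminus: "\<mu> \<in> dual_space V H \<Longrightarrow> - \<mu> \<in> dual_space V H"
  by (auto simp: dual_space_def fun_Compl_def)

section \<open>Modules and the action of a single element\<close>

locale lie_mod = torus L H for L :: "('l::ab_group_add, 'z) lie_super_scheme" and H +
  fixes M :: "('l, 'm::ab_group_add, 'x) super_module_scheme"
  assumes lie_module: "lie_module L M"
begin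

lemma super_space_M: "super_space M" using lie_module by (simp add: lie_module_def)

sublocale ms: vector_space "smul M" using super_space_M by (simp add: super_space_def)

lemma linear_act: "Vector_Spaces.linear (smul M) (smul M) (act M x)"
  and linear_act_left: "Vector_Spaces.linear (smul L) (smul M) (\<lambda>x. act M x v)"
  and act_part: "x \<in> part L p \<Longrightarrow> v \<in> part M q \<Longrightarrow> act M x v \<in> part M (p \<noteq> q)"
  and act_brkt: "x \<in> part L p \<Longrightarrow> y \<in> part L q \<Longrightarrow>
    act M (brkt L x y) v = act M x (act M y v) - smul M (ksign p q) (act M y (act M x v))"
  using lie_module unfolding lie_module_def by blast+

lemma act_add: "act M x (v + w) = act M x v + act M x w"
  and act_add_left: "act M (x + y) v = act M x v + act M y v"
  and act_smul: "act M x (smul M a v) = smul M a (act M x v)"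
  and act_smul_left: "act M (smul L a x) v = smul M a (act M x v)"
  using linear_add[OF linear_act] linear_add[OF linear_act_left]
    linear_scale[OF linear_act] linear_scale[OF linear_act_left] by auto

lemma act_zero [simp]: "act M x 0 = 0" "act M 0 v = 0"
  using act_smul[of x 0 0] act_smul_left[of 0 0 v] by simp_all

lemma inj_act_iff: "inj (act M x) \<longleftrightarrow> (\<forall>v. act M x v = 0 \<longrightarrow> v = 0)"
proof
  assume *: "\<forall>v. act M x v = 0 \<longrightarrow> v = 0"
  show "inj (act M x)"
  proof (rule injI)
    fix v w assume "act M x v = act M x w"
    then have "act M x (v + smul M (- 1) w) = 0" by (simp only: act_add act_smul) simp
    with * have "v + smul M (- 1) w = 0" by blast
    then show "v = w" by simp
  qed
qed (metis act_zero(1) injD)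

lemma act_brkt_even:
  assumes "x \<in> part L False"
  shows "act M x (act M y v) = act M (brkt L x y) v + act M y (act M x v)"
proof -
  obtain y0 y1 where y: "y0 \<in> part L False" "y1 \<in> part L True" "y = y0 + y1"
    using super_space_decomp[OF super_space] .
  then show ?thesis
    using act_brkt[OF assms y(1), of v] act_brkt[OF assms y(2), of v]
    by (simp add: act_add act_add_left brkt_add ksign_def)
qed

lemma act_odd_sq:
  assumes "x \<in> part L True"
  shows "act M (brkt L x x) v = smul M 2 (act M x (act M x v))"
  using act_brkt[OF assms assms, of v] ms.scale_left_distrib[of 1 1 "act M x (act M x v)"]
  by (simp add: ksign_def)

lemma funpow_act_zero [simp]: "(act M x ^^ n) 0 = 0"
  by (induction n) auto

text \<open>By the Leibniz rule the result is a combination of terms in which i factors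
  \<open>x\<close> hit \<open>y\<close> and j hit \<open>v\<close>, with i + j = m + n; either i
  reaches \<open>m\<close> or j reaches \<open>n\<close>.\<close>

lemma funpow_act_brkt:
  assumes x: "x \<in> part L False"
  shows "(brkt L x ^^ m) y = 0 \<Longrightarrow> (act M x ^^ n) v = 0 \<Longrightarrow> (act M x ^^ (m + n)) (act M y v) = 0"
proof (induction "m + n" arbitrary: m n y v)
  case 0 then show ?case by simp
next
  case (Suc k)
  show ?case
  proof (cases "m = 0 \<or> n = 0")
    case True
    then show ?thesis using Suc.prems by auto
  next
    case False
    then obtain m' n' where mn: "m = Suc m'" "n = Suc n'" by (metis not0_implies_Suc)
    have "(act M x ^^ (m' + n)) (act M (brkt L x y) v) = 0"
      using Suc.hyps(1)[of m' n "brkt L x y" v] Suc.hyps(2) Suc.prems mn by (simp add: funpow_swap1)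
    moreover have "(act M x ^^ (m + n')) (act M y (act M x v)) = 0"
      using Suc.hyps(1)[of m n' y "act M x v"] Suc.hyps(2) Suc.prems mn by (simp add: funpow_swap1)
    ultimately have "(act M x ^^ (m' + n)) (act M x (act M y v)) = 0"
      using mn by (simp only: act_brkt_even[OF x] linear_add[OF ms.linear_funpow[OF linear_act]]) simp
    then show ?thesis using mn by (simp add: funpow_swap1)
  qed
qed

lemma funpow_act_part: "x \<in> part L False \<Longrightarrow> v \<in> part M q \<Longrightarrow> (act M x ^^ n) v \<in> part M q"
  by (induction n) (use act_part[of x False] in auto)

lemma dichotomy:
  assumes simple: "simple_module L M" and x: "x \<in> part L False"
    and nil: "\<And>y. \<exists>n. (brkt L x ^^ n) y = 0"
  shows "inj (act M x) \<or> (\<forall>v. \<exists>n. (act M x ^^ n) v = 0)"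
proof -
  define W where "W = {v. \<exists>n. (act M x ^^ n) v = 0}"
  \<comment> \<open>Simplicity only concerns graded submodules. The homogeneous parts of a vector in
    \<open>W\<close> lie in \<open>W\<close> because an even \<open>x\<close> preserves
    parity.\<close>
  have "graded_subspace M W" unfolding graded_subspace_def
  proof (intro conjI ballI)
    show "ms.subspace W" unfolding W_def by (rule ms.subspace_locally_nilpotent[OF linear_act])
    fix w assume "w \<in> W"
    then obtain n where n: "(act M x ^^ n) w = 0" by (auto simp: W_def)
    obtain a b where ab: "a \<in> part M False" "b \<in> part M True" "w = a + b"
      using super_space_decomp[OF super_space_M] .
    have "(act M x ^^ n) a + (act M x ^^ n) b = 0"
      using n ab(3) by (simp add: linear_add[OF ms.linear_funpow[OF linear_act]])
    with super_space_zero[OF super_space_M] funpow_act_part[OF x] ab(1,2)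
    have "(act M x ^^ n) a = 0" "(act M x ^^ n) b = 0" by blast+
    then show "\<exists>x \<in> W \<inter> part M False. \<exists>y \<in> W \<inter> part M True. w = x + y"
      using ab by (auto simp: W_def)
  qed
  moreover have "\<forall>y. \<forall>v\<in>W. act M y v \<in> W"
  proof (intro allI ballI)
    fix y v assume "v \<in> W"
    then obtain n where "(act M x ^^ n) v = 0" by (auto simp: W_def)
    moreover obtain m where "(brkt L x ^^ m) y = 0" using nil by blast
    ultimately show "act M y v \<in> W" using funpow_act_brkt[OF x] unfolding W_def by blast
  qed
  ultimately consider "W = {0}" | "W = UNIV" using simple unfolding simple_module_def by blast
  then show ?thesis
  proof cases
    case 1
    have "v = 0" if "act M x v = 0" for v
    proof -
      have "(act M x ^^ 1) v = 0" using that by simp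
      then have "v \<in> W" unfolding W_def by blast
      then show ?thesis using 1 by simp
    qed
    then show ?thesis by (simp add: inj_act_iff)
  qed (auto simp: W_def)
qed

lemma not_inj_and_nilpotent:
  assumes "v \<noteq> (0 :: 'm)" "inj (act M x)" shows "(act M x ^^ n) v \<noteq> 0"
  using assms by (induction n) (auto simp: inj_act_iff)

lemma inj_act_odd_sq:
  assumes "x \<in> part L True"
  shows "inj (act M (brkt L x x)) \<longleftrightarrow> inj (act M x)"
  by (auto simp: inj_act_iff act_odd_sq[OF assms])

lemma funpow_act_odd_sq:
  assumes "x \<in> part L True"
  shows "(act M (brkt L x x) ^^ n) v = smul M (2 ^ n) ((act M x ^^ (2 * n)) v)"
  by (induction n) (simp_all add: act_odd_sq[OF assms] act_smul mult.commute)

lemma nilpotent_act_odd_sq: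
  assumes "x \<in> part L True"
  shows "(\<exists>n. (act M (brkt L x x) ^^ n) v = 0) \<longleftrightarrow> (\<exists>n. (act M x ^^ n) v = 0)"
proof
  assume "\<exists>n. (act M x ^^ n) v = 0"
  then obtain n where "(act M x ^^ n) v = 0" by blast
  then have "(act M x ^^ (n + n)) v = 0" by (rule ms.funpow_add_zero[OF linear_act])
  then have "(act M (brkt L x x) ^^ n) v = 0" by (simp add: funpow_act_odd_sq[OF assms] mult_2)
  then show "\<exists>n. (act M (brkt L x x) ^^ n) v = 0" ..
qed (auto simp: funpow_act_odd_sq[OF assms])

end

section \<open>Weights and the support\<close>

locale weight_module = lie_mod L "cartan L" M
  for L :: "('l::ab_group_add, 'y) affine_super_scheme"
    and M :: "('l, 'm::ab_group_add, 'x) super_module_scheme" +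
  assumes finite_weight: "finite_weight_module L M"
begin

abbreviation D :: "('l \<Rightarrow> complex) set" where "D \<equiv> dual_space L (cartan L)"
abbreviation rts :: "('l \<Rightarrow> complex) \<Rightarrow> 'l set" where "rts \<equiv> root_space L (cartan L)"
abbreviation wt :: "('l \<Rightarrow> complex) \<Rightarrow> 'm set" where "wt \<equiv> weight_space L M"

definition supp :: "('l \<Rightarrow> complex) set" where
  "supp = {\<mu> \<in> D. \<exists>v \<in> wt \<mu>. v \<noteq> 0}"

lemma act_weight:
  assumes "x \<in> rts \<alpha>" "v \<in> wt \<mu>"
  shows "act M x v \<in> wt (\<lambda>h. \<mu> h + \<alpha> h)"
  unfolding weight_space_def
proof (intro CollectI ballI)
  fix h assume h: "h \<in> cartan L"
  have "act M h (act M x v) = act M (brkt L h x) v + act M x (act M h v)"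
    using act_brkt_even h H_even by blast
  then show "act M h (act M x v) = smul M (\<mu> h + \<alpha> h) (act M x v)"
    using assms h by (simp add: root_space_def weight_space_def act_smul act_smul_left
        ms.scale_left_distrib add.commute)
qed

lemma funpow_act_weight:
  assumes "x \<in> rts \<alpha>" "v \<in> wt \<mu>"
  shows "(act M x ^^ n) v \<in> wt (\<lambda>h. \<mu> h + of_nat n * \<alpha> h)"
proof (induction n)
  case (Suc n)
  have "(act M x ^^ Suc n) v \<in> wt (\<lambda>h. (\<mu> h + of_nat n * \<alpha> h) + \<alpha> h)"
    using act_weight[OF assms(1) Suc] by simp
  then show ?case by (simp add: algebra_simps)
qed (use assms in simp)

lemma supp_nonempty:
  assumes "v \<noteq> (0 :: 'm)" shows "supp \<noteq> {}"
proof
  assume "supp = {}"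
  then have "(\<Union>\<mu>\<in>D. wt \<mu>) \<subseteq> {0}" by (auto simp: supp_def)
  then have "ms.span (\<Union>\<mu>\<in>D. wt \<mu>) \<subseteq> {0}" by (rule ms.span_minimal) (rule ms.subspace_single_0)
  then show False using finite_weight assms unfolding finite_weight_module_def by auto
qed

lemma supp_inj:
  assumes "x \<in> rts \<alpha>" "\<alpha> \<in> D" "inj (act M x)" "\<mu> \<in> supp"
  shows "(\<lambda>h. \<mu> h + \<alpha> h) \<in> supp"
proof -
  obtain v where v: "v \<in> wt \<mu>" "v \<noteq> 0" "\<mu> \<in> D" using assms(4) by (auto simp: supp_def)
  then show ?thesis
    using act_weight[OF assms(1) v(1)] assms(3) dual_space_combine[OF v(3) assms(2), of 1]
    by (auto simp: supp_def inj_act_iff)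
qed

text \<open>Finite dimensionality of the weight spaces enters here: the exponents of a finite
  spanning set add up to one exponent for the whole weight space.\<close>

lemma weight_space_nilpotent:
  assumes "\<mu> \<in> D" "\<And>v. \<exists>n. (act M x ^^ n) v = 0"
  shows "\<exists>N. \<forall>v\<in>wt \<mu>. (act M x ^^ N) v = 0"
proof -
  obtain B where B: "finite B" "wt \<mu> \<subseteq> ms.span B"
    using finite_weight assms(1) unfolding finite_weight_module_def finite_dimensional_def by blast
  obtain k where k: "(act M x ^^ k v) v = 0" for v using assms(2) by metis
  define N where "N = sum k B"
  have "(act M x ^^ N) b = 0" if "b \<in> B" for b
  proof -
    have "N = sum k (B - {b}) + k b" using B(1) that by (simp add: N_def sum.remove)
    then show ?thesis using ms.funpow_add_zero[OF linear_act k] by simp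
  qed
  moreover have "ms.subspace {v. (act M x ^^ N) v = 0}"
    by (rule ms.subspaceI) (simp_all add: linear_add[OF ms.linear_funpow[OF linear_act]]
        linear_scale[OF ms.linear_funpow[OF linear_act]])
  ultimately have "ms.span B \<subseteq> {v. (act M x ^^ N) v = 0}"
    by (intro ms.span_minimal) auto
  then show ?thesis using B(2) by blast
qed

end

section \<open>One sl2-triple acting on a weight module\<close>

locale sl2_module = weight_module +
  fixes \<alpha> and e f :: 'a
  assumes \<alpha>: "\<alpha> \<in> D" and e: "e \<in> rts \<alpha>" "e \<in> part L False"
    and f: "f \<in> rts (- \<alpha>)" "f \<in> part L False"
    and h: "brkt L e f \<in> cartan L" "\<alpha> (brkt L e f) = 2"
begin

lemma swap: "sl2_module L M (- \<alpha>) f e"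
proof (intro sl2_module.intro weight_module_axioms sl2_module_axioms.intro)
  have fe: "brkt L f e = smul L (- 1) (brkt L e f)" using antisym_even[OF f(2)] by simp
  show "- \<alpha> \<in> D" by (rule dual_space_uminus[OF \<alpha>])
  have "- (- \<alpha>) = \<alpha>" by (rule ext) simp
  then show "e \<in> rts (- (- \<alpha>))" using e by simp
  have "\<alpha> (smul L (- 1) (brkt L e f)) = - 1 * \<alpha> (brkt L e f)"
    using \<alpha> h(1) unfolding dual_space_def by blast
  then show "(- \<alpha>) (brkt L f e) = 2" using h(2) fe by simp
  \<comment> \<open>Functionals in \<open>D\<close> vanish outside \<open>cartan L\<close>, so the
    nonzero value just computed already implies membership.\<close>
  show "brkt L f e \<in> cartan L"
  proof (rule ccontr)
    assume "brkt L f e \<notin> cartan L"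
    then have "\<alpha> (brkt L f e) = 0" using \<alpha> by (simp add: dual_space_def)
    with \<open>(- \<alpha>) (brkt L f e) = 2\<close> show False by simp
  qed
qed (use e f in auto)

lemma highest_weight_string:
  assumes v: "v \<in> wt \<mu>" "act M e v = 0"
  shows "sl2_string (smul M) (act M e) (act M f) v (\<mu> (brkt L e f))"
proof (rule sl2_string.intro)
  fix j
  have "act M (brkt L e f) ((act M f ^^ j) v)
      = smul M (\<mu> (brkt L e f) - 2 * of_nat j) ((act M f ^^ j) v)"
    using funpow_act_weight[OF f(1) v(1), of j] h by (simp add: weight_space_def mult.commute)
  then show "act M e (act M f ((act M f ^^ j) v)) = act M f (act M e ((act M f ^^ j) v))
      + smul M (\<mu> (brkt L e f) - 2 * of_nat j) ((act M f ^^ j) v)"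
    using act_brkt_even[OF e(2), of f "(act M f ^^ j) v"] by simp
qed (fact ms.vector_space_axioms linear_act v(2))+

lemma highest_weight_exists:
  assumes nil: "\<And>v. \<exists>n. (act M e ^^ n) v = 0" and v: "v \<in> wt \<mu>" "v \<noteq> 0"
  obtains j w where "w \<in> wt (\<lambda>h. \<mu> h + of_nat j * \<alpha> h)" "w \<noteq> 0" "act M e w = 0"
proof -
  define k where "k = (LEAST n. (act M e ^^ n) v = 0)"
  have k: "(act M e ^^ k) v = 0" unfolding k_def using nil by (rule LeastI_ex)
  have nz: "(act M e ^^ j) v \<noteq> 0" if "j < k" for j using that not_less_Least unfolding k_def by blast
  obtain j where j: "k = Suc j" using k v by (cases k) auto
  show ?thesis
  proof (rule that)
    show "(act M e ^^ j) v \<in> wt (\<lambda>h. \<mu> h + of_nat j * \<alpha> h)" by (rule funpow_act_weight[OF e(1) v(1)])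
    show "(act M e ^^ j) v \<noteq> 0" using nz j by simp
    show "act M e ((act M e ^^ j) v) = 0" using k j by simp
  qed
qed

text \<open>Far out on the ray there is a highest weight vector \<open>w\<close>. Lowering it
  \<open>j\<close> times to a fixed weight \<nu> and raising it again gives a nonzero vector,
  although on the weight space of \<nu> all powers of \<open>e\<close> from the uniform exponent
  \<open>N\<close> on vanish.\<close>

lemma finite_supp_ray:
  assumes nil: "\<And>v. \<exists>n. (act M e ^^ n) v = 0" and \<mu>: "\<mu> \<in> D"
  shows "finite {n::nat. (\<lambda>h. \<mu> h + of_nat n * \<alpha> h) \<in> supp}"
proof (rule ccontr)
  assume inf: "infinite {n::nat. (\<lambda>h. \<mu> h + of_nat n * \<alpha> h) \<in> supp}"
  let ?h = "brkt L e f"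
  \<comment> \<open>Weights take complex values, so positions are compared by real parts. Starting
    at \<nu> = \<mu> + p\<alpha> makes the real part of \<nu> on the coroot nonnegative; the weight
    of \<open>w\<close>, which is larger by 2j, then differs from all natural numbers below
    j.\<close>
  obtain p :: nat where p: "- Re (\<mu> ?h) \<le> real p" using real_arch_simple by blast
  define \<nu> where "\<nu> = (\<lambda>h. \<mu> h + of_nat p * \<alpha> h)"
  have "\<nu> \<in> D" unfolding \<nu>_def by (rule dual_space_combine[OF \<mu> \<alpha>])
  then obtain N where N: "\<forall>v\<in>wt \<nu>. (act M e ^^ N) v = 0" using weight_space_nilpotent nil by blast
  obtain n where n: "p + N \<le> n" "(\<lambda>h. \<mu> h + of_nat n * \<alpha> h) \<in> supp"
    using inf unfolding finite_nat_set_iff_bounded by (auto simp: not_less)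
  then obtain v where "v \<in> wt (\<lambda>h. \<mu> h + of_nat n * \<alpha> h)" "v \<noteq> 0" by (auto simp: supp_def)
  from highest_weight_exists[OF nil this] obtain i w where
    w: "w \<in> wt (\<lambda>h. \<mu> h + of_nat n * \<alpha> h + of_nat i * \<alpha> h)" "w \<noteq> 0" "act M e w = 0" .
  define j where "j = n + i - p"
  have j: "N \<le> j" "n + i = p + j" using n(1) by (auto simp: j_def)
  have eq: "\<mu> h + of_nat n * \<alpha> h + of_nat i * \<alpha> h = \<nu> h + of_nat j * \<alpha> h" for h
  proof -
    have "\<mu> h + of_nat n * \<alpha> h + of_nat i * \<alpha> h = \<mu> h + of_nat (n + i) * \<alpha> h"
      by (simp add: algebra_simps)
    then show ?thesis by (simp only: j(2) \<nu>_def of_nat_add distrib_right add.assoc)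
  qed
  have w': "w \<in> wt (\<lambda>h. \<nu> h + of_nat j * \<alpha> h)" using w(1) by (simp only: eq)
  interpret sl2_string "smul M" "act M e" "act M f" w "\<nu> ?h + of_nat j * \<alpha> ?h"
    using highest_weight_string[OF w' w(3)] .
  have "(act M f ^^ j) w \<in> wt \<nu>" using funpow_act_weight[OF f(1) w', of j] by simp
  then have "(act M e ^^ N) ((act M f ^^ j) w) = 0" using N by blast
  then have "(act M e ^^ (j - N + N)) ((act M f ^^ j) w) = 0"
    by (rule ms.funpow_add_zero[OF linear_act])
  moreover have "(act M e ^^ j) ((act M f ^^ j) w) \<noteq> 0"
  proof (rule raise_lower_nonzero[OF w(2)])
    fix i assume "i < j"
    moreover have "Re (\<nu> ?h + of_nat j * \<alpha> ?h) = Re (\<mu> ?h) + 2 * real p + 2 * real j"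
      by (simp add: \<nu>_def h)
    ultimately have "Re (of_nat i) < Re (\<nu> ?h + of_nat j * \<alpha> ?h)" using p by simp
    then show "\<nu> ?h + of_nat j * \<alpha> ?h \<noteq> of_nat i" by fastforce
  qed
  ultimately show False using j(1) by simp
qed

text \<open>A highest weight vector \<open>w\<close> above \<mu> has weight i = \<mu>(h) + 2j on the
  coroot h, and the string below it is nonzero up to the power i. The reflected weight is met after
  i - j steps; nonnegativity of \<mu>(h) = i - 2j keeps this subtraction from being
  truncated.\<close>

lemma reflect_supp_nonneg:
  assumes nil: "\<And>v. \<exists>n. (act M e ^^ n) v = 0" "\<And>v. \<exists>n. (act M f ^^ n) v = 0"
    and \<mu>: "\<mu> \<in> supp" and nonneg: "0 \<le> Re (\<mu> (brkt L e f))"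
  shows "(\<lambda>h. \<mu> h - \<mu> (brkt L e f) * \<alpha> h) \<in> supp"
proof -
  let ?h = "brkt L e f"
  obtain v where v: "v \<in> wt \<mu>" "v \<noteq> 0" "\<mu> \<in> D" using \<mu> by (auto simp: supp_def)
  from highest_weight_exists[OF nil(1) v(1,2)] obtain j w where
    w: "w \<in> wt (\<lambda>h. \<mu> h + of_nat j * \<alpha> h)" "w \<noteq> 0" "act M e w = 0" .
  interpret sl2_string "smul M" "act M e" "act M f" w "\<mu> ?h + of_nat j * \<alpha> ?h"
    using highest_weight_string[OF w(1,3)] .
  obtain i where i: "\<mu> ?h + of_nat j * \<alpha> ?h = of_nat i" "\<And>k. k \<le> i \<Longrightarrow> (act M f ^^ k) w \<noteq> 0"
    using nilpotent_weight[OF w(2)] nil(2) by blast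
  have mu: "\<mu> ?h = of_nat i - 2 * of_nat j" using i(1) by (simp add: h algebra_simps)
  have "2 * j \<le> i" using nonneg by (simp add: mu)
  then have "(act M f ^^ (i - j)) w \<noteq> 0" by (intro i(2)) simp
  moreover have "(act M f ^^ (i - j)) w \<in> wt (\<lambda>h. \<mu> h - \<mu> ?h * \<alpha> h)"
    using funpow_act_weight[OF f(1) w(1), of "i - j"] \<open>2 * j \<le> i\<close>
    by (simp add: mu of_nat_diff algebra_simps)
  moreover have "(\<lambda>h. \<mu> h - \<mu> ?h * \<alpha> h) \<in> D" using dual_space_combine[OF v(3) \<alpha>, of "- \<mu> ?h"] by simp
  ultimately show ?thesis unfolding supp_def by blast
qed

lemma reflect_supp:
  assumes nil: "\<And>v. \<exists>n. (act M e ^^ n) v = 0" "\<And>v. \<exists>n. (act M f ^^ n) v = 0"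
    and \<mu>: "\<mu> \<in> supp"
  shows "(\<lambda>h. \<mu> h - \<mu> (brkt L e f) * \<alpha> h) \<in> supp"
proof (cases "0 \<le> Re (\<mu> (brkt L e f))")
  case True then show ?thesis using reflect_supp_nonneg[OF nil \<mu>] by blast
next
  case False
  interpret sw: sl2_module L M "- \<alpha>" f e by (rule swap)
  have "brkt L f e = smul L (- 1) (brkt L e f)" using antisym_even[OF f(2)] by simp
  moreover have "\<mu> (smul L (- 1) (brkt L e f)) = - 1 * \<mu> (brkt L e f)"
    using \<mu> h(1) unfolding supp_def dual_space_def by blast
  ultimately have "\<mu> (brkt L f e) = - \<mu> (brkt L e f)" by simp
  then show ?thesis using sw.reflect_supp_nonneg[OF nil(2,1) \<mu>] False by simp
qed

end

text \<open>Only the values of \<alpha> and \<delta> on the coroots are prescribed, since in an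
  affinization the coroots for different \<open>j\<close> differ by multiples of a central
  element.\<close>

locale sl2_loop_module = weight_module +
  fixes \<alpha> and e f :: "int \<Rightarrow> 'a"
  assumes simple: "simple_module L M"
    and \<alpha>: "\<alpha> \<in> D" and \<delta>: "delta L \<in> D"
    and e: "e j \<in> rts (shift L \<alpha> j)" "e j \<in> part L False" "\<exists>n. (brkt L (e j) ^^ n) x = 0"
    and f: "f j \<in> rts (shift L (- \<alpha>) j)" "f j \<in> part L False" "\<exists>n. (brkt L (f j) ^^ n) x = 0"
    and h: "brkt L (e j) (f (- j)) \<in> cartan L" "\<alpha> (brkt L (e j) (f (- j))) = 2"
      "delta L (brkt L (e j) (f (- j))) = 0"
begin

lemma shift_D: "\<mu> \<in> D \<Longrightarrow> shift L \<mu> j \<in> D"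
  unfolding shift_def by (rule dual_space_combine[OF _ \<delta>])

lemma triple: "sl2_module L M (shift L \<alpha> j) (e j) (f (- j))"
proof (intro sl2_module.intro weight_module_axioms sl2_module_axioms.intro)
  have "shift L (- \<alpha>) (- j) = - shift L \<alpha> j" by (rule ext) (simp add: shift_def)
  then show "f (- j) \<in> rts (- shift L \<alpha> j)" using f(1)[of "- j"] by simp
  show "shift L \<alpha> j (brkt L (e j) (f (- j))) = 2" using h(2,3)[of j] by (simp add: shift_def)
qed (use e f h \<alpha> shift_D in auto)

lemma triple': "sl2_module L M (shift L (- \<alpha>) j) (f j) (e (- j))"
proof -
  have "- shift L \<alpha> (- j) = shift L (- \<alpha>) j" by (rule ext) (simp add: shift_def)
  then show ?thesis using sl2_module.swap[OF triple[of "- j"]] by simp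
qed

definition K :: "(int \<times> int) set" where
  "K = {(i, k). \<forall>\<mu>\<in>supp. (\<lambda>h. \<mu> h + of_int i * \<alpha> h + of_int k * delta L h) \<in> supp}"

lemma K_D: "(i, k) \<in> K \<Longrightarrow> \<mu> \<in> supp \<Longrightarrow> (\<lambda>h. \<mu> h + of_int i * \<alpha> h + of_int k * delta L h) \<in> supp"
  by (simp add: K_def)

lemma K_add:
  assumes "(i, k) \<in> K" "(j, l) \<in> K" shows "(i + j, k + l) \<in> K"
  unfolding K_def
proof (intro CollectI case_prodI ballI)
  fix \<mu> assume "\<mu> \<in> supp"
  from K_D[OF assms(2) K_D[OF assms(1) this]]
  show "(\<lambda>h. \<mu> h + of_int (i + j) * \<alpha> h + of_int (k + l) * delta L h) \<in> supp"
    by (simp add: algebra_simps)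
qed

lemma K_mult: "(i, k) \<in> K \<Longrightarrow> (int n * i, int n * k) \<in> K"
proof (induction n)
  case 0 show ?case by (simp add: K_def)
next
  case (Suc n)
  from K_add[OF Suc.prems Suc.IH[OF Suc.prems]] show ?case by (simp add: algebra_simps)
qed

text \<open>Iterating the translation by n times i\<alpha> + k\<delta> from one weight puts all
  positions n * q of a ray into the support.\<close>

lemma supp_ray_K:
  assumes n: "0 < n" and K: "(i * int n, k * int n) \<in> K"
    and fin: "\<And>\<mu>. \<mu> \<in> D \<Longrightarrow>
      finite {m::nat. (\<lambda>h. \<mu> h + of_nat m * (of_int i * \<alpha> h + of_int k * delta L h)) \<in> supp}"
  shows False
proof -
  obtain v where "v \<noteq> (0 :: 'c)" using simple by (auto simp: simple_module_def)
  then obtain \<mu> where \<mu>: "\<mu> \<in> supp" using supp_nonempty by blast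
  have "n * q \<in> {m::nat. (\<lambda>h. \<mu> h + of_nat m * (of_int i * \<alpha> h + of_int k * delta L h)) \<in> supp}" for q
    using K_D[OF K_mult[OF K, of q] \<mu>] by (simp add: algebra_simps)
  then have "range (\<lambda>q. n * q) \<subseteq> {m::nat. (\<lambda>h. \<mu> h + of_nat m * (of_int i * \<alpha> h + of_int k * delta L h)) \<in> supp}"
    by blast
  then have "finite (range (\<lambda>q. n * q))"
    using fin[of \<mu>] \<mu> finite_subset by (auto simp: supp_def)
  then show False using n finite_imageD[of "\<lambda>q. n * q" UNIV] by (auto simp: inj_on_def)
qed

abbreviation A :: "int set" where "A \<equiv> {j. inj (act M (e j))}"
abbreviation B :: "int set" where "B \<equiv> {j. inj (act M (f j))}"

lemma nilpotent_e: "j \<notin> A \<Longrightarrow> \<exists>n. (act M (e j) ^^ n) v = 0"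
  using dichotomy[OF simple e(2,3)] by blast

lemma nilpotent_f: "j \<notin> B \<Longrightarrow> \<exists>n. (act M (f j) ^^ n) v = 0"
  using dichotomy[OF simple f(2,3)] by blast

lemma A_iff_K: "0 < n \<Longrightarrow> (int n, int n * k) \<in> K \<Longrightarrow> k \<in> A"
proof (rule ccontr)
  assume n: "0 < n" and K: "(int n, int n * k) \<in> K" and k: "k \<notin> A"
  interpret t: sl2_module L M "shift L \<alpha> k" "e k" "f (- k)" by (rule triple)
  show False
  proof (rule supp_ray_K[OF n])
    show "(1 * int n, k * int n) \<in> K" using K by (simp add: mult.commute)
    show "finite {m::nat. (\<lambda>h. \<mu> h + of_nat m * (of_int 1 * \<alpha> h + of_int k * delta L h)) \<in> supp}"
      if "\<mu> \<in> D" for \<mu>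
      using t.finite_supp_ray[OF nilpotent_e[OF k] that] by (simp add: shift_def)
  qed
qed

lemma B_iff_K: "0 < n \<Longrightarrow> (- int n, int n * k) \<in> K \<Longrightarrow> k \<in> B"
proof (rule ccontr)
  assume n: "0 < n" and K: "(- int n, int n * k) \<in> K" and k: "k \<notin> B"
  interpret t: sl2_module L M "shift L (- \<alpha>) k" "f k" "e (- k)" by (rule triple')
  show False
  proof (rule supp_ray_K[OF n])
    show "(- 1 * int n, k * int n) \<in> K" using K by (simp add: mult.commute)
    show "finite {m::nat. (\<lambda>h. \<mu> h + of_nat m * (of_int (- 1) * \<alpha> h + of_int k * delta L h)) \<in> supp}"
      if "\<mu> \<in> D" for \<mu>
      using t.finite_supp_ray[OF nilpotent_f[OF k] that] by (simp add: shift_def)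
  qed
qed

lemma A_K: "k \<in> A \<Longrightarrow> (1, k) \<in> K"
  using supp_inj[OF e(1) shift_D[OF \<alpha>]] by (auto simp: K_def shift_def add.assoc)

lemma B_K: "k \<in> B \<Longrightarrow> (- 1, k) \<in> K"
  using supp_inj[OF f(1) shift_D[OF dual_space_uminus[OF \<alpha>]]] by (auto simp: K_def shift_def add.assoc)

text \<open>The reflection in \<alpha> + l\<delta> preserves the support, and conjugating the
  translation by i\<alpha> + k\<delta> with it gives the translation by - i\<alpha> + (k -
  2il)\<delta>, because \<alpha> is 2 and \<delta> is 0 on the coroot. Membership in
  \<open>K\<close> then decides injectivity.\<close>

lemma reflect:
  assumes l: "l \<notin> A" "- l \<notin> B"
  shows "j \<in> A \<longleftrightarrow> j - 2 * l \<in> B"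
proof -
  interpret t: sl2_module L M "shift L \<alpha> l" "e l" "f (- l)" by (rule triple)
  let ?h = "brkt L (e l) (f (- l))"
  have R: "(\<lambda>h. \<mu> h - \<mu> ?h * (\<alpha> h + of_int l * delta L h)) \<in> supp" if "\<mu> \<in> supp" for \<mu>
    using t.reflect_supp[OF nilpotent_e[OF l(1)] nilpotent_f[OF l(2)] that] by (simp add: shift_def)
  have refl_K: "(- i, k - 2 * i * l) \<in> K" if K: "(i, k) \<in> K" for i k
    unfolding K_def
  proof (intro CollectI case_prodI ballI)
    fix \<mu> assume "\<mu> \<in> supp"
    from R[OF K_D[OF K R[OF this]]]
    show "(\<lambda>h. \<mu> h + of_int (- i) * \<alpha> h + of_int (k - 2 * i * l) * delta L h) \<in> supp"
      by (simp add: h algebra_simps)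
  qed
  show ?thesis
  proof
    assume "j \<in> A"
    from refl_K[OF A_K[OF this]] show "j - 2 * l \<in> B" using B_iff_K[of 1 "j - 2 * l"] by simp
  next
    assume "j - 2 * l \<in> B"
    from refl_K[OF B_K[OF this]] show "j \<in> A" using A_iff_K[of 1 j] by simp
  qed
qed

theorem string_type: "string_type A B"
proof -
  interpret string_pair A B K
    by unfold_locales (use K_add A_K B_K A_iff_K B_iff_K reflect in \<open>auto simp: K_def\<close>)
  show ?thesis by (rule string_type)
qed

end


section \<open>Affinizations\<close>

text \<open>A common frame for both constructions: in type A(n,n) \<open>\<epsilon> = 1\<close> and \<open>c1\<close>, \<open>c2\<close>, \<open>d1\<close>, \<open>d2\<close> are as in the
  paper; otherwise \<open>\<epsilon> = 0\<close>, \<open>ds = 0\<close>, \<open>c1 = d1 = 0\<close>, and \<open>c2\<close>, \<open>d2\<close> are the paper's \<open>c\<close>, \<open>d\<close>.\<close>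

locale affine_lie = basic_lie G H0 \<kappa> + L: lie_superalg L
  for G :: "('g::ab_group_add, 'z) lie_super_scheme" and H0 \<kappa>
    and L :: "('l::ab_group_add, 'y) affine_super_scheme" +
  fixes \<tau> :: "int \<Rightarrow> 'g \<Rightarrow> 'l" and ds :: "'g \<Rightarrow> 'g" and c1 c2 d1 d2 :: 'l and r \<epsilon> :: complex
  assumes linear_tau: "Vector_Spaces.linear (smul G) (smul L) (\<tau> p)"
    and repr: "\<exists>P g a1 a2 b1 b2. finite P \<and> v = (\<Sum>p\<in>P. \<tau> p (g p))
      + smul L a1 c1 + smul L a2 c2 + smul L b1 d1 + smul L b2 d2"
    and indep: "finite P \<Longrightarrow> (\<Sum>p\<in>P. \<tau> p (g p))
      + smul L a1 c1 + smul L a2 c2 + smul L b1 d1 + smul L b2 d2 = 0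
      \<Longrightarrow> (\<forall>p\<in>P. g p = 0) \<and> a2 = 0 \<and> b2 = 0 \<and> \<epsilon> * a1 = 0 \<and> \<epsilon> * b1 = 0"
    and eps: "\<epsilon> = 1 \<or> \<epsilon> = 0 \<and> c1 = 0 \<and> d1 = 0"
    and tau_part: "x \<in> part G s \<Longrightarrow> \<tau> p x \<in> part L s"
    and cd_even: "c1 \<in> part L False" "c2 \<in> part L False" "d1 \<in> part L False" "d2 \<in> part L False"
    and brkt_c: "brkt L c1 v = 0" "brkt L c2 v = 0"
    and brkt_d1_d2: "brkt L d1 d2 = 0"
    and brkt_d1: "brkt L d1 (\<tau> p x) = smul L 2 (\<tau> p (ds x))"
    and brkt_d2: "brkt L d2 (\<tau> p x) = smul L (of_int p) (\<tau> p x)"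
    and brkt_tau: "brkt L (\<tau> p x) (\<tau> q y) = \<tau> (p + q) (brkt G x y)
      + (if p + q = 0 then smul L (\<kappa> (ds x) y * r) c1 + smul L (of_int p * \<kappa> x y) c2 else 0)"
    and ds_even: "x \<in> part G False \<Longrightarrow> ds x = 0"
    and cartan: "cartan L = {\<tau> 0 h + smul L a1 c1 + smul L a2 c2 + smul L b1 d1 + smul L b2 d2
      | h a1 a2 b1 b2. h \<in> H0}"
    and cartan_form: "h \<in> H0 \<Longrightarrow> h' \<in> H0 \<Longrightarrow> cartan_form L
        (\<tau> 0 h + smul L a1 c1 + smul L a2 c2 + smul L b1 d1 + smul L b2 d2)
        (\<tau> 0 h' + smul L a1' c1 + smul L a2' c2 + smul L b1' d1 + smul L b2' d2)
      = \<kappa> h h' + \<epsilon> * (a1 * b1' + b1 * a1') + (a2 * b2' + b2 * a2')"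
    and delta_dual: "delta L \<in> dual_space L (cartan L)"
    and delta: "h \<in> H0 \<Longrightarrow>
      delta L (\<tau> 0 h + smul L a1 c1 + smul L a2 c2 + smul L b1 d1 + smul L b2 d2) = b2"
begin

lemma tau_add: "\<tau> p (x + y) = \<tau> p x + \<tau> p y"
  and tau_smul: "\<tau> p (smul G a x) = smul L a (\<tau> p x)"
  using linear_add[OF linear_tau] linear_scale[OF linear_tau] by auto

lemma tau_zero [simp]: "\<tau> p 0 = 0"
  using tau_smul[of p 0 0] by simp

lemma tau_diff: "\<tau> p (x - y) = \<tau> p x - \<tau> p y"
  using tau_add[of p "x - y" y] by simp

lemma tau_eq_0: "\<tau> p x = 0 \<Longrightarrow> x = 0"
  using indep[of "{p}" "\<lambda>_. x" 0 0 0 0] by simp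

lemma brkt_c_right: "brkt L v c1 = 0" "brkt L v c2 = 0"
  using L.antisym_even[OF cd_even(1), of v] L.antisym_even[OF cd_even(2), of v] by (simp_all add: brkt_c)

lemma brkt_d_self: "brkt L d1 d1 = 0" "brkt L d2 d2 = 0" "brkt L d2 d1 = 0"
  using L.brkt_even_self cd_even L.antisym_even[OF cd_even(4), of d1] by (simp_all add: brkt_d1_d2)

lemma zero_H0: "0 \<in> H0" by (rule vs.subspace_0[OF subspace_H0])

lemma ds_H0: "h \<in> H0 \<Longrightarrow> ds h = 0" using ds_even H_even by blast

lemma cartanI: "h \<in> H0 \<Longrightarrow>
    \<tau> 0 h + smul L a1 c1 + smul L a2 c2 + smul L b1 d1 + smul L b2 d2 \<in> cartan L"
  unfolding cartan by blast

lemma cartan_elems: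
  "h \<in> H0 \<Longrightarrow> \<tau> 0 h \<in> cartan L" "c1 \<in> cartan L" "c2 \<in> cartan L" "d1 \<in> cartan L" "d2 \<in> cartan L"
  using cartanI[of h 0 0 0 0] cartanI[OF zero_H0, of 1 0 0 0] cartanI[OF zero_H0, of 0 1 0 0]
    cartanI[OF zero_H0, of 0 0 1 0] cartanI[OF zero_H0, of 0 0 0 1] by simp_all

lemma cartan_even: "cartan L \<subseteq> part L False"
proof
  fix x assume "x \<in> cartan L"
  then obtain h a1 a2 b1 b2 where "h \<in> H0"
    and x: "x = \<tau> 0 h + smul L a1 c1 + smul L a2 c2 + smul L b1 d1 + smul L b2 d2"
    unfolding cartan by blast
  then have "\<tau> 0 h \<in> part L False" using H_even tau_part by blast
  then show "x \<in> part L False" unfolding x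
    by (intro L.vs.subspace_add[OF L.subspace_part] L.vs.subspace_scale[OF L.subspace_part] cd_even)
qed

sublocale L: torus L "cartan L" by unfold_locales (rule cartan_even)

abbreviation rts :: "('l \<Rightarrow> complex) \<Rightarrow> 'l set" where "rts \<equiv> root_space L (cartan L)"
abbreviation D :: "('l \<Rightarrow> complex) set" where "D \<equiv> dual_space L (cartan L)"

lemma dual_cartan:
  assumes "\<alpha> \<in> D" "h \<in> H0"
  shows "\<alpha> (\<tau> 0 h + smul L a1 c1 + smul L a2 c2 + smul L b1 d1 + smul L b2 d2)
    = \<alpha> (\<tau> 0 h) + a1 * \<alpha> c1 + a2 * \<alpha> c2 + b1 * \<alpha> d1 + b2 * \<alpha> d2"
proof -
  have add: "\<alpha> (x + y) = \<alpha> x + \<alpha> y" if "x \<in> cartan L" "y \<in> cartan L" for x y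
    using assms(1) that unfolding dual_space_def by blast
  have scale: "\<alpha> (smul L a x) = a * \<alpha> x" if "x \<in> cartan L" for a x
    using assms(1) that unfolding dual_space_def by blast
  have mem: "smul L a c1 \<in> cartan L" "smul L a c2 \<in> cartan L" "smul L a d1 \<in> cartan L"
      "smul L a d2 \<in> cartan L" for a
    using cartanI[OF zero_H0, of a 0 0 0] cartanI[OF zero_H0, of 0 a 0 0]
      cartanI[OF zero_H0, of 0 0 a 0] cartanI[OF zero_H0, of 0 0 0 a] by simp_all
  have sums: "\<tau> 0 h + smul L a1 c1 \<in> cartan L" "\<tau> 0 h + smul L a1 c1 + smul L a2 c2 \<in> cartan L"
      "\<tau> 0 h + smul L a1 c1 + smul L a2 c2 + smul L b1 d1 \<in> cartan L"
    using cartanI[OF assms(2), of a1 0 0 0] cartanI[OF assms(2), of a1 a2 0 0]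
      cartanI[OF assms(2), of a1 a2 b1 0] by simp_all
  show ?thesis
    using add[OF sums(3) mem(4)] add[OF sums(2) mem(3)] add[OF sums(1) mem(2)]
      add[OF cartan_elems(1)[OF assms(2)] mem(1)] scale[OF cartan_elems(2)] scale[OF cartan_elems(3)]
      scale[OF cartan_elems(4)] scale[OF cartan_elems(5)] by simp
qed

lemma delta_values: "h \<in> H0 \<Longrightarrow> delta L (\<tau> 0 h) = 0" "delta L c1 = 0" "delta L c2 = 0"
    "delta L d1 = 0" "delta L d2 = 1"
  using delta[of h 0 0 0 0] delta[OF zero_H0, of 1 0 0 0] delta[OF zero_H0, of 0 1 0 0]
    delta[OF zero_H0, of 0 0 1 0] delta[OF zero_H0, of 0 0 0 1] by simp_all

lemma dual_tau0:
  assumes "\<alpha> \<in> D"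
  shows "h \<in> H0 \<Longrightarrow> \<alpha> (\<tau> 0 (smul G a h)) = a * \<alpha> (\<tau> 0 h)"
  using assms cartan_elems(1) unfolding dual_space_def tau_smul by blast

lemma brkt_tau0: "h \<in> H0 \<Longrightarrow> brkt L (\<tau> 0 h) (\<tau> p x) = \<tau> p (brkt G h x)"
  by (simp add: brkt_tau ds_H0)

lemma brkt_tau0_d: "h \<in> H0 \<Longrightarrow> brkt L (\<tau> 0 h) d1 = 0" "h \<in> H0 \<Longrightarrow> brkt L (\<tau> 0 h) d2 = 0"
proof -
  assume h: "h \<in> H0"
  then have even: "\<tau> 0 h \<in> part L False" using L.H_even cartan_elems(1) by blast
  show "brkt L (\<tau> 0 h) d1 = 0" "brkt L (\<tau> 0 h) d2 = 0"
    using L.antisym_even[OF even] brkt_d1[of 0 h] brkt_d2[of 0 h] h by (simp_all add: ds_H0)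
qed

text \<open>By linearity \<alpha> is nonzero at some \<open>\<tau> 0 h\<close> or at one of
  \<open>c1\<close>, \<open>c2\<close>, \<open>d1\<close>, \<open>d2\<close>. The eigenvalue
  equation for that element kills the central and derivation components, and the equation for
  \<open>d2\<close> leaves a single power of the loop variable.\<close>

lemma rts_decode:
  assumes \<alpha>: "\<alpha> \<in> D" and x0: "x0 \<in> cartan L" "\<alpha> x0 \<noteq> 0" and v: "v \<in> rts \<alpha>" "v \<noteq> 0"
  obtains k z where "v = \<tau> k z" "z \<noteq> 0" "z \<in> rs (\<lambda>h. \<alpha> (\<tau> 0 h))" "\<alpha> d2 = of_int k" "\<alpha> c1 = 0" "\<alpha> c2 = 0"
    "smul G (\<alpha> d1) z = smul G 2 (ds z)"
proof -
  obtain P g a1 a2 b1 b2 where P: "finite P"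
    and v_eq: "v = (\<Sum>p\<in>P. \<tau> p (g p)) + smul L a1 c1 + smul L a2 c2 + smul L b1 d1 + smul L b2 d2"
    using repr[of v] by blast
  \<comment> \<open>The eigenvalue equation for a Cartan element \<open>X\<close>, compared
    coordinate by coordinate through \<open>indep\<close>; \<phi> describes the action of
    \<open>X\<close> on the loop part.\<close>
  have coord: "(\<forall>p\<in>P. smul G (\<alpha> X) (g p) = \<phi> p) \<and> \<alpha> X * a2 = 0 \<and> \<alpha> X * b2 = 0
      \<and> \<epsilon> * (\<alpha> X * a1) = 0 \<and> \<epsilon> * (\<alpha> X * b1) = 0"
    if X: "X \<in> cartan L" "\<And>p. brkt L X (\<tau> p (g p)) = \<tau> p (\<phi> p)"
      "brkt L X d1 = 0" "brkt L X d2 = 0" for X \<phi>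
  proof -
    have "brkt L X v = (\<Sum>p\<in>P. \<tau> p (\<phi> p))"
      unfolding v_eq by (simp add: L.brkt_add L.brkt_smul L.brkt_sum X brkt_c_right)
    then have "smul L (\<alpha> X) v - (\<Sum>p\<in>P. \<tau> p (\<phi> p)) = 0" using L.root_spaceD[OF v(1) X(1)] by simp
    moreover have "smul L (\<alpha> X) v = (\<Sum>p\<in>P. \<tau> p (smul G (\<alpha> X) (g p))) + smul L (\<alpha> X * a1) c1
        + smul L (\<alpha> X * a2) c2 + smul L (\<alpha> X * b1) d1 + smul L (\<alpha> X * b2) d2"
      unfolding v_eq by (simp add: L.vs.scale_right_distrib L.vs.scale_sum_right tau_smul)
    ultimately have "(\<Sum>p\<in>P. \<tau> p (smul G (\<alpha> X) (g p) - \<phi> p)) + smul L (\<alpha> X * a1) c1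
        + smul L (\<alpha> X * a2) c2 + smul L (\<alpha> X * b1) d1 + smul L (\<alpha> X * b2) d2 = 0"
      by (simp add: tau_diff sum_subtractf algebra_simps)
    from indep[OF P this] show ?thesis by simp
  qed
  have tau0: "h \<in> H0 \<Longrightarrow> (\<forall>p\<in>P. smul G (\<alpha> (\<tau> 0 h)) (g p) = brkt G h (g p)) \<and> \<alpha> (\<tau> 0 h) * a2 = 0
      \<and> \<alpha> (\<tau> 0 h) * b2 = 0 \<and> \<epsilon> * (\<alpha> (\<tau> 0 h) * a1) = 0 \<and> \<epsilon> * (\<alpha> (\<tau> 0 h) * b1) = 0" for h
    by (rule coord) (auto simp: brkt_tau0 brkt_tau0_d cartan_elems)
  have c1: "(\<forall>p\<in>P. smul G (\<alpha> c1) (g p) = 0) \<and> \<alpha> c1 * a2 = 0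
      \<and> \<alpha> c1 * b2 = 0 \<and> \<epsilon> * (\<alpha> c1 * a1) = 0 \<and> \<epsilon> * (\<alpha> c1 * b1) = 0"
    by (rule coord) (auto simp: brkt_c cartan_elems)
  have c2: "(\<forall>p\<in>P. smul G (\<alpha> c2) (g p) = 0) \<and> \<alpha> c2 * a2 = 0
      \<and> \<alpha> c2 * b2 = 0 \<and> \<epsilon> * (\<alpha> c2 * a1) = 0 \<and> \<epsilon> * (\<alpha> c2 * b1) = 0"
    by (rule coord) (auto simp: brkt_c cartan_elems)
  have d1: "(\<forall>p\<in>P. smul G (\<alpha> d1) (g p) = smul G 2 (ds (g p))) \<and> \<alpha> d1 * a2 = 0
      \<and> \<alpha> d1 * b2 = 0 \<and> \<epsilon> * (\<alpha> d1 * a1) = 0 \<and> \<epsilon> * (\<alpha> d1 * b1) = 0"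
    by (rule coord) (auto simp: brkt_d1 brkt_d1_d2 brkt_d_self cartan_elems tau_smul)
  have d2: "(\<forall>p\<in>P. smul G (\<alpha> d2) (g p) = smul G (of_int p) (g p)) \<and> \<alpha> d2 * a2 = 0
      \<and> \<alpha> d2 * b2 = 0 \<and> \<epsilon> * (\<alpha> d2 * a1) = 0 \<and> \<epsilon> * (\<alpha> d2 * b1) = 0"
    by (rule coord) (auto simp: brkt_d2 brkt_d_self cartan_elems tau_smul)
  obtain h x1 x2 y1 y2 where h: "h \<in> H0"
    and "x0 = \<tau> 0 h + smul L x1 c1 + smul L x2 c2 + smul L y1 d1 + smul L y2 d2"
    using x0(1) unfolding cartan by blast
  then have "\<alpha> (\<tau> 0 h) \<noteq> 0 \<or> \<alpha> c1 \<noteq> 0 \<or> \<alpha> c2 \<noteq> 0 \<or> \<alpha> d1 \<noteq> 0 \<or> \<alpha> d2 \<noteq> 0"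
    using dual_cartan[OF \<alpha> h] x0(2) by auto
  moreover have "a2 = 0 \<and> b2 = 0 \<and> \<epsilon> * a1 = 0 \<and> \<epsilon> * b1 = 0"
    if "x * a2 = 0 \<and> x * b2 = 0 \<and> \<epsilon> * (x * a1) = 0 \<and> \<epsilon> * (x * b1) = 0" "x \<noteq> 0" for x
    using that by auto
  ultimately have "a2 = 0 \<and> b2 = 0 \<and> \<epsilon> * a1 = 0 \<and> \<epsilon> * b1 = 0"
    using tau0[OF h] c1 c2 d1 d2 by blast
  \<comment> \<open>Either the coordinates at \<open>c1\<close> and \<open>d1\<close> vanish, or
    these two elements themselves do.\<close>
  then have v_sum: "v = (\<Sum>p\<in>P. \<tau> p (g p))" using eps v_eq by auto
  then obtain k where k: "k \<in> P" "g k \<noteq> 0" using v(2) by (metis (mono_tags) sum.neutral tau_zero)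
  have "smul G (\<alpha> d2) (g k) = smul G (of_int k) (g k)" using d2 k(1) by blast
  then have d2k: "\<alpha> d2 = of_int k" using k(2) by (simp add: vs.scale_cancel_right)
  have "g p = 0" if "p \<in> P - {k}" for p
  proof -
    have "smul G (of_int k) (g p) = smul G (of_int p) (g p)" using d2 d2k that by auto
    then show ?thesis using that by (auto simp: vs.scale_cancel_right)
  qed
  then have "v = \<tau> k (g k)" unfolding v_sum using k(1) P by (simp add: sum.remove)
  moreover have "g k \<in> rs (\<lambda>h. \<alpha> (\<tau> 0 h))" using tau0 k(1) by (auto simp: root_space_def)
  moreover have "smul G (\<alpha> c1) (g k) = 0" "smul G (\<alpha> c2) (g k) = 0"
      and "smul G (\<alpha> d1) (g k) = smul G 2 (ds (g k))"
    using c1 c2 d1 k(1) by blast+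
  moreover from this(1,2) have "\<alpha> c1 = 0" "\<alpha> c2 = 0" using k(2) by simp_all
  ultimately show ?thesis using that[of k "g k"] k(2) d2k by blast
qed

lemma tau_rts:
  assumes \<alpha>: "\<alpha> \<in> D" "\<alpha> c1 = 0" "\<alpha> c2 = 0" "\<alpha> d2 = of_int k"
    and z: "z \<in> rs (\<lambda>h. \<alpha> (\<tau> 0 h))" "smul G (\<alpha> d1) z = smul G 2 (ds z)"
  shows "\<tau> k z \<in> rts \<alpha>"
  unfolding root_space_def
proof (intro CollectI ballI)
  fix x assume "x \<in> cartan L"
  then obtain h a1 a2 b1 b2 where h: "h \<in> H0"
    and x: "x = \<tau> 0 h + smul L a1 c1 + smul L a2 c2 + smul L b1 d1 + smul L b2 d2"
    unfolding cartan by blast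
  have "smul L 2 (\<tau> k (ds z)) = smul L (\<alpha> d1) (\<tau> k z)" using z(2) by (metis tau_smul)
  then show "brkt L x (\<tau> k z) = smul L (\<alpha> x) (\<tau> k z)"
    using root_spaceD[OF z(1) h] unfolding x dual_cartan[OF \<alpha>(1) h]
    by (simp add: L.brkt_add_left L.brkt_smul_left brkt_tau0[OF h] brkt_c brkt_d1 brkt_d2 \<alpha>(2-4)
        tau_smul L.vs.scale_left_distrib)
qed

lemma dual_form_eq:
  assumes \<alpha>: "\<alpha> \<in> D" "\<alpha> c1 = 0" "\<alpha> c2 = 0" and t: "t \<in> H0" "\<And>h. h \<in> H0 \<Longrightarrow> \<kappa> t h = \<alpha> (\<tau> 0 h)"
  shows "dual_form L \<alpha> \<alpha> = \<alpha> (\<tau> 0 t)"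
proof -
  \<comment> \<open>Central elements pair with derivations, so the values of \<alpha> on
    \<open>d1\<close> and \<open>d2\<close> become central coordinates; there are no derivation
    coordinates because \<alpha> vanishes on \<open>c1\<close> and \<open>c2\<close>. This is why
    only the finite part contributes to the length.\<close>
  define T where "T = \<tau> 0 t + smul L (\<alpha> d1) c1 + smul L (\<alpha> d2) c2 + smul L 0 d1 + smul L 0 d2"
  have T: "T \<in> cartan L" unfolding T_def by (rule cartanI[OF t(1)])
  have d1: "\<epsilon> * \<alpha> d1 = \<alpha> d1"
    using eps dual_cartan[OF \<alpha>(1) zero_H0, of 0 0 0 0] dual_tau0[OF \<alpha>(1) zero_H0, of 0] by auto
  have form: "cartan_form L T h = \<alpha> h" if h_cartan: "h \<in> cartan L" for h
  proof -
    obtain h' a1 a2 b1 b2 where h: "h' \<in> H0"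
      "h = \<tau> 0 h' + smul L a1 c1 + smul L a2 c2 + smul L b1 d1 + smul L b2 d2"
      using h_cartan unfolding cartan by blast
    have "\<epsilon> * (\<alpha> d1 * b1 + 0 * a1) = b1 * \<alpha> d1" using arg_cong[OF d1, of "\<lambda>x. b1 * x"] by (simp add: algebra_simps)
    then show ?thesis unfolding T_def h(2) cartan_form[OF t(1) h(1)] dual_cartan[OF \<alpha>(1) h(1)]
      using t(2)[OF h(1)] \<alpha>(2,3) by simp
  qed
  have "dual_vector L \<alpha> = T" unfolding dual_vector_def
  proof (rule the_equality)
    show "T \<in> cartan L \<and> (\<forall>h\<in>cartan L. cartan_form L T h = \<alpha> h)" using T form by blast
    fix s assume s: "s \<in> cartan L \<and> (\<forall>h\<in>cartan L. cartan_form L s h = \<alpha> h)"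
    then obtain h a1 a2 b1 b2 where h: "h \<in> H0"
      and s_eq: "s = \<tau> 0 h + smul L a1 c1 + smul L a2 c2 + smul L b1 d1 + smul L b2 d2"
      unfolding cartan by blast
    have form_eq: "\<kappa> h h' + \<epsilon> * (a1 * b1' + b1 * a1') + (a2 * b2' + b2 * a2')
        = \<kappa> t h' + \<epsilon> * (\<alpha> d1 * b1' + 0 * a1') + (\<alpha> d2 * b2' + 0 * a2')"
      if "h' \<in> H0" for h' a1' a2' b1' b2'
      using cartan_form[OF h that, of a1 a2 b1 b2 a1' a2' b1' b2', folded s_eq]
        cartan_form[OF t(1) that, of "\<alpha> d1" "\<alpha> d2" 0 0 a1' a2' b1' b2', folded T_def]
        s form[OF cartanI[OF that, of a1' a2' b1' b2']] cartanI[OF that, of a1' a2' b1' b2'] by simp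
    have "h - t = 0"
    proof (rule kappa_nondeg_H0)
      show "h - t \<in> H0" using h t(1) by (rule vs.subspace_diff[OF subspace_H0])
      show "\<kappa> (h - t) h' = 0" if "h' \<in> H0" for h'
        using form_eq[OF that, of 0 0 0 0] by (simp add: kappa_diff)
    qed
    moreover have "a2 = \<alpha> d2" "b2 = 0" "\<epsilon> * a1 = \<epsilon> * \<alpha> d1" "\<epsilon> * b1 = 0"
      using form_eq[OF zero_H0, of 0 0 0 1] form_eq[OF zero_H0, of 0 1 0 0]
        form_eq[OF zero_H0, of 0 0 1 0] form_eq[OF zero_H0, of 1 0 0 0] by simp_all
    ultimately show "s = T" unfolding s_eq T_def using eps by auto
  qed
  then have "dual_form L \<alpha> \<alpha> = \<alpha> T" using form[OF T] by (simp add: dual_form_def)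
  also have "\<dots> = \<alpha> (\<tau> 0 t)" unfolding T_def dual_cartan[OF \<alpha>(1) t(1)] using \<alpha>(2,3) by simp
  finally show ?thesis .
qed

text \<open>On loop elements the bracket acts through \<open>brkt G E\<close> up to central terms,
  and these are killed at the next step. It kills \<open>d1\<close> because \<open>ds E = 0\<close>,
  and it sends \<open>d2\<close> to a multiple of \<open>\<tau> p E\<close>.\<close>

lemma tau_ad_nilpotent:
  assumes E: "E \<in> rs a" "E \<in> part G False" and h: "h \<in> H0" "a h \<noteq> 0"
  shows "\<exists>n. (brkt L (\<tau> p E) ^^ n) v = 0"
proof -
  let ?x = "\<tau> p E"
  define S where "S = {v. \<exists>n. (brkt L ?x ^^ n) v = 0}"
  have sub: "L.vs.subspace S" unfolding S_def by (rule L.vs.subspace_locally_nilpotent[OF L.linear_brkt])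
  have x: "?x \<in> part L False" by (rule tau_part[OF E(2)])
  have S1: "v \<in> S" if "brkt L ?x v = 0" for v
  proof -
    have "(brkt L ?x ^^ 1) v = 0" using that by simp
    then show ?thesis unfolding S_def by blast
  qed
  have S_step: "v \<in> S" if xv: "brkt L ?x v \<in> S" for v
  proof -
    obtain n where "(brkt L ?x ^^ n) (brkt L ?x v) = 0" using xv unfolding S_def by blast
    then have "(brkt L ?x ^^ Suc n) v = 0" by (simp add: funpow_swap1)
    then show ?thesis unfolding S_def by blast
  qed
  have c: "c1 \<in> S" "c2 \<in> S" using S1 by (simp_all add: brkt_c_right)
  have tau_step: "\<tau> q z \<in> S" if "\<tau> (p + q) (brkt G E z) \<in> S" for q z
    by (rule S_step, unfold brkt_tau, intro L.vs.subspace_add[OF sub] that)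
      (auto intro!: L.vs.subspace_add[OF sub] L.vs.subspace_scale[OF sub] L.vs.subspace_0[OF sub] c)
  have tau_nil: "(brkt G E ^^ n) z = 0 \<Longrightarrow> \<tau> q z \<in> S" for n q z
  proof (induction n arbitrary: q z)
    case 0 then show ?case using L.vs.subspace_0[OF sub] by simp
  next
    case (Suc n)
    then have "(brkt G E ^^ n) (brkt G E z) = 0" by (simp add: funpow_swap1)
    then have "\<tau> (p + q) (brkt G E z) \<in> S" by (rule Suc.IH)
    then show ?case by (rule tau_step)
  qed
  have tau: "\<tau> q z \<in> S" for q z using tau_nil ad_locally_nilpotent[OF E(1) h] by blast
  have d1: "d1 \<in> S" using L.antisym_even[OF x, of d1] by (intro S1) (simp add: brkt_d1 ds_even[OF E(2)])
  have d2: "d2 \<in> S"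
  proof (rule S_step)
    have "brkt L ?x d2 = smul L (- of_int p) ?x" using L.antisym_even[OF x, of d2] by (simp add: brkt_d2)
    then show "brkt L ?x d2 \<in> S" using L.vs.subspace_scale[OF sub tau] by metis
  qed
  obtain P g a1 a2 b1 b2 where "finite P"
    and v_eq: "v = (\<Sum>p\<in>P. \<tau> p (g p)) + smul L a1 c1 + smul L a2 c2 + smul L b1 d1 + smul L b2 d2"
    using repr[of v] by blast
  have "v \<in> S" unfolding v_eq
    by (intro L.vs.subspace_add[OF sub] L.vs.subspace_scale[OF sub] L.vs.subspace_sum[OF sub] tau c d1 d2)
  then show ?thesis by (simp add: S_def)
qed

end

text \<open>A real root in coordinates: it vanishes on the center, has degree \<open>k\<close>, and
  by \<open>dual_form_eq\<close> its squared length is \<open>\<alpha> (\<tau> 0 t)\<close>.\<close>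

locale affine_root = affine_lie +
  fixes \<alpha> and k :: int and t
  assumes \<alpha>: "\<alpha> \<in> D" "\<alpha> c1 = 0" "\<alpha> c2 = 0" "\<alpha> d2 = of_int k" and root: "rts \<alpha> \<noteq> {0}"
    and t: "t \<in> H0" "h \<in> H0 \<Longrightarrow> \<kappa> t h = \<alpha> (\<tau> 0 h)" "\<alpha> (\<tau> 0 t) \<noteq> 0"
begin

sublocale nonisotropic G H0 \<kappa> "\<lambda>h. \<alpha> (\<tau> 0 h)" t by unfold_locales (use t in auto)

lemma real: "\<alpha> \<in> real_roots L"
  using dual_form_eq[OF \<alpha>(1-3) t(1,2)] t(3) \<alpha>(1) root by (simp add: real_roots_def roots_def)

lemma rtsE:
  assumes "x \<in> rts \<alpha>" "x \<noteq> 0"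
  obtains z where "x = \<tau> k z" "z \<noteq> 0" "z \<in> rs (\<lambda>h. \<alpha> (\<tau> 0 h))" "smul G (\<alpha> d1) z = smul G 2 (ds z)"
proof -
  from rts_decode[OF \<alpha>(1) cartan_elems(1)[OF t(1)] t(3) assms] obtain k' z where
    z: "x = \<tau> k' z" "z \<noteq> 0" "z \<in> rs (\<lambda>h. \<alpha> (\<tau> 0 h))" "\<alpha> d2 = of_int k'"
      "smul G (\<alpha> d1) z = smul G 2 (ds z)" .
  then show ?thesis using that \<alpha>(4) by simp
qed

lemma ex_root_vector: obtains x where "x \<in> rts \<alpha>" "x \<noteq> 0"
  using root L.vs.subspace_0[OF L.subspace_root_space] by auto

text \<open>Adding j\<delta> changes only the degree: the same \<open>z\<close> serves as root
  vector with the power k + j of the loop variable.\<close>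

lemma shift: "affine_root G H0 \<kappa> L \<tau> ds c1 c2 d1 d2 r \<epsilon> (shift L \<alpha> j) (k + j) t"
proof (intro affine_root.intro affine_lie_axioms affine_root_axioms.intro)
  have tau0: "shift L \<alpha> j (\<tau> 0 h) = \<alpha> (\<tau> 0 h)" if "h \<in> H0" for h
    using that by (simp add: shift_def delta_values)
  show D: "shift L \<alpha> j \<in> D" unfolding shift_def by (rule dual_space_combine[OF \<alpha>(1) delta_dual])
  show vals: "shift L \<alpha> j c1 = 0" "shift L \<alpha> j c2 = 0" "shift L \<alpha> j d2 = of_int (k + j)"
    using \<alpha> by (simp_all add: shift_def delta_values)
  obtain x where "x \<in> rts \<alpha>" "x \<noteq> 0" using ex_root_vector .
  then obtain z where z: "z \<noteq> 0" "z \<in> rs (\<lambda>h. \<alpha> (\<tau> 0 h))" "smul G (\<alpha> d1) z = smul G 2 (ds z)"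
    using rtsE by blast
  have "rs (\<lambda>h. shift L \<alpha> j (\<tau> 0 h)) = rs (\<lambda>h. \<alpha> (\<tau> 0 h))"
    by (rule root_space_cong) (rule tau0)
  then have "\<tau> (k + j) z \<in> rts (shift L \<alpha> j)"
    using z by (intro tau_rts D vals) (simp_all add: shift_def delta_values)
  then show "rts (shift L \<alpha> j) \<noteq> {0}" using tau_eq_0 z(1) by blast
qed (use t delta_values in \<open>auto simp: shift_def\<close>)

end

context affine_lie
begin

text \<open>A root of nonzero length is not the zero functional, so \<open>rts_decode\<close>
  applies. The bracket of a homogeneous root vector with its normalized partner represents the
  finite part of \<alpha>.\<close>

lemma real_rootE:
  assumes "\<alpha> \<in> real_roots L"
  obtains k t where "affine_root G H0 \<kappa> L \<tau> ds c1 c2 d1 d2 r \<epsilon> \<alpha> k t"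
proof -
  have \<alpha>: "\<alpha> \<in> D" "rts \<alpha> \<noteq> {0}" and real: "dual_form L \<alpha> \<alpha> \<noteq> 0"
    using assms by (auto simp: real_roots_def roots_def)
  obtain v where v: "v \<in> rts \<alpha>" "v \<noteq> 0" using \<alpha>(2) L.vs.subspace_0[OF L.subspace_root_space] by blast
  have "\<exists>x0\<in>cartan L. \<alpha> x0 \<noteq> 0"
  proof (rule ccontr)
    assume "\<not> (\<exists>x0\<in>cartan L. \<alpha> x0 \<noteq> 0)"
    then have 0: "\<alpha> x0 = 0" if "x0 \<in> cartan L" for x0 using that by blast
    have "dual_form L \<alpha> \<alpha> = \<alpha> (\<tau> 0 0)"
      by (rule dual_form_eq[OF \<alpha>(1) _ _ zero_H0]) (simp_all add: 0 cartan_elems)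
    then show False using real 0[OF cartan_elems(1)[OF zero_H0]] by simp
  qed
  then obtain x0 where x0: "x0 \<in> cartan L" "\<alpha> x0 \<noteq> 0" by blast
  from rts_decode[OF \<alpha>(1) x0 v] obtain k z where kz: "v = \<tau> k z" "z \<noteq> 0" "z \<in> rs (\<lambda>h. \<alpha> (\<tau> 0 h))"
    "\<alpha> d2 = of_int k" "\<alpha> c1 = 0" "\<alpha> c2 = 0" "smul G (\<alpha> d1) z = smul G 2 (ds z)" .
  obtain z0 z1 where z: "z0 \<in> part G False" "z1 \<in> part G True" "z = z0 + z1"
    using super_space_decomp[OF super_space] .
  have "\<exists>p w. w \<in> part G p \<and> w \<noteq> 0 \<and> w \<in> rs (\<lambda>h. \<alpha> (\<tau> 0 h))"
    using root_space_parts[of z0 z1] kz(2,3) z by (cases "z0 = 0") auto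
  then obtain p w where w: "w \<in> part G p" "w \<noteq> 0" "w \<in> rs (\<lambda>h. \<alpha> (\<tau> 0 h))" by blast
  obtain y where y: "y \<in> rs (\<lambda>h. - \<alpha> (\<tau> 0 h))" "y \<in> part G p" "\<kappa> w y = 1"
    using kappa_pairing[OF w(3,2,1)] .
  have t: "brkt G w y \<in> H0" "\<And>h. h \<in> H0 \<Longrightarrow> \<kappa> (brkt G w y) h = \<alpha> (\<tau> 0 h)"
    using brkt_opposite[OF w(3) y(1)] y(3) by auto
  have "affine_root G H0 \<kappa> L \<tau> ds c1 c2 d1 d2 r \<epsilon> \<alpha> k (brkt G w y)"
    using dual_form_eq[OF \<alpha>(1) kz(5,6) t] real t kz \<alpha>
    by (intro affine_root.intro affine_lie_axioms affine_root_axioms.intro) auto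
  then show ?thesis by (rule that)
qed

end


section \<open>Real roots acting on simple modules\<close>

locale affine_root_module = affine_root + W: weight_module L M for M +
  assumes simple: "simple_module L M"
begin

text \<open>One even vector settles the parity: by \<open>root_space_one_dim\<close> the whole root
  space is then the line that it spans.\<close>

abbreviation even_root :: bool where
  "even_root \<equiv> \<exists>E. E \<in> rs (\<lambda>h. \<alpha> (\<tau> 0 h)) \<and> E \<in> part G False \<and> E \<noteq> 0"

lemma shift_module: "affine_root_module G H0 \<kappa> L \<tau> ds c1 c2 d1 d2 r \<epsilon> (shift L \<alpha> j) (k + j) t M"
  by (intro affine_root_module.intro shift W.weight_module_axioms affine_root_module_axioms.intro simple)

lemma rs_shift: "rs (\<lambda>h. shift L \<alpha> j (\<tau> 0 h)) = rs (\<lambda>h. \<alpha> (\<tau> 0 h))"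
  by (rule root_space_cong) (simp add: shift_def delta_values)

context
  fixes E assumes E: "E \<in> rs (\<lambda>h. \<alpha> (\<tau> 0 h))" "E \<in> part G False" "E \<noteq> 0"
begin

lemma d1_zero: "\<alpha> d1 = 0"
proof -
  obtain x where x: "x \<in> rts \<alpha>" "x \<noteq> 0" using ex_root_vector .
  from rtsE[OF this] obtain z where
    z: "z \<noteq> 0" "z \<in> rs (\<lambda>h. \<alpha> (\<tau> 0 h))" "smul G (\<alpha> d1) z = smul G 2 (ds z)" .
  obtain a where "z = smul G a E" using root_space_one_dim[OF E z(2)] by blast
  then have "ds z = 0" using ds_even vs.subspace_scale[OF subspace_part E(2)] by blast
  then show ?thesis using z by simp
qed

lemma tau_E: "\<tau> k E \<in> rts \<alpha>" "\<tau> k E \<in> part L False" "\<tau> k E \<noteq> 0"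
  using tau_rts[OF \<alpha> E(1)] tau_part[OF E(2)] tau_eq_0 E(3) by (auto simp: d1_zero ds_even[OF E(2)])

lemma rts_multiple:
  assumes "x \<in> rts \<alpha>" "x \<noteq> 0"
  obtains a where "x = smul L a (\<tau> k E)" "a \<noteq> 0"
proof -
  from rtsE[OF assms] obtain z where z: "x = \<tau> k z" "z \<in> rs (\<lambda>h. \<alpha> (\<tau> 0 h))" .
  obtain a where "z = smul G a E" using root_space_one_dim[OF E z(2)] by blast
  then have "x = smul L a (\<tau> k E)" using z(1) by (simp add: tau_smul)
  then show ?thesis using that assms(2) by auto
qed

lemma dichotomy_E: "inj (act M (\<tau> k E)) \<longleftrightarrow> \<not> (\<forall>v. \<exists>n. (act M (\<tau> k E) ^^ n) v = 0)"
proof -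
  obtain v :: 'e where "v \<noteq> 0" using simple by (auto simp: simple_module_def)
  then show ?thesis
    using W.dichotomy[OF simple tau_E(2)] tau_ad_nilpotent[OF E(1,2) t(1,3)] W.not_inj_and_nilpotent
    by metis
qed

lemma funpow_act_smul: "(act M (smul L a x) ^^ n) v = smul M (a ^ n) ((act M x ^^ n) v)"
  by (induction n) (simp_all add: W.act_smul_left W.act_smul mult.commute)

lemma even_R:
  assumes "x \<in> rts \<alpha>" "x \<noteq> 0"
  shows "\<alpha> \<in> R_in L M \<longleftrightarrow> inj (act M x)" and "\<alpha> \<in> R_ln L M \<longleftrightarrow> (\<forall>v. \<exists>n. (act M x ^^ n) v = 0)"
proof -
  have multiple: "(inj (act M y) \<longleftrightarrow> inj (act M (\<tau> k E))) \<and>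
    ((\<forall>v. \<exists>n. (act M y ^^ n) v = 0) \<longleftrightarrow> (\<forall>v. \<exists>n. (act M (\<tau> k E) ^^ n) v = 0))"
    if y: "y \<in> rts \<alpha>" "y \<noteq> 0" for y
  proof -
    obtain a where a: "y = smul L a (\<tau> k E)" "a \<noteq> 0" using rts_multiple[OF y] .
    then show ?thesis by (simp add: W.inj_act_iff W.act_smul_left funpow_act_smul)
  qed
  show "\<alpha> \<in> R_in L M \<longleftrightarrow> inj (act M x)" "\<alpha> \<in> R_ln L M \<longleftrightarrow> (\<forall>v. \<exists>n. (act M x ^^ n) v = 0)"
    unfolding R_in_def R_ln_def using real assms multiple by blast+
qed

lemma even_complement: "\<alpha> \<in> R_ln L M \<longleftrightarrow> \<alpha> \<notin> R_in L M"
  using even_R[OF tau_E(1,3)] dichotomy_E by blast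

lemma negative:
  assumes F: "F \<in> rs (\<lambda>h. - \<alpha> (\<tau> 0 h))" "F \<in> part G False" "F \<noteq> 0"
  shows "affine_root_module G H0 \<kappa> L \<tau> ds c1 c2 d1 d2 r \<epsilon> (- \<alpha>) (- k) (- t) M"
proof (intro affine_root_module.intro affine_root.intro affine_lie_axioms affine_root_axioms.intro
    W.weight_module_axioms affine_root_module_axioms.intro simple)
  show D: "- \<alpha> \<in> D" by (rule dual_space_uminus[OF \<alpha>(1)])
  have "\<tau> (- k) F \<in> rts (- \<alpha>)"
    using F(1) \<alpha> by (intro tau_rts D) (simp_all add: d1_zero ds_even[OF F(2)])
  then show "rts (- \<alpha>) \<noteq> {0}" using tau_eq_0 F(3) by blast
  show "- t \<in> H0" using t(1) by (rule vs.subspace_neg[OF subspace_H0])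
  have "\<alpha> (\<tau> 0 (- t)) = - \<alpha> (\<tau> 0 t)" using dual_tau0[OF \<alpha>(1) t(1), of "- 1"] by simp
  then show "(- \<alpha>) (\<tau> 0 (- t)) \<noteq> 0" using t(3) by simp
qed (use \<alpha> t kappa_minus in auto)

lemma opposite:
  obtains F where "F \<in> rs (\<lambda>h. - \<alpha> (\<tau> 0 h))" "F \<in> part G False" "F \<noteq> 0"
    "brkt G E F \<in> H0" "\<alpha> (\<tau> 0 (brkt G E F)) = 2"
  using sl2_triple[OF E] by (metis kappa_zero(1))

lemma brkt_loop:
  assumes "brkt G E F \<in> H0" "p + q = 0"
  shows "brkt L (\<tau> p E) (\<tau> q F) \<in> cartan L"
    and "\<alpha> (brkt L (\<tau> p E) (\<tau> q F)) = \<alpha> (\<tau> 0 (brkt G E F))"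
    and "delta L (brkt L (\<tau> p E) (\<tau> q F)) = 0"
proof -
  have eq: "brkt L (\<tau> p E) (\<tau> q F) = \<tau> 0 (brkt G E F)
      + smul L 0 c1 + smul L (of_int p * \<kappa> E F) c2 + smul L 0 d1 + smul L 0 d2"
    using assms(2) by (simp add: brkt_tau ds_even[OF E(2)])
  show "brkt L (\<tau> p E) (\<tau> q F) \<in> cartan L" unfolding eq by (rule cartanI[OF assms(1)])
  show "\<alpha> (brkt L (\<tau> p E) (\<tau> q F)) = \<alpha> (\<tau> 0 (brkt G E F))"
    unfolding eq dual_cartan[OF \<alpha>(1) assms(1)] using \<alpha> by simp
  show "delta L (brkt L (\<tau> p E) (\<tau> q F)) = 0" unfolding eq by (rule delta[OF assms(1)])
qed

end

lemma even_string:
  assumes even_root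
  shows "string_type {j. shift L \<alpha> j \<in> R_in L M} {j. shift L (- \<alpha>) j \<in> R_in L M}"
proof -
  obtain E where E: "E \<in> rs (\<lambda>h. \<alpha> (\<tau> 0 h))" "E \<in> part G False" "E \<noteq> 0" using assms by blast
  obtain F where F: "F \<in> rs (\<lambda>h. - \<alpha> (\<tau> 0 h))" "F \<in> part G False" "F \<noteq> 0"
    and EF: "brkt G E F \<in> H0" "\<alpha> (\<tau> 0 (brkt G E F)) = 2" using opposite[OF E] .
  interpret N: affine_root_module G H0 \<kappa> L \<tau> ds c1 c2 d1 d2 r \<epsilon> "- \<alpha>" "- k" "- t" M
    by (rule negative[OF E F])
  have F': "F \<in> rs (\<lambda>h. (- \<alpha>) (\<tau> 0 h))" using F(1) by simp
  \<comment> \<open>\<alpha> has degree \<open>k\<close> and - \<alpha> has degree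
    \<open>- k\<close>, so the powers of \<open>e j\<close> and \<open>f (- j)\<close> cancel, as a
    coroot requires.\<close>
  define e f where "e = (\<lambda>j. \<tau> (k + j) E)" and "f = (\<lambda>j. \<tau> (- k + j) F)"
  have e: "e j \<in> rts (shift L \<alpha> j)" "e j \<in> part L False" "e j \<noteq> 0"
      "shift L \<alpha> j \<in> R_in L M \<longleftrightarrow> inj (act M (e j))" for j
  proof -
    interpret S: affine_root_module G H0 \<kappa> L \<tau> ds c1 c2 d1 d2 r \<epsilon> "shift L \<alpha> j" "k + j" t M
      by (rule shift_module)
    have E': "E \<in> rs (\<lambda>h. shift L \<alpha> j (\<tau> 0 h))" using E(1) by (simp only: rs_shift)
    show *: "e j \<in> rts (shift L \<alpha> j)" "e j \<in> part L False" "e j \<noteq> 0"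
      unfolding e_def by (rule S.tau_E[OF E' E(2,3)])+
    show "shift L \<alpha> j \<in> R_in L M \<longleftrightarrow> inj (act M (e j))" by (rule S.even_R(1)[OF E' E(2,3) *(1,3)])
  qed
  have f: "f j \<in> rts (shift L (- \<alpha>) j)" "f j \<in> part L False" "f j \<noteq> 0"
      "shift L (- \<alpha>) j \<in> R_in L M \<longleftrightarrow> inj (act M (f j))" for j
  proof -
    interpret S: affine_root_module G H0 \<kappa> L \<tau> ds c1 c2 d1 d2 r \<epsilon> "shift L (- \<alpha>) j" "- k + j" "- t" M
      by (rule N.shift_module)
    have E': "F \<in> rs (\<lambda>h. shift L (- \<alpha>) j (\<tau> 0 h))" using F' by (simp only: N.rs_shift)
    show *: "f j \<in> rts (shift L (- \<alpha>) j)" "f j \<in> part L False" "f j \<noteq> 0"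
      unfolding f_def by (rule S.tau_E[OF E' F(2,3)])+
    show "shift L (- \<alpha>) j \<in> R_in L M \<longleftrightarrow> inj (act M (f j))" by (rule S.even_R(1)[OF E' F(2,3) *(1,3)])
  qed
  have h: "brkt L (e j) (f (- j)) \<in> cartan L" "\<alpha> (brkt L (e j) (f (- j))) = 2"
      "delta L (brkt L (e j) (f (- j))) = 0" for j
    unfolding e_def f_def
    by (rule brkt_loop[OF E EF(1)], simp, subst brkt_loop[OF E EF(1)], simp, rule EF(2),
        rule brkt_loop[OF E EF(1)], simp)
  interpret S: sl2_loop_module L M \<alpha> e f
  proof (intro sl2_loop_module.intro W.weight_module_axioms sl2_loop_module_axioms.intro)
    show "\<exists>n. (brkt L (e j) ^^ n) x = 0" for j x
      unfolding e_def by (rule tau_ad_nilpotent[OF E(1,2) t(1,3)])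
    show "\<exists>n. (brkt L (f j) ^^ n) x = 0" for j x
      unfolding f_def using tau_ad_nilpotent[OF F(1,2) t(1)] t(3) by simp
  qed (fact simple \<alpha>(1) delta_dual e(1,2) f(1,2) h)+
  show ?thesis using S.string_type by (simp add: e(4) f(4))
qed

text \<open>For an odd root everything is read off the even root \<open>2\<alpha>\<close>, since \<open>[x, x]\<close> acts as \<open>2 x\<^sup>2\<close>.\<close>

context
  assumes odd: "\<not> even_root"
begin

lemma odd_square:
  assumes "x \<in> rts \<alpha>" "x \<noteq> 0"
  shows "x \<in> part L True" and "brkt L x x \<noteq> 0" and "brkt L x x \<in> rts (\<lambda>h. 2 * \<alpha> h)"
    and "\<exists>E. E \<in> rs (\<lambda>h. 2 * \<alpha> (\<tau> 0 h)) \<and> E \<in> part G False \<and> E \<noteq> 0"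
proof -
  from rtsE[OF assms] obtain z where z: "x = \<tau> k z" "z \<noteq> 0" "z \<in> rs (\<lambda>h. \<alpha> (\<tau> 0 h))" .
  obtain z0 z1 where zd: "z0 \<in> part G False" "z1 \<in> part G True" "z = z0 + z1"
    using super_space_decomp[OF super_space] .
  have "z0 = 0" using odd root_space_parts(1)[of z0 z1] z(3) zd by blast
  then have z_odd: "z \<in> part G True" using zd by simp
  then show "x \<in> part L True" using z(1) tau_part by blast
  have zz: "brkt G z z \<noteq> 0" by (rule odd_square_nonzero[OF z(3) z_odd z(2)])
  have "brkt G z z \<in> rs (\<lambda>h. 2 * \<alpha> (\<tau> 0 h))" using root_space_brkt[OF z(3,3)] by (simp only: mult_2)
  then show "\<exists>E. E \<in> rs (\<lambda>h. 2 * \<alpha> (\<tau> 0 h)) \<and> E \<in> part G False \<and> E \<noteq> 0"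
    using zz brkt_part[OF z_odd z_odd] by auto
  show "brkt L x x \<in> rts (\<lambda>h. 2 * \<alpha> h)" using L.root_space_brkt[OF assms(1,1)] by (simp only: mult_2)
  \<comment> \<open>For k = 0 the bracket has central terms; they cannot cancel the nonzero loop
    component.\<close>
  define a b where "a = (if k + k = 0 then \<kappa> (ds z) z * r else 0)"
    and "b = (if k + k = 0 then of_int k * \<kappa> z z else 0)"
  have "brkt L x x = (\<Sum>p\<in>{k + k}. \<tau> p (brkt G z z)) + smul L a c1 + smul L b c2 + smul L 0 d1 + smul L 0 d2"
    by (simp add: z(1) brkt_tau a_def b_def)
  then show "brkt L x x \<noteq> 0" using indep[of "{k + k}" "\<lambda>_. brkt G z z" a b 0 0] zz by auto
qed

lemma double: "affine_root_module G H0 \<kappa> L \<tau> ds c1 c2 d1 d2 r \<epsilon> (\<lambda>h. 2 * \<alpha> h) (2 * k) (smul G 2 t) M"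
proof (intro affine_root_module.intro affine_root.intro affine_lie_axioms affine_root_axioms.intro
    W.weight_module_axioms affine_root_module_axioms.intro simple)
  show "(\<lambda>h. 2 * \<alpha> h) \<in> D" by (rule dual_space_scale[OF \<alpha>(1)])
  obtain x where x: "x \<in> rts \<alpha>" "x \<noteq> 0" using ex_root_vector .
  then show "rts (\<lambda>h. 2 * \<alpha> h) \<noteq> {0}" using odd_square by blast
  show "smul G 2 t \<in> H0" by (rule vs.subspace_scale[OF subspace_H0 t(1)])
qed (use \<alpha> t dual_tau0[OF \<alpha>(1) t(1)] in \<open>auto simp: kappa_smul\<close>)

lemma odd_R:
  "\<alpha> \<in> R_in L M \<longleftrightarrow> (\<lambda>h. 2 * \<alpha> h) \<in> R_in L M" "\<alpha> \<in> R_ln L M \<longleftrightarrow> (\<lambda>h. 2 * \<alpha> h) \<in> R_ln L M"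
proof -
  interpret T: affine_root_module G H0 \<kappa> L \<tau> ds c1 c2 d1 d2 r \<epsilon> "\<lambda>h. 2 * \<alpha> h" "2 * k" "smul G 2 t" M
    by (rule double)
  obtain x0 where x0: "x0 \<in> rts \<alpha>" "x0 \<noteq> 0" using ex_root_vector .
  obtain E where E: "E \<in> rs (\<lambda>h. 2 * \<alpha> (\<tau> 0 h))" "E \<in> part G False" "E \<noteq> 0"
    using odd_square(4)[OF x0] by blast
  have "(\<lambda>h. 2 * \<alpha> h) \<in> R_in L M \<longleftrightarrow> inj (act M x)"
    "(\<lambda>h. 2 * \<alpha> h) \<in> R_ln L M \<longleftrightarrow> (\<forall>v. \<exists>n. (act M x ^^ n) v = 0)" if x: "x \<in> rts \<alpha>" "x \<noteq> 0" for x
    using T.even_R[OF E odd_square(3,2)[OF x]] W.inj_act_odd_sq[OF odd_square(1)[OF x]]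
      W.nilpotent_act_odd_sq[OF odd_square(1)[OF x]] by auto
  moreover have "\<alpha> \<in> R_in L M \<longleftrightarrow> (\<forall>x\<in>rts \<alpha>. x \<noteq> 0 \<longrightarrow> inj (act M x))"
    "\<alpha> \<in> R_ln L M \<longleftrightarrow> (\<forall>x\<in>rts \<alpha>. x \<noteq> 0 \<longrightarrow> (\<forall>v. \<exists>n. (act M x ^^ n) v = 0))"
    using real by (simp_all add: R_in_def R_ln_def)
  ultimately show "\<alpha> \<in> R_in L M \<longleftrightarrow> (\<lambda>h. 2 * \<alpha> h) \<in> R_in L M"
    "\<alpha> \<in> R_ln L M \<longleftrightarrow> (\<lambda>h. 2 * \<alpha> h) \<in> R_ln L M"
    using x0 by blast+
qed

lemma odd_complement: "\<alpha> \<in> R_ln L M \<longleftrightarrow> \<alpha> \<notin> R_in L M"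
proof -
  interpret T: affine_root_module G H0 \<kappa> L \<tau> ds c1 c2 d1 d2 r \<epsilon> "\<lambda>h. 2 * \<alpha> h" "2 * k" "smul G 2 t" M
    by (rule double)
  obtain x0 where x0: "x0 \<in> rts \<alpha>" "x0 \<noteq> 0" using ex_root_vector .
  obtain E where E: "E \<in> rs (\<lambda>h. 2 * \<alpha> (\<tau> 0 h))" "E \<in> part G False" "E \<noteq> 0"
    using odd_square(4)[OF x0] by blast
  show ?thesis using odd_R T.even_complement[OF E] by blast
qed

lemma odd_negative: "affine_root_module G H0 \<kappa> L \<tau> ds c1 c2 d1 d2 r \<epsilon> (- \<alpha>) (- k) (- t) M"
proof (intro affine_root_module.intro affine_root.intro affine_lie_axioms affine_root_axioms.intro
    W.weight_module_axioms affine_root_module_axioms.intro simple)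
  interpret T: affine_root_module G H0 \<kappa> L \<tau> ds c1 c2 d1 d2 r \<epsilon> "\<lambda>h. 2 * \<alpha> h" "2 * k" "smul G 2 t" M
    by (rule double)
  obtain x where x: "x \<in> rts \<alpha>" "x \<noteq> 0" using ex_root_vector .
  obtain E where E: "E \<in> rs (\<lambda>h. 2 * \<alpha> (\<tau> 0 h))" "E \<in> part G False" "E \<noteq> 0"
    using odd_square(4)[OF x] by blast
  obtain F where F: "F \<in> rs (\<lambda>h. - (2 * \<alpha> (\<tau> 0 h)))" "F \<in> part G False" "F \<noteq> 0"
    and EF: "brkt G E F \<in> H0" "2 * \<alpha> (\<tau> 0 (brkt G E F)) = 2" using T.opposite[OF E] .
  interpret N: affine_root_module G H0 \<kappa> L \<tau> ds c1 c2 d1 d2 r \<epsilon> "- (\<lambda>h. 2 * \<alpha> h)" "- (2 * k)" "- smul G 2 t" M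
    by (rule T.negative[OF E F])
  have F': "F \<in> rs (\<lambda>h. (- (\<lambda>h. 2 * \<alpha> h)) (\<tau> 0 h))" using F(1) by simp
  define e f where "e = \<tau> (2 * k) E" and "f = \<tau> (- (2 * k)) F"
  have e: "e \<in> part L False" unfolding e_def by (rule T.tau_E(2)[OF E])
  have f: "f \<in> rts (- (\<lambda>h. 2 * \<alpha> h))" unfolding f_def by (rule N.tau_E(1)[OF F' F(2,3)])
  have ef: "brkt L e f \<in> cartan L" "2 * \<alpha> (brkt L e f) = 2"
    using T.brkt_loop[OF E EF(1), of "2 * k" "- (2 * k)"] EF(2) by (simp_all add: e_def f_def)
  from T.rts_multiple[OF E odd_square(3,2)[OF x]] obtain a where
    a: "brkt L x x = smul L a e" "a \<noteq> 0" unfolding e_def .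
  have "brkt L e x = 0" using L.brkt_odd_sq[OF odd_square(1)[OF x]] a by (simp add: L.brkt_smul_left)
  then have "brkt L e (brkt L f x) = x"
    using L.jacobi_even[OF e, of f x] L.root_spaceD[OF x(1) ef(1)] ef(2) by simp
  then have "brkt L f x \<noteq> 0" using x(2) by auto
  moreover have "brkt L f x \<in> rts (- \<alpha>)"
  proof -
    have "(\<lambda>h. (- (\<lambda>h. 2 * \<alpha> h)) h + \<alpha> h) = - \<alpha>" by (rule ext) simp
    then show ?thesis using L.root_space_brkt[OF f x(1)] by simp
  qed
  ultimately show "rts (- \<alpha>) \<noteq> {0}" by blast
  show "- \<alpha> \<in> D" by (rule dual_space_uminus[OF \<alpha>(1)])
  show "- t \<in> H0" using t(1) by (rule vs.subspace_neg[OF subspace_H0])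
  have "\<alpha> (\<tau> 0 (- t)) = - \<alpha> (\<tau> 0 t)" using dual_tau0[OF \<alpha>(1) t(1), of "- 1"] by simp
  then show "(- \<alpha>) (\<tau> 0 (- t)) \<noteq> 0" using t(3) by simp
qed (use \<alpha> t kappa_minus in auto)

end

section \<open>Real roots of either parity\<close>

lemma complement: "\<alpha> \<in> R_ln L M \<longleftrightarrow> \<alpha> \<notin> R_in L M"
  using even_complement odd_complement by blast

lemma shift_complement: "shift L \<alpha> j \<in> R_ln L M \<longleftrightarrow> shift L \<alpha> j \<notin> R_in L M"
  by (rule affine_root_module.complement[OF shift_module])

lemma neg_module: "affine_root_module G H0 \<kappa> L \<tau> ds c1 c2 d1 d2 r \<epsilon> (- \<alpha>) (- k) (- t) M"
proof (cases even_root)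
  case True
  then obtain E where E: "E \<in> rs (\<lambda>h. \<alpha> (\<tau> 0 h))" "E \<in> part G False" "E \<noteq> 0" by blast
  from opposite[OF E] obtain F where "F \<in> rs (\<lambda>h. - \<alpha> (\<tau> 0 h))" "F \<in> part G False" "F \<noteq> 0" .
  then show ?thesis by (rule negative[OF E])
qed (rule odd_negative)

lemma odd_shift:
  assumes "\<not> even_root"
  shows "shift L \<alpha> j \<in> R_in L M \<longleftrightarrow> shift L (\<lambda>h. 2 * \<alpha> h) (2 * j) \<in> R_in L M"
proof -
  interpret S: affine_root_module G H0 \<kappa> L \<tau> ds c1 c2 d1 d2 r \<epsilon> "shift L \<alpha> j" "k + j" t M
    by (rule shift_module)
  have "(\<lambda>h. 2 * shift L \<alpha> j h) = shift L (\<lambda>h. 2 * \<alpha> h) (2 * j)"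
    by (rule ext) (simp add: shift_def algebra_simps)
  moreover have "\<not> S.even_root" using assms unfolding rs_shift .
  ultimately show ?thesis using S.odd_R(1) by simp
qed

theorem root_string_type:
  "string_type {j. shift L \<alpha> j \<in> R_in L M} {j. shift L (- \<alpha>) j \<in> R_in L M}"
proof (cases even_root)
  case True then show ?thesis by (rule even_string)
next
  case False
  interpret N: affine_root_module G H0 \<kappa> L \<tau> ds c1 c2 d1 d2 r \<epsilon> "- \<alpha>" "- k" "- t" M
    by (rule neg_module)
  interpret T: affine_root_module G H0 \<kappa> L \<tau> ds c1 c2 d1 d2 r \<epsilon> "\<lambda>h. 2 * \<alpha> h" "2 * k" "smul G 2 t" M
    by (rule double[OF False])
  have "\<not> N.even_root"
  proof
    assume N.even_root
    then obtain E where E: "E \<in> rs (\<lambda>h. (- \<alpha>) (\<tau> 0 h))" "E \<in> part G False" "E \<noteq> 0" by blast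
    from N.opposite[OF E] obtain F where
      "F \<in> rs (\<lambda>h. - (- \<alpha>) (\<tau> 0 h))" "F \<in> part G False" "F \<noteq> 0" .
    then show False using False by auto
  qed
  moreover have "(\<lambda>h. 2 * (- \<alpha>) h) = - (\<lambda>h. 2 * \<alpha> h)" by (rule ext) simp
  ultimately have neg: "shift L (- \<alpha>) j \<in> R_in L M \<longleftrightarrow> shift L (- (\<lambda>h. 2 * \<alpha> h)) (2 * j) \<in> R_in L M" for j
    using N.odd_shift[of j] by simp
  obtain x where "x \<in> rts \<alpha>" "x \<noteq> 0" using ex_root_vector .
  then have "T.even_root" using odd_square(4)[OF False] by blast
  from string_type_vimage_double[OF T.even_string[OF this]]
  show ?thesis by (simp add: odd_shift[OF False] neg)
qed

end


section \<open>The two constructions\<close>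

text \<open>Links the finite sums over arbitrary index sets in \<open>affine_lie\<close> with the
  finitely supported functions that parametrize the loop algebra.\<close>

lemma ex_loop_sum:
  assumes "finite P" "\<And>p. \<tau> p 0 = 0"
  obtains f where "\<forall>p\<in>P. Poly_Mapping.lookup f p = g p"
    "loop_sum \<tau> f = (\<Sum>p\<in>P. \<tau> p (g p))"
proof -
  define f where "f = Abs_poly_mapping (\<lambda>p. if p \<in> P then g p else 0)"
  have "{p. (if p \<in> P then g p else 0) \<noteq> 0} \<subseteq> P" by auto
  then have f: "Poly_Mapping.lookup f = (\<lambda>p. if p \<in> P then g p else 0)"
    unfolding f_def by (intro lookup_Abs_poly_mapping finite_subset[OF _ assms(1)])
  have "Poly_Mapping.keys f \<subseteq> P" by (auto simp: in_keys_iff f split: if_splits)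
  then have "loop_sum \<tau> f = (\<Sum>p\<in>P. \<tau> p (Poly_Mapping.lookup f p))"
    unfolding loop_sum_def using assms by (intro sum.mono_neutral_left) (auto simp: in_keys_iff)
  also have "\<dots> = (\<Sum>p\<in>P. \<tau> p (g p))" by (intro sum.cong) (auto simp: f)
  finally show ?thesis by (intro that[of f]) (simp_all add: f)
qed

lemma loop_sum_zero: "loop_sum \<tau> 0 = 0"
  by (simp add: loop_sum_def)

text \<open>An even element is only known to be the image of some matrix \<open>X\<close>. The image
  of the off-diagonal blocks of \<open>X\<close> is both odd and even, hence zero, and
  \<open>block_sign\<close> annihilates the diagonal blocks.\<close>

lemma ds_even_zero:
  assumes G: "lie_superalgebra G" and pres: "psl_presentation G n \<pi>"
    and ds: "\<And>X. X \<in> sl_super n \<Longrightarrow> ds (\<pi> X) = \<pi> (block_sign n X)"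
    and x: "x \<in> part G False"
  shows "ds x = 0"
proof -
  interpret lie_superalg G by unfold_locales (rule G)
  let ?N = "2 * Suc n"
  have \<pi>: "\<And>X Y. X \<in> sl_super n \<Longrightarrow> Y \<in> sl_super n \<Longrightarrow> \<pi> (X + Y) = \<pi> X + \<pi> Y"
    "\<And>p. \<pi> ` sl_super_part n p \<subseteq> part G p" "\<pi> ` sl_super n = UNIV"
    "{X \<in> sl_super n. \<pi> X = 0} = {a \<cdot>\<^sub>m 1\<^sub>m ?N | a. True}"
    using pres unfolding psl_presentation_def by simp_all
  obtain X where X: "X \<in> sl_super n" "x = \<pi> X" using \<pi>(3) by (metis UNIV_I imageE)
  have carr: "X \<in> carrier_mat ?N ?N" using X(1) by (simp add: sl_super_def)
  define Y where "Y p = mat ?N ?N (\<lambda>(i, j). if ((i < Suc n) \<noteq> (j < Suc n)) = p then X $$ (i, j) else 0)" for p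
  have Y_carr: "Y p \<in> carrier_mat ?N ?N" for p by (simp add: Y_def)
  have diag: "(\<Sum>i<Suc n. Y p $$ (i, i)) = (if p then 0 else \<Sum>i<Suc n. X $$ (i, i))"
    "(\<Sum>i\<in>{Suc n..<?N}. Y p $$ (i, i)) = (if p then 0 else \<Sum>i\<in>{Suc n..<?N}. X $$ (i, i))" for p
    by (auto simp: Y_def intro!: sum.cong sum.neutral)
  have Y_sl: "Y p \<in> sl_super n" for p
    using Y_carr[of p] X(1) unfolding sl_super_def mem_Collect_eq diag
    by (cases p) (simp_all only: if_True if_False simp_thms)
  have Y_part: "Y p \<in> sl_super_part n p" for p
    using Y_sl[of p] by (auto simp: sl_super_part_def Y_def)
  have "X = Y False + Y True" using carr by (intro eq_matI) (auto simp: Y_def)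
  then have x_eq: "x = \<pi> (Y False) + \<pi> (Y True)"
    using X(2) \<pi>(1)[OF Y_sl Y_sl] by simp
  have parts: "\<pi> (Y p) \<in> part G p" for p using \<pi>(2) Y_part by blast
  have "\<pi> (Y True) = x - \<pi> (Y False)" using x_eq by simp
  then have "\<pi> (Y True) \<in> part G False" using vs.subspace_diff[OF subspace_part x parts] by simp
  then have "x = \<pi> (Y False)" using even_odd_zero[OF _ parts] x_eq by simp
  then have "ds x = \<pi> (block_sign n (Y False))" using ds Y_sl by simp
  \<comment> \<open>The zero matrix is written as a scalar matrix because the kernel of
    \<open>\<pi>\<close> is given in this form.\<close>
  also have "block_sign n (Y False) = 0 \<cdot>\<^sub>m 1\<^sub>m ?N"
    by (intro eq_matI) (auto simp: block_sign_def Y_def)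
  also have "\<pi> (0 \<cdot>\<^sub>m 1\<^sub>m ?N) = 0" using \<pi>(4) by blast
  finally show ?thesis .
qed

lemma affine_lie_affinization:
  assumes G: "basic_lie G H0 \<kappa>" and L: "affinization G H0 \<kappa> \<tau> c d L"
  shows "affine_lie G H0 \<kappa> L \<tau> (\<lambda>_. 0) 0 c 0 d 0 0"
proof -
  interpret basic_lie G H0 \<kappa> by (rule G)
  interpret L: lie_superalg L using L by unfold_locales (simp add: affinization_def)
  have lin: "Vector_Spaces.linear (smul G) (smul L) (\<tau> p)" for p using L by (simp add: affinization_def)
  have tau0: "\<tau> p 0 = 0" for p using linear_scale[OF lin, of p 0 0] by simp
  have bij: "bij (\<lambda>(f, a, b). loop_sum \<tau> f + smul L a c + smul L b d)" using L by (simp add: affinization_def)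
  show ?thesis
  proof (intro affine_lie.intro G L.lie_superalg_axioms affine_lie_axioms.intro)
    fix v
    obtain f a b where "v = loop_sum \<tau> f + smul L a c + smul L b d"
      using bij_is_surj[OF bij] by (metis (mono_tags, lifting) case_prod_conv surj_def surj_pair)
    then show "\<exists>P g a1 a2 b1 b2. finite P \<and> v = (\<Sum>p\<in>P. \<tau> p (g p))
        + smul L a1 0 + smul L a2 c + smul L b1 0 + smul L b2 d"
      unfolding loop_sum_def
      by (intro exI[of _ "Poly_Mapping.keys f"] exI[of _ "Poly_Mapping.lookup f"] exI[of _ a] exI[of _ b]) simp
  next
    fix P g a1 a2 b1 b2
    assume P: "finite (P :: int set)" and 0: "(\<Sum>p\<in>P. \<tau> p (g p))
        + smul L a1 0 + smul L a2 c + smul L b1 0 + smul L b2 d = 0"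
    obtain f where f: "\<forall>p\<in>P. Poly_Mapping.lookup f p = g p"
      "loop_sum \<tau> f = (\<Sum>p\<in>P. \<tau> p (g p))" using ex_loop_sum[where \<tau> = \<tau> and g = g, OF P tau0] .
    have "(\<lambda>(f, a, b). loop_sum \<tau> f + smul L a c + smul L b d) (f, a2, b2)
        = (\<lambda>(f, a, b). loop_sum \<tau> f + smul L a c + smul L b d) (0, 0, 0)"
      using 0 f(2) by (simp add: loop_sum_zero)
    then have "f = 0" "a2 = 0" "b2 = 0" using injD[OF bij_is_inj[OF bij]] by blast+
    then show "(\<forall>p\<in>P. g p = 0) \<and> a2 = 0 \<and> b2 = 0 \<and> 0 * a1 = 0 \<and> 0 * b1 = 0"
      using f(1) by force
  next
    show "\<tau> p x \<in> part L s" if "x \<in> part G s" for x s p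
      using L that by (simp add: affinization_def image_subset_iff)
    show "delta L \<in> dual_space L (cartan L)" using L unfolding affinization_def by (elim conjE)
    show "cartan L = {\<tau> 0 h + smul L a1 0 + smul L a2 c + smul L b1 0 + smul L b2 d | h a1 a2 b1 b2. h \<in> H0}"
      using L by (auto simp: affinization_def)
  qed (use L L.vs.subspace_0[OF L.subspace_part] tau0 in \<open>auto simp: affinization_def\<close>)
qed

lemma affine_lie_affinization_Ann:
  assumes G: "basic_lie G H0 \<kappa>" and pres: "psl_presentation G n \<pi>"
    and ds: "\<And>X. X \<in> sl_super n \<Longrightarrow> ds (\<pi> X) = \<pi> (block_sign n X)"
    and L: "affinization_Ann n G H0 \<kappa> ds \<tau> c1 c2 d1 d2 L"
  shows "affine_lie G H0 \<kappa> L \<tau> ds c1 c2 d1 d2 (1 / of_nat (n + 1)) 1"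
proof -
  interpret basic_lie G H0 \<kappa> by (rule G)
  interpret L: lie_superalg L using L by unfold_locales (simp add: affinization_Ann_def)
  have lin: "Vector_Spaces.linear (smul G) (smul L) (\<tau> p)" for p using L by (simp add: affinization_Ann_def)
  have tau0: "\<tau> p 0 = 0" for p using linear_scale[OF lin, of p 0 0] by simp
  let ?F = "\<lambda>(f, a1, a2, b1, b2). loop_sum \<tau> f + smul L a1 c1 + smul L a2 c2 + smul L b1 d1 + smul L b2 d2"
  have bij: "bij ?F" using L by (simp add: affinization_Ann_def)
  show ?thesis
  proof (intro affine_lie.intro G L.lie_superalg_axioms affine_lie_axioms.intro)
    fix v
    obtain y where "v = ?F y" using bij_is_surj[OF bij] by (rule surjE)
    moreover obtain f a1 a2 b1 b2 where "y = (f, a1, a2, b1, b2)" by (cases y)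
    ultimately have "v = loop_sum \<tau> f + smul L a1 c1 + smul L a2 c2 + smul L b1 d1 + smul L b2 d2" by simp
    then show "\<exists>P g a1 a2 b1 b2. finite P \<and> v = (\<Sum>p\<in>P. \<tau> p (g p))
        + smul L a1 c1 + smul L a2 c2 + smul L b1 d1 + smul L b2 d2"
      unfolding loop_sum_def
      by (intro exI[of _ "Poly_Mapping.keys f"] exI[of _ "Poly_Mapping.lookup f"] exI[of _ a1] exI[of _ a2]
          exI[of _ b1] exI[of _ b2]) simp
  next
    fix P g a1 a2 b1 b2
    assume P: "finite (P :: int set)" and 0: "(\<Sum>p\<in>P. \<tau> p (g p))
        + smul L a1 c1 + smul L a2 c2 + smul L b1 d1 + smul L b2 d2 = 0"
    obtain f where f: "\<forall>p\<in>P. Poly_Mapping.lookup f p = g p"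
      "loop_sum \<tau> f = (\<Sum>p\<in>P. \<tau> p (g p))" using ex_loop_sum[where \<tau> = \<tau> and g = g, OF P tau0] .
    have "?F (f, a1, a2, b1, b2) = ?F (0, 0, 0, 0, 0)" using 0 f(2) by (simp add: loop_sum_zero)
    then have "(f, a1, a2, b1, b2) = (0, 0, 0, 0, 0)" by (rule injD[OF bij_is_inj[OF bij]])
    then show "(\<forall>p\<in>P. g p = 0) \<and> a2 = 0 \<and> b2 = 0 \<and> 1 * a1 = 0 \<and> 1 * b1 = 0"
      using f(1) by force
  next
    fix h h' a1 a2 b1 b2 a1' a2' b1' b2' assume "h \<in> H0" "h' \<in> H0"
    then show "cartan_form L
        (\<tau> 0 h + smul L a1 c1 + smul L a2 c2 + smul L b1 d1 + smul L b2 d2)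
        (\<tau> 0 h' + smul L a1' c1 + smul L a2' c2 + smul L b1' d1 + smul L b2' d2)
      = \<kappa> h h' + 1 * (a1 * b1' + b1 * a1') + (a2 * b2' + b2 * a2')"
      using L by (simp add: affinization_Ann_def)
  next
    show "delta L \<in> dual_space L (cartan L)" using L unfolding affinization_Ann_def by (elim conjE)
    show "ds x = 0" if "x \<in> part G False" for x using ds_even_zero[OF lie pres ds that] .
  qed (use L in \<open>simp_all add: affinization_Ann_def image_subset_iff\<close>)
qed

lemma untwisted_affine_affine_lie:
  assumes "untwisted_affine G H0 \<kappa> L"
  obtains \<tau> ds c1 c2 d1 d2 r \<epsilon> where "affine_lie G H0 \<kappa> L \<tau> ds c1 c2 d1 d2 r \<epsilon>"
proof -
  have G: "basic_lie G H0 \<kappa>"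
    using assms by unfold_locales (simp_all add: untwisted_affine_def basic_classical_simple_def)
  show ?thesis
  proof (cases "type_Ann G")
    case False
    then obtain \<tau> c d where "affinization G H0 \<kappa> \<tau> c d L" using assms by (auto simp: untwisted_affine_def)
    from that[OF affine_lie_affinization[OF G this]] show ?thesis .
  next
    case True
    then obtain n \<pi> ds \<tau> c1 c2 d1 d2 where pres: "psl_presentation G n \<pi>"
      and ds: "\<forall>X \<in> sl_super n. ds (\<pi> X) = \<pi> (block_sign n X)"
      and L: "affinization_Ann n G H0 \<kappa> ds \<tau> c1 c2 d1 d2 L"
      using assms unfolding untwisted_affine_def by (simp only: True not_True_eq_False if_False) blast
    from that[OF affine_lie_affinization_Ann[OF G pres _ L]] ds show ?thesis by blast
  qed
qed

text \<open>The hybrid conditions constrain only the far ends of the strings;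
  \<open>string_type\<close> rules out irregular behaviour in between and supplies the exact end
  points.\<close>

lemma string_type_hybrid:
  assumes "string_type A B"
  defines "down \<equiv> \<exists>m>0. (\<forall>i\<ge>m. i \<in> A \<and> i \<in> B) \<and> (\<forall>i\<le>- m. i \<notin> A \<and> i \<notin> B)"
    and "up \<equiv> \<exists>m>0. (\<forall>i\<ge>m. i \<notin> A \<and> i \<notin> B) \<and> (\<forall>i\<le>- m. i \<in> A \<and> i \<in> B)"
  shows "A = {} \<or> A = UNIV \<or> down \<or> up"
    and "down \<longleftrightarrow> (\<exists>m. \<exists>t\<in>{- 1, 0, 1}. (\<forall>i\<ge>1. m + i \<in> A) \<and> (\<forall>i\<le>0. m + i \<notin> A)
      \<and> (\<forall>i\<ge>t. i - m \<in> B) \<and> (\<forall>i\<le>t - 1. i - m \<notin> B))" (is "_ \<longleftrightarrow> ?down")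
    and "up \<longleftrightarrow> (\<exists>m. \<exists>t\<in>{- 1, 0, 1}. (\<forall>i\<le>- 1. m + i \<in> A) \<and> (\<forall>i\<ge>0. m + i \<notin> A)
      \<and> (\<forall>i\<le>- t. i - m \<in> B) \<and> (\<forall>i\<ge>1 - t. i - m \<notin> B))" (is "_ \<longleftrightarrow> ?up")
proof -
  have bound: "\<exists>m>0::int. a \<le> m \<and> - m < a \<and> b \<le> m \<and> - m < b" for a b :: int
    by (intro exI[of _ "\<bar>a\<bar> + \<bar>b\<bar> + 1"]) linarith
  have down_lines: down if "A = {a..}" "B = {b..}" for a b
    unfolding down_def using bound[of a b] by (elim exE, intro exI conjI) (auto simp: that)
  have up_lines: up if "A = {..a}" "B = {..b}" for a b
    \<comment> \<open>\<open>a + 1\<close> and \<open>b + 1\<close> are the first positions outside,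
      matching the role of \<open>a\<close> and \<open>b\<close> for upward half-lines.\<close>
    unfolding up_def using bound[of "a + 1" "b + 1"] by (elim exE, intro exI conjI) (auto simp: that)
  have down_imp: ?down if down: down
  proof -
    obtain m where m: "m > 0" "\<And>i. m \<le> i \<Longrightarrow> i \<in> A \<and> i \<in> B" "\<And>i. i \<le> - m \<Longrightarrow> i \<notin> A \<and> i \<notin> B"
      using down unfolding down_def by blast
    have "A \<noteq> {}" "A \<noteq> UNIV" using m(2)[of m] m(3)[of "- m"] by auto
    moreover have "A \<noteq> {..a}" for a using m(2)[of "max m (a + 1)"] by auto
    ultimately obtain a b where ab: "A = {a..}" "B = {b..}" "0 \<le> a + b" "a + b \<le> 2"
      using assms(1) unfolding string_type_def by blast
    \<comment> \<open>The witnesses are m = a - 1, the last position outside \<open>A\<close>, and t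
      = a + b - 1, the lower end of \<open>B\<close> shifted by m.\<close>
    have "a + b - 1 \<in> {- 1, 0, 1}" using ab(3,4) by auto
    moreover have "(\<forall>i\<ge>1. a - 1 + i \<in> A) \<and> (\<forall>i\<le>0. a - 1 + i \<notin> A)
      \<and> (\<forall>i\<ge>a + b - 1. i - (a - 1) \<in> B) \<and> (\<forall>i\<le>a + b - 1 - 1. i - (a - 1) \<notin> B)"
      by (auto simp: ab)
    ultimately show ?thesis by blast
  qed
  have up_imp: ?up if up: up
  proof -
    obtain m where m: "m > 0" "\<And>i. m \<le> i \<Longrightarrow> i \<notin> A \<and> i \<notin> B" "\<And>i. i \<le> - m \<Longrightarrow> i \<in> A \<and> i \<in> B"
      using up unfolding up_def by blast
    have "A \<noteq> {}" "A \<noteq> UNIV" using m(2)[of m] m(3)[of "- m"] by auto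
    moreover have "A \<noteq> {a..}" for a using m(2)[of "max m a"] by auto
    ultimately obtain a b where ab: "A = {..a}" "B = {..b}" "- 2 \<le> a + b" "a + b \<le> 0"
      using assms(1) unfolding string_type_def by blast
    \<comment> \<open>Here m = a + 1 is the first position outside \<open>A\<close>, and t = - (a +
      b) - 1 makes - t the upper end of \<open>B\<close> shifted by m.\<close>
    have "- (a + b) - 1 \<in> {- 1, 0, 1}" using ab(3,4) by auto
    moreover have "(\<forall>i\<le>- 1. a + 1 + i \<in> A) \<and> (\<forall>i\<ge>0. a + 1 + i \<notin> A)
      \<and> (\<forall>i\<le>- (- (a + b) - 1). i - (a + 1) \<in> B) \<and> (\<forall>i\<ge>1 - (- (a + b) - 1). i - (a + 1) \<notin> B)"
      by (auto simp: ab)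
    ultimately show ?thesis by blast
  qed
  have imp_down: down if lines: ?down
  proof -
    obtain m t where m: "\<And>i. i \<ge> 1 \<Longrightarrow> m + i \<in> A" "\<And>i. i \<le> 0 \<Longrightarrow> m + i \<notin> A"
      "\<And>i. i \<ge> t \<Longrightarrow> i - m \<in> B" "\<And>i. i \<le> t - 1 \<Longrightarrow> i - m \<notin> B" using lines by blast
    have "i \<in> A \<longleftrightarrow> m + 1 \<le> i" "i \<in> B \<longleftrightarrow> t - m \<le> i" for i
      using m(1,2)[of "i - m"] m(3,4)[of "i + m"] by (cases "m + 1 \<le> i"; cases "t - m \<le> i"; simp)+
    then show ?thesis by (intro down_lines[of "m + 1" "t - m"]) auto
  qed
  have imp_up: up if lines: ?up
  proof -
    obtain m t where m: "\<And>i. i \<le> - 1 \<Longrightarrow> m + i \<in> A" "\<And>i. i \<ge> 0 \<Longrightarrow> m + i \<notin> A"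
      "\<And>i. i \<le> - t \<Longrightarrow> i - m \<in> B" "\<And>i. i \<ge> 1 - t \<Longrightarrow> i - m \<notin> B" using lines by blast
    have "i \<in> A \<longleftrightarrow> i \<le> m - 1" "i \<in> B \<longleftrightarrow> i \<le> - t - m" for i
      using m(1,2)[of "i - m"] m(3,4)[of "i + m"] by (cases "i \<le> m - 1"; cases "i \<le> - t - m"; simp)+
    then show ?thesis by (intro up_lines[of "m - 1" "- t - m"]) auto
  qed
  show "A = {} \<or> A = UNIV \<or> down \<or> up"
    using assms(1) down_lines up_lines unfolding string_type_def by blast
  show "down \<longleftrightarrow> ?down" using down_imp imp_down by blast
  show "up \<longleftrightarrow> ?up" using up_imp imp_up by blast
qed

theorem theorem1p1:
  fixes G :: "'g::ab_group_add lie_super"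
    and H0 :: "'g set"
    and \<kappa> :: "'g \<Rightarrow> 'g \<Rightarrow> complex"
    and L :: "'l::ab_group_add affine_super"
    and M :: "('l, 'm::ab_group_add) super_module"
  assumes "untwisted_affine G H0 \<kappa> L"
    and "finite_weight_module L M"
    and "simple_module L M"
  shows "\<forall>\<beta> \<in> real_roots L.
    (full_locally_nilpotent L M \<beta> \<or> full_injective L M \<beta>
      \<or> down_nilpotent_hybrid L M \<beta> \<or> up_nilpotent_hybrid L M \<beta>)
    \<and> (full_locally_nilpotent L M \<beta> \<longleftrightarrow> shift L \<beta> ` UNIV \<subseteq> R_ln L M)
    \<and> (full_injective L M \<beta> \<longleftrightarrow> shift L \<beta> ` UNIV \<subseteq> R_in L M)
    \<and> (down_nilpotent_hybrid L M \<beta> \<longleftrightarrow>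
        (\<exists>m. \<exists>t \<in> {- 1, 0, 1}. let \<gamma> = shift L \<beta> m in
          shift L \<gamma> ` {1..} \<subseteq> R_in L M \<and> shift L \<gamma> ` {..0} \<subseteq> R_ln L M
          \<and> shift L (- \<gamma>) ` {t..} \<subseteq> R_in L M \<and> shift L (- \<gamma>) ` {..t - 1} \<subseteq> R_ln L M))
    \<and> (up_nilpotent_hybrid L M \<beta> \<longleftrightarrow>
        (\<exists>m. \<exists>t \<in> {- 1, 0, 1}. let \<eta> = shift L \<beta> m in
          shift L \<eta> ` {..- 1} \<subseteq> R_in L M \<and> shift L \<eta> ` {0..} \<subseteq> R_ln L M
          \<and> shift L (- \<eta>) ` {..- t} \<subseteq> R_in L M \<and> shift L (- \<eta>) ` {1 - t..} \<subseteq> R_ln L M))"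
proof
  fix \<beta> assume \<beta>: "\<beta> \<in> real_roots L"
  obtain \<tau> ds c1 c2 d1 d2 r \<epsilon> where "affine_lie G H0 \<kappa> L \<tau> ds c1 c2 d1 d2 r \<epsilon>"
    using untwisted_affine_affine_lie[OF assms(1)] .
  then interpret affine_lie G H0 \<kappa> L \<tau> ds c1 c2 d1 d2 r \<epsilon> .
  interpret W: weight_module L M
    using assms(2) by unfold_locales (simp_all add: finite_weight_module_def)
  obtain k t where "affine_root G H0 \<kappa> L \<tau> ds c1 c2 d1 d2 r \<epsilon> \<beta> k t" using real_rootE[OF \<beta>] .
  then interpret affine_root_module G H0 \<kappa> L \<tau> ds c1 c2 d1 d2 r \<epsilon> \<beta> k t M
    by (intro affine_root_module.intro W.weight_module_axioms affine_root_module_axioms.intro assms(3))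
  interpret N: affine_root_module G H0 \<kappa> L \<tau> ds c1 c2 d1 d2 r \<epsilon> "- \<beta>" "- k" "- t" M
    by (rule neg_module)
  define A B where "A = {j. shift L \<beta> j \<in> R_in L M}" and "B = {j. shift L (- \<beta>) j \<in> R_in L M}"
  have st: "string_type A B" unfolding A_def B_def by (rule root_string_type)
  \<comment> \<open>Each root of the string is either injective or locally nilpotent and never both,
    so \<open>A\<close> and \<open>B\<close> describe \<open>R_ln\<close> as well.\<close>
  have A: "shift L \<beta> j \<in> R_in L M \<longleftrightarrow> j \<in> A" "shift L \<beta> j \<in> R_ln L M \<longleftrightarrow> j \<notin> A" for j
    using shift_complement by (simp_all add: A_def)
  have B: "shift L (- \<beta>) j \<in> R_in L M \<longleftrightarrow> j \<in> B" "shift L (- \<beta>) j \<in> R_ln L M \<longleftrightarrow> j \<notin> B" for j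
    using N.shift_complement by (simp_all add: B_def)
  have shift_shift: "shift L (shift L \<beta> m) j = shift L \<beta> (m + j)"
    "shift L (- shift L \<beta> m) j = shift L (- \<beta>) (j - m)" for m j
    by (auto simp: shift_def algebra_simps)
  have full: "full_locally_nilpotent L M \<beta> \<longleftrightarrow> A = {}" "full_injective L M \<beta> \<longleftrightarrow> A = UNIV"
    by (auto simp: full_locally_nilpotent_def full_injective_def image_subset_iff A)
  have down: "down_nilpotent_hybrid L M \<beta> \<longleftrightarrow>
      (\<exists>m>0. (\<forall>i\<ge>m. i \<in> A \<and> i \<in> B) \<and> (\<forall>i\<le>- m. i \<notin> A \<and> i \<notin> B))"
    unfolding down_nilpotent_hybrid_def
    by (intro ex_cong1 conj_cong refl) (auto simp: image_subset_iff A B)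
  have up: "up_nilpotent_hybrid L M \<beta> \<longleftrightarrow>
      (\<exists>m>0. (\<forall>i\<ge>m. i \<notin> A \<and> i \<notin> B) \<and> (\<forall>i\<le>- m. i \<in> A \<and> i \<in> B))"
    unfolding up_nilpotent_hybrid_def
    by (intro ex_cong1 conj_cong refl) (auto simp: image_subset_iff A B)
  note hybrid = string_type_hybrid[OF st, folded down up]
  show "(full_locally_nilpotent L M \<beta> \<or> full_injective L M \<beta>
      \<or> down_nilpotent_hybrid L M \<beta> \<or> up_nilpotent_hybrid L M \<beta>)
    \<and> (full_locally_nilpotent L M \<beta> \<longleftrightarrow> shift L \<beta> ` UNIV \<subseteq> R_ln L M)
    \<and> (full_injective L M \<beta> \<longleftrightarrow> shift L \<beta> ` UNIV \<subseteq> R_in L M)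
    \<and> (down_nilpotent_hybrid L M \<beta> \<longleftrightarrow>
        (\<exists>m. \<exists>t \<in> {- 1, 0, 1}. let \<gamma> = shift L \<beta> m in
          shift L \<gamma> ` {1..} \<subseteq> R_in L M \<and> shift L \<gamma> ` {..0} \<subseteq> R_ln L M
          \<and> shift L (- \<gamma>) ` {t..} \<subseteq> R_in L M \<and> shift L (- \<gamma>) ` {..t - 1} \<subseteq> R_ln L M))
    \<and> (up_nilpotent_hybrid L M \<beta> \<longleftrightarrow>
        (\<exists>m. \<exists>t \<in> {- 1, 0, 1}. let \<eta> = shift L \<beta> m in
          shift L \<eta> ` {..- 1} \<subseteq> R_in L M \<and> shift L \<eta> ` {0..} \<subseteq> R_ln L M
          \<and> shift L (- \<eta>) ` {..- t} \<subseteq> R_in L M \<and> shift L (- \<eta>) ` {1 - t..} \<subseteq> R_ln L M))"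
  proof (intro conjI)
    show "full_locally_nilpotent L M \<beta> \<or> full_injective L M \<beta>
      \<or> down_nilpotent_hybrid L M \<beta> \<or> up_nilpotent_hybrid L M \<beta>"
      using hybrid(1) full by blast
    show "down_nilpotent_hybrid L M \<beta> \<longleftrightarrow>
        (\<exists>m. \<exists>t \<in> {- 1, 0, 1}. let \<gamma> = shift L \<beta> m in
          shift L \<gamma> ` {1..} \<subseteq> R_in L M \<and> shift L \<gamma> ` {..0} \<subseteq> R_ln L M
          \<and> shift L (- \<gamma>) ` {t..} \<subseteq> R_in L M \<and> shift L (- \<gamma>) ` {..t - 1} \<subseteq> R_ln L M)"
      unfolding Let_def image_subset_iff shift_shift A B atLeast_iff atMost_iff Ball_def[of "{_..}"]
        Ball_def[of "{.._}"] by (rule hybrid(2))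
    show "up_nilpotent_hybrid L M \<beta> \<longleftrightarrow>
        (\<exists>m. \<exists>t \<in> {- 1, 0, 1}. let \<eta> = shift L \<beta> m in
          shift L \<eta> ` {..- 1} \<subseteq> R_in L M \<and> shift L \<eta> ` {0..} \<subseteq> R_ln L M
          \<and> shift L (- \<eta>) ` {..- t} \<subseteq> R_in L M \<and> shift L (- \<eta>) ` {1 - t..} \<subseteq> R_ln L M)"
      unfolding Let_def image_subset_iff shift_shift A B atLeast_iff atMost_iff Ball_def[of "{_..}"]
        Ball_def[of "{.._}"] by (rule hybrid(3))
  qed (simp_all add: full_locally_nilpotent_def full_injective_def)
qed

end
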